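(* Let $m\in\mathbb N$, let $\Psi_1,\ldots,\Psi_m$ be bounded sets of positive kernel operators on $L^2(X,\mu)$, and let $r\in\{\rho,\hat\rho\}$. If $m$ is even, then $$\big\|\Psi_1^{(\frac1m)}\circ\cdots\circ\Psi_m^{(\frac1m)}\big\|\le\big(r(\Psi_1^*\Psi_2\Psi_3^*\Psi_4\cdots\Psi_{m-1}^*\Psi_m)\,r(\Psi_1\Psi_2^*\Psi_3\Psi_4^*\cdots\Psi_{m-1}\Psi_m^* )\big)^{\frac1{2m}}$$ $$=\big(r(\Psi_1^*\Psi_2\Psi_3^*\Psi_4\cdots\Psi_{m-1}^*\Psi_m)\,r(\Psi_m\Psi_{m-1}^*\cdots\Psi_4\Psi_3^*\Psi_2\Psi_1^* )\big)^{\frac1{2m}}.$$ If $m$ is odd, then $$\big\|\Psi_1^{(\frac1m)}\circ\cdots\circ\Psi_m^{(\frac1m)}\big\|\le r\big(\Psi_1\Psi_2^*\Psi_3\Psi_4^*\cdots\Psi_{m-2}\Psi_{m-1}^*\Psi_m\Psi_1^*\Psi_2\Psi_3^*\Psi_4\cdots\Psi_{m-2}^*\Psi_{m-1}\Psi_m^*\big)^{\frac1{2m}},$$ where the product on the right consists of $2m$ factors with indices $1,2,\ldots,m,1,2,\ldots,m$, in which every second factor (starting with the second) carries the star.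
   Context: $(X,\mathfrak M,\mu)$ is a nonempty set with a $\sigma$-finite positive measure and $L^2(X,\mu)$ is the complex Hilbert space. A linear operator $A$ on it is positive if it maps a.e. nonnegative functions to a.e. nonnegative functions (then it is bounded). It is a kernel operator if there is a $\mu\times\mu$-measurable $a$ on $X\times X$ such that for all $f\in L^2(X,\mu)$ and almost all $x$, $\int_X|a(x,y)f(y)|\,d\mu(y)<\infty$ and $(Af)(x)=\int_X a(x,y)f(y)\,d\mu(y)$. For positive kernel operators $A_1,\ldots,A_m$ with kernels $a_1,\ldots,a_m$ and positive $\alpha_j$ with $\sum_j\alpha_j=1$, $A_1^{(\alpha_1)}\circ\cdots\circ A_m^{(\alpha_m)}$ is the positive kernel operator with kernel $a_1(x,y)^{\alpha_1}\cdots a_m(x,y)^{\alpha_m}$. For bounded sets of operators: $\Psi_1\cdots\Psi_k=\{A_1\cdots A_k: A_i\in\Psi_i\}$, $\Sigma^k=\{A_1\cdots A_k:A_i\in\Sigma\}$, $\Psi^*=\{A^*:A\in\Psi\}$ ($A^*$ the Hilbert space adjoint), $\|\Psi\|=\sup_{A\in\Psi}\|A\|$, and $\Psi_1^{(\alpha_1)}\circ\cdots\circ\Psi_m^{(\alpha_m)}=\{A_1^{(\alpha_1)}\circ\cdots\circ A_m^{(\alpha_m)}:A_j\in\Psi_j\}$ (elements chosen independently from each factor). With $\rho(A)$ the spectral radius of an operator, for a bounded set $\Sigma$ of bounded operators: $\rho(\Sigma)=\limsup_{k\to\infty}[\sup_{A\in\Sigma^k}\rho(A)]^{1/k}$ and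 $\hat\rho(\Sigma)=\lim_{k\to\infty}[\sup_{A\in\Sigma^k}\|A\|]^{1/k}$. *)

theory Defs
  imports "HOL-Analysis.Analysis"
begin

text \<open>
  Elements of $L^2$ are represented by square-integrable functions, and almost everywhere equal
  functions are identified by having all notions below depend on them only up to equality almost
  everywhere.  An operator is accordingly a map on functions which respects equality almost
  everywhere; its values outside of the space of square-integrable functions are irrelevant.
\<close>

type_synonym 'a l2op = "('a \<Rightarrow> complex) \<Rightarrow> ('a \<Rightarrow> complex)"

definition l2 :: "'a measure \<Rightarrow> ('a \<Rightarrow> complex) set" where
  "l2 M = {f \<in> borel_measurable M. integrable M (\<lambda>x. (cmod (f x))\<^sup>2)}"

definition l2_norm :: "'a measure \<Rightarrow> ('a \<Rightarrow> complex) \<Rightarrow> real" where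
  "l2_norm M f = sqrt (\<integral>x. (cmod (f x))\<^sup>2 \<partial>M)"

definition l2_inner :: "'a measure \<Rightarrow> ('a \<Rightarrow> complex) \<Rightarrow> ('a \<Rightarrow> complex) \<Rightarrow> complex" where
  "l2_inner M f g = (\<integral>x. f x * cnj (g x) \<partial>M)"

definition l2_operator :: "'a measure \<Rightarrow> 'a l2op \<Rightarrow> bool" where
  "l2_operator M A \<longleftrightarrow>
     (\<forall>f\<in>l2 M. A f \<in> l2 M) \<and>
     (\<forall>f\<in>l2 M. \<forall>g\<in>l2 M. (AE x in M. f x = g x) \<longrightarrow> (AE x in M. A f x = A g x)) \<and>
     (\<forall>f\<in>l2 M. \<forall>g\<in>l2 M. AE x in M. A (\<lambda>y. f y + g y) x = A f x + A g x) \<and>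
     (\<forall>c. \<forall>f\<in>l2 M. AE x in M. A (\<lambda>y. c * f y) x = c * A f x)"

definition bounded_operator_set :: "'a measure \<Rightarrow> 'a l2op set \<Rightarrow> bool" where
  "bounded_operator_set M \<Psi> \<longleftrightarrow>
     (\<forall>A\<in>\<Psi>. l2_operator M A) \<and>
     (\<exists>C. \<forall>A\<in>\<Psi>. \<forall>f\<in>l2 M. l2_norm M (A f) \<le> C * l2_norm M f)"

definition op_norm :: "'a measure \<Rightarrow> 'a l2op \<Rightarrow> real" where
  "op_norm M A = Sup {l2_norm M (A f) | f. f \<in> l2 M \<and> l2_norm M f \<le> 1}"

definition op_spectrum :: "'a measure \<Rightarrow> 'a l2op \<Rightarrow> complex set" where
  "op_spectrum M A = {z. \<not> (\<exists>R. bounded_operator_set M {R} \<and>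
     (\<forall>f\<in>l2 M. (AE x in M. z * R f x - A (R f) x = f x) \<and>
                (AE x in M. R (\<lambda>y. z * f y - A f y) x = f x)))}"

text \<open>
  All suprema below are taken in $[0,\infty)$: inserting $0$ only fixes the value of the supremum
  of the empty set (the spectrum is empty precisely if $L^2$ is trivial).
\<close>

definition op_spectral_radius :: "'a measure \<Rightarrow> 'a l2op \<Rightarrow> real" where
  "op_spectral_radius M A = Sup (insert 0 (cmod ` op_spectrum M A))"

definition set_norm :: "'a measure \<Rightarrow> 'a l2op set \<Rightarrow> real" where
  "set_norm M \<Psi> = Sup (insert 0 (op_norm M ` \<Psi>))"

definition set_prod :: "'a l2op set list \<Rightarrow> 'a l2op set" where
  "set_prod \<Psi>s = {foldr (\<circ>) As id | As. As \<in> listset \<Psi>s}"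

definition set_power :: "'a l2op set \<Rightarrow> nat \<Rightarrow> 'a l2op set" where
  "set_power \<Sigma> k = set_prod (replicate k \<Sigma>)"

text \<open>
  An adjoint is only determined up to equality almost everywhere of its values; the set below
  contains all representatives of the adjoints of the members of \<open>\<Psi>\<close>.
\<close>

definition set_adjoint :: "'a measure \<Rightarrow> 'a l2op set \<Rightarrow> 'a l2op set" where
  "set_adjoint M \<Psi> = {B. l2_operator M B \<and>
     (\<exists>A\<in>\<Psi>. \<forall>f\<in>l2 M. \<forall>g\<in>l2 M. l2_inner M (A f) g = l2_inner M f (B g))}"

definition generalized_spectral_radius :: "'a measure \<Rightarrow> 'a l2op set \<Rightarrow> real" where
  "generalized_spectral_radius M \<Sigma> =
     real_of_ereal (limsup (\<lambda>k. ereal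
       (root k (Sup (insert 0 (op_spectral_radius M ` set_power \<Sigma> k))))))"

definition joint_spectral_radius :: "'a measure \<Rightarrow> 'a l2op set \<Rightarrow> real" where
  "joint_spectral_radius M \<Sigma> = lim (\<lambda>k. root k (set_norm M (set_power \<Sigma> k)))"

definition positive_operator :: "'a measure \<Rightarrow> 'a l2op \<Rightarrow> bool" where
  "positive_operator M A \<longleftrightarrow> l2_operator M A \<and>
     (\<forall>f\<in>l2 M. (AE x in M. f x \<in> \<real>\<^sub>\<ge>\<^sub>0) \<longrightarrow> (AE x in M. A f x \<in> \<real>\<^sub>\<ge>\<^sub>0))"

definition has_kernel :: "'a measure \<Rightarrow> 'a l2op \<Rightarrow> ('a \<times> 'a \<Rightarrow> complex) \<Rightarrow> bool" where
  "has_kernel M A a \<longleftrightarrow> l2_operator M A \<and> a \<in> borel_measurable (M \<Otimes>\<^sub>M M) \<and>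
     (\<forall>f\<in>l2 M. AE x in M.
        integrable M (\<lambda>y. a (x, y) * f y) \<and> A f x = (\<integral>y. a (x, y) * f y \<partial>M))"

definition positive_kernel_operator :: "'a measure \<Rightarrow> 'a l2op \<Rightarrow> bool" where
  "positive_kernel_operator M A \<longleftrightarrow> positive_operator M A \<and> (\<exists>a. has_kernel M A a)"

text \<open>
  The kernel of a positive kernel operator is unique and nonnegative up to null sets of the product
  measure, so it can be chosen to be nonnegative everywhere, and the weighted geometric mean does
  not depend on this choice.  As for adjoints, all representatives of the mean are collected.
\<close>

definition is_geometric_mean ::
    "'a measure \<Rightarrow> nat \<Rightarrow> (nat \<Rightarrow> real) \<Rightarrow> (nat \<Rightarrow> 'a l2op) \<Rightarrow> 'a l2op \<Rightarrow> bool" where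
  "is_geometric_mean M m \<alpha> A C \<longleftrightarrow> positive_kernel_operator M C \<and>
     (\<exists>a :: nat \<Rightarrow> 'a \<times> 'a \<Rightarrow> real.
        (\<forall>j\<in>{1..m}. (\<forall>p. 0 \<le> a j p) \<and> has_kernel M (A j) (\<lambda>p. complex_of_real (a j p))) \<and>
        has_kernel M C (\<lambda>p. complex_of_real (\<Prod>j=1..m. a j p powr \<alpha> j)))"

definition set_geometric_mean ::
    "'a measure \<Rightarrow> nat \<Rightarrow> (nat \<Rightarrow> real) \<Rightarrow> (nat \<Rightarrow> 'a l2op set) \<Rightarrow> 'a l2op set" where
  "set_geometric_mean M m \<alpha> \<Psi> =
     {C. \<exists>A. (\<forall>j\<in>{1..m}. A j \<in> \<Psi> j) \<and> is_geometric_mean M m \<alpha> A C}"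

text \<open>The factors $\Psi_i$, for \<open>i\<close> running through a list, where those with \<open>S i\<close> carry a star.\<close>

definition starred_factors ::
    "'a measure \<Rightarrow> (nat \<Rightarrow> bool) \<Rightarrow> (nat \<Rightarrow> 'a l2op set) \<Rightarrow> nat list \<Rightarrow> 'a l2op set list" where
  "starred_factors M S \<Psi> is = map (\<lambda>i. if S i then set_adjoint M (\<Psi> i) else \<Psi> i) is"

end

(*
  For a geometric mean C of A_1, ..., A_m with equal weights, Hoelder's inequality gives
  C (f_1 ... f_m)^(1/m) <= ((A_1 f_1) ... (A_m f_m))^(1/m) pointwise for nonnegative functions, and
  the factors on the right may be taken in any order.  Applying C and C* alternately to f and shifting
  the order cyclically from step to step, one dominates ... C C* C f by the geometric mean of m columns,
  in each of which A_j, A_(j-1)*, A_(j-2), ... are applied in turn (indices modulo m).  Up to a bounded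
  number of factors at both ends, a column is a power of an element of one of the sets on the right-hand
  side, so it grows no faster than the radius r of that set.  On the other hand, the norms of the vectors
  f, C f, C* C f, C C* C f, ... form a log-convex sequence, so the n-th one is at least |C f|^n
  if |f| <= 1.  For the generalized spectral radius, the growth of powers of an operator is read off from
  its spectrum by Gelfand's formula.  The equality of the two right-hand sides for even m holds since
  operators and their adjoints have powers of equal norm.
*)
theory Submission
  imports Defs "HOL-Complex_Analysis.Complex_Analysis"
begin

subsection \<open>Square-integrable functions\<close>

text \<open>The generalized radius sees only the spectra of products, not their norms. Fixing all
  operators before iterating removes this obstacle: C comes from one tuple A_1, ..., A_m, so each
  column repeats one word B, a single member of the set on the right. Only powers of B matter, and
  for either radius r their norms are O(s^n) for every s > r, without any comparison of the two
  radii. The parity of m governs the stars. At step p column j applies the operator of index j - p,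
  starred if p is odd. For even m, j and the index determine the parity of p, so the period is m and
  the parity of j selects one of two words. For odd m the stars are exchanged after m steps, so the
  period is 2m and all columns repeat the same word up to rotation: hence a single radius. Adjoints
  are built twice. The inequality needs transposed kernels, so that the adjoint of C is again a
  geometric mean; they come from Tonelli and Fubini. The equality of the right-hand sides concerns
  every member of the sets, treated merely as a bounded operator, whose adjoint comes from Riesz
  representation.\<close>

lemma l2_measurable [measurable_dest]: "f \<in> l2 M \<Longrightarrow> f \<in> borel_measurable M"
  by (simp add: l2_def)

lemma borel_measurable_cnj [measurable]: "cnj \<in> borel_measurable borel"
  by (intro borel_measurable_continuous_onI continuous_intros)

lemma l2_integrable: "f \<in> l2 M \<Longrightarrow> integrable M (\<lambda>x. (cmod (f x))\<^sup>2)"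
  by (simp add: l2_def)

lemma l2_norm_nonneg [simp]: "0 \<le> l2_norm M f"
  by (simp add: l2_norm_def)

lemma l2_norm_square: "(l2_norm M f)\<^sup>2 = (\<integral>x. (cmod (f x))\<^sup>2 \<partial>M)"
  by (simp add: l2_norm_def)

lemma l2_dominated:
  assumes f: "f \<in> borel_measurable M" and g: "g \<in> l2 M" and le: "AE x in M. cmod (f x) \<le> cmod (g x)"
  shows "f \<in> l2 M" "l2_norm M f \<le> l2_norm M g"
proof -
  have le2: "AE x in M. (cmod (f x))\<^sup>2 \<le> (cmod (g x))\<^sup>2"
    using le by eventually_elim (simp add: power_mono)
  have i: "integrable M (\<lambda>x. (cmod (f x))\<^sup>2)"
    by (rule Bochner_Integration.integrable_bound[OF l2_integrable[OF g]]) (use f le2 in auto)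
  show "f \<in> l2 M" using i f by (simp add: l2_def)
  show "l2_norm M f \<le> l2_norm M g" unfolding l2_norm_def
    by (intro real_sqrt_le_mono integral_mono_AE i l2_integrable[OF g] le2)
qed

lemma l2_norm_cong_AE:
  assumes "f \<in> l2 M" "g \<in> l2 M" "AE x in M. f x = g x"
  shows "l2_norm M f = l2_norm M g"
proof (rule antisym)
  have "AE x in M. cmod (f x) \<le> cmod (g x)" "AE x in M. cmod (g x) \<le> cmod (f x)"
    using assms(3) by (eventually_elim, simp)+
  then show "l2_norm M f \<le> l2_norm M g" "l2_norm M g \<le> l2_norm M f"
    using assms(1,2) by (auto intro: l2_dominated(2))
qed

lemma l2_norm_eq_0:
  assumes "f \<in> l2 M"
  shows "l2_norm M f = 0 \<longleftrightarrow> (AE x in M. f x = 0)"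
  using integral_nonneg_eq_0_iff_AE[OF l2_integrable[OF assms]] by (simp add: l2_norm_def)

lemma l2_zero [simp]: "(\<lambda>x. 0) \<in> l2 M" "l2_norm M (\<lambda>x. 0) = 0"
  by (simp_all add: l2_def l2_norm_def)

lemma l2_add:
  assumes f: "f \<in> l2 M" and g: "g \<in> l2 M"
  shows "(\<lambda>x. f x + g x) \<in> l2 M"
proof -
  have "(cmod (f x + g x))\<^sup>2 \<le> 2 * (cmod (f x))\<^sup>2 + 2 * (cmod (g x))\<^sup>2" for x
  proof -
    have "(cmod (f x + g x))\<^sup>2 \<le> (cmod (f x) + cmod (g x))\<^sup>2"
      by (intro power_mono norm_triangle_ineq) auto
    also have "\<dots> \<le> 2 * (cmod (f x))\<^sup>2 + 2 * (cmod (g x))\<^sup>2"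
      using sum_squares_bound[of "cmod (f x)" "cmod (g x)"] by (simp add: power2_sum)
    finally show ?thesis .
  qed
  then have "integrable M (\<lambda>x. (cmod (f x + g x))\<^sup>2)"
    using f g by - (rule Bochner_Integration.integrable_bound[where
        f="\<lambda>x. 2 * (cmod (f x))\<^sup>2 + 2 * (cmod (g x))\<^sup>2"], auto simp: l2_def)
  then show ?thesis using l2_measurable[OF f] l2_measurable[OF g] by (simp add: l2_def)
qed

lemma l2_scale: "f \<in> l2 M \<Longrightarrow> (\<lambda>x. c * f x) \<in> l2 M"
  by (auto simp: l2_def norm_mult power_mult_distrib)

lemma l2_norm_scale: "l2_norm M (\<lambda>x. c * f x) = cmod c * l2_norm M f"
  by (simp add: l2_norm_def norm_mult power_mult_distrib real_sqrt_mult)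

lemma l2_diff: "f \<in> l2 M \<Longrightarrow> g \<in> l2 M \<Longrightarrow> (\<lambda>x. f x - g x) \<in> l2 M"
  using l2_add[OF _ l2_scale[of g M "-1"], of f] by simp

lemma l2_sum: "finite I \<Longrightarrow> (\<And>i. i \<in> I \<Longrightarrow> f i \<in> l2 M) \<Longrightarrow> (\<lambda>x. \<Sum>i\<in>I. f i x) \<in> l2 M"
  by (induction I rule: finite_induct) (auto intro!: l2_add)

lemma l2_cmod:
  assumes "f \<in> l2 M"
  shows "(\<lambda>x. complex_of_real (cmod (f x))) \<in> l2 M" "l2_norm M (\<lambda>x. complex_of_real (cmod (f x))) = l2_norm M f"
  using assms by (auto simp: l2_def l2_norm_def)

lemma l2_mult_integrable:
  assumes f: "f \<in> l2 M" and g: "g \<in> l2 M"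
  shows "integrable M (\<lambda>x. cmod (f x) * cmod (g x))"
proof -
  have "norm (cmod (f x) * cmod (g x)) \<le> norm ((cmod (f x))\<^sup>2 + (cmod (g x))\<^sup>2)" for x
  proof -
    have "0 \<le> cmod (f x) * cmod (g x)" by simp
    then have "cmod (f x) * cmod (g x) \<le> (cmod (f x))\<^sup>2 + (cmod (g x))\<^sup>2"
      using sum_squares_bound[of "cmod (f x)" "cmod (g x)"] by linarith
    then show ?thesis by simp
  qed
  then show ?thesis
    using f g by - (rule Bochner_Integration.integrable_bound[where
        f="\<lambda>x. (cmod (f x))\<^sup>2 + (cmod (g x))\<^sup>2"], auto simp: l2_def)
qed

lemma l2_Cauchy_Schwarz:
  assumes f: "f \<in> l2 M" and g: "g \<in> l2 M"
  shows "(\<integral>x. cmod (f x) * cmod (g x) \<partial>M) \<le> l2_norm M f * l2_norm M g"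
proof -
  note [measurable] = l2_measurable[OF f] l2_measurable[OF g]
  let ?I = "\<integral>x. cmod (f x) * cmod (g x) \<partial>M"
  have "ennreal (?I\<^sup>2) = (\<integral>\<^sup>+x. ennreal (cmod (f x)) * ennreal (cmod (g x)) \<partial>M)\<^sup>2"
    using nn_integral_eq_integral[OF l2_mult_integrable[OF f g]]
    by (simp add: ennreal_mult ennreal_power)
  also have "\<dots> \<le> (\<integral>\<^sup>+x. (ennreal (cmod (f x)))\<^sup>2 \<partial>M) * (\<integral>\<^sup>+x. (ennreal (cmod (g x)))\<^sup>2 \<partial>M)"
    by (rule Cauchy_Schwarz_nn_integral) auto
  also have "\<dots> = ennreal ((l2_norm M f * l2_norm M g)\<^sup>2)"
    using nn_integral_eq_integral[OF l2_integrable[OF f]] nn_integral_eq_integral[OF l2_integrable[OF g]]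
    by (simp add: ennreal_power l2_norm_square power_mult_distrib ennreal_mult)
  finally have "?I\<^sup>2 \<le> (l2_norm M f * l2_norm M g)\<^sup>2"
    by (simp add: ennreal_le_iff)
  then show ?thesis
    by (rule power2_le_imp_le) simp
qed

lemma l2_inner_integrable:
  assumes f: "f \<in> l2 M" and g: "g \<in> l2 M"
  shows "integrable M (\<lambda>x. f x * cnj (g x))"
proof (rule Bochner_Integration.integrable_bound[OF l2_mult_integrable[OF f g]])
  show "(\<lambda>x. f x * cnj (g x)) \<in> borel_measurable M"
    using l2_measurable[OF f] l2_measurable[OF g] by measurable
qed (simp add: norm_mult)

lemma l2_inner_le:
  assumes f: "f \<in> l2 M" and g: "g \<in> l2 M"
  shows "cmod (l2_inner M f g) \<le> l2_norm M f * l2_norm M g"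
proof -
  have "cmod (l2_inner M f g) \<le> (\<integral>x. cmod (f x * cnj (g x)) \<partial>M)"
    unfolding l2_inner_def by (rule integral_norm_bound)
  also have "\<dots> \<le> l2_norm M f * l2_norm M g"
    using l2_Cauchy_Schwarz[OF f g] by (simp add: norm_mult)
  finally show ?thesis .
qed

lemma l2_inner_self: "l2_inner M f f = complex_of_real ((l2_norm M f)\<^sup>2)"
  unfolding l2_inner_def l2_norm_square
  by (simp add: complex_norm_square[symmetric] del: of_real_power integral_complex_of_real
      flip: integral_complex_of_real)

lemma l2_inner_add_left:
  "f \<in> l2 M \<Longrightarrow> g \<in> l2 M \<Longrightarrow> h \<in> l2 M \<Longrightarrow>
    l2_inner M (\<lambda>x. f x + g x) h = l2_inner M f h + l2_inner M g h"
  by (simp add: l2_inner_def distrib_right l2_inner_integrable)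

lemma l2_inner_diff_left:
  "f \<in> l2 M \<Longrightarrow> g \<in> l2 M \<Longrightarrow> h \<in> l2 M \<Longrightarrow>
    l2_inner M (\<lambda>x. f x - g x) h = l2_inner M f h - l2_inner M g h"
  by (simp add: l2_inner_def left_diff_distrib l2_inner_integrable)

lemma l2_inner_scale_left: "l2_inner M (\<lambda>x. c * f x) g = c * l2_inner M f g"
  by (simp add: l2_inner_def mult.assoc)

lemma l2_inner_cnj: "cnj (l2_inner M f g) = l2_inner M g f"
  unfolding l2_inner_def
  by (rule trans[OF Bochner_Integration.integral_cnj[symmetric]], rule Bochner_Integration.integral_cong) auto

lemma l2_inner_cong_AE:
  assumes "f \<in> l2 M" "f' \<in> l2 M" "g \<in> l2 M" "AE x in M. f x = f' x"
  shows "l2_inner M f g = l2_inner M f' g"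
  unfolding l2_inner_def
proof (rule integral_cong_AE)
  note [measurable] = assms(1-3)[THEN l2_measurable]
  show "(\<lambda>x. f x * cnj (g x)) \<in> borel_measurable M" "(\<lambda>x. f' x * cnj (g x)) \<in> borel_measurable M"
    by measurable
qed (use assms(4) in auto)

lemma l2_norm_triangle:
  assumes f: "f \<in> l2 M" and g: "g \<in> l2 M"
  shows "l2_norm M (\<lambda>x. f x + g x) \<le> l2_norm M f + l2_norm M g"
proof -
  note fg = l2_add[OF f g]
  let ?h = "\<lambda>x. f x + g x"
  have "complex_of_real ((l2_norm M ?h)\<^sup>2) = l2_inner M f ?h + l2_inner M g ?h"
    using l2_inner_add_left[OF f g fg] by (simp only: l2_inner_self)
  then have "(l2_norm M ?h)\<^sup>2 \<le> cmod (l2_inner M f ?h + l2_inner M g ?h)"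
    by (metis norm_of_real abs_ge_self)
  also have "\<dots> \<le> cmod (l2_inner M f ?h) + cmod (l2_inner M g ?h)"
    by (rule norm_triangle_ineq)
  also have "\<dots> \<le> l2_norm M f * l2_norm M ?h + l2_norm M g * l2_norm M ?h"
    by (intro add_mono l2_inner_le f g fg)
  finally have "l2_norm M ?h * l2_norm M ?h \<le> (l2_norm M f + l2_norm M g) * l2_norm M ?h"
    by (simp add: power2_eq_square distrib_right)
  then show ?thesis
    by (smt (verit) l2_norm_nonneg mult_right_le_imp_le)
qed

lemma l2_norm_triangle_diff:
  assumes "f \<in> l2 M" "g \<in> l2 M"
  shows "l2_norm M (\<lambda>x. f x - g x) \<le> l2_norm M f + l2_norm M g"
  using l2_norm_triangle[OF assms(1) l2_scale[OF assms(2), of "-1"]] l2_norm_scale[of M "-1" g] by simp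

lemma l2_norm_sum:
  assumes "finite I" "\<And>i. i \<in> I \<Longrightarrow> f i \<in> l2 M"
  shows "l2_norm M (\<lambda>x. \<Sum>i\<in>I. f i x) \<le> (\<Sum>i\<in>I. l2_norm M (f i))"
  using assms
proof (induction I rule: finite_induct)
  case (insert i I)
  then show ?case
    using l2_norm_triangle[of "f i" M "\<lambda>x. \<Sum>i\<in>I. f i x"] l2_sum[of I f M] by (simp; fastforce)
qed simp

text \<open>Completeness of L^2, in the form in which the Neumann series and the Riesz minimizer
  need it. Monotone convergence is applied to the squares of the partial sums of |f n|, whose norms
  stay below \<open>suminf b\<close>.\<close>

lemma l2_series:
  fixes f :: "nat \<Rightarrow> 'a \<Rightarrow> complex"
  assumes f: "\<And>n. f n \<in> l2 M" and b: "\<And>n. l2_norm M (f n) \<le> b n" and sb: "summable b"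
  shows "AE x in M. summable (\<lambda>n. cmod (f n x))"
    and "(\<lambda>x. \<Sum>n. f n x) \<in> l2 M"
    and "l2_norm M (\<lambda>x. \<Sum>n. f n x) \<le> suminf b"
proof -
  note [measurable] = l2_measurable[OF f]
  have b0: "0 \<le> b n" for n using b[of n] l2_norm_nonneg[of M "f n"] by linarith
  define S where "S N x = (\<Sum>n<N. complex_of_real (cmod (f n x)))" for N x
  have S: "S N \<in> l2 M" for N
    unfolding S_def using f l2_cmod by (intro l2_sum) auto
  have Sn: "l2_norm M (S N) \<le> suminf b" for N
  proof -
    have "l2_norm M (S N) \<le> (\<Sum>n<N. l2_norm M (f n))"
      using l2_norm_sum[of "{..<N}" "\<lambda>n x. complex_of_real (cmod (f n x))" M]
      unfolding S_def by (simp add: l2_cmod f)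
    also have "\<dots> \<le> (\<Sum>n<N. b n)" by (intro sum_mono b)
    also have "\<dots> \<le> suminf b" using b0 sb by (intro sum_le_suminf) auto
    finally show ?thesis .
  qed
  \<comment> \<open>H serves twice: its finiteness almost everywhere gives absolute convergence, and
    its integral bounds the squared norm of the sum.\<close>
  define H where "H x = (SUP N. ennreal ((cmod (S N x))\<^sup>2))" for x
  have [measurable]: "S N \<in> borel_measurable M" for N using S by (rule l2_measurable)
  have [measurable]: "H \<in> borel_measurable M" unfolding H_def by measurable
  have cS: "cmod (S N x) = (\<Sum>n<N. cmod (f n x))" for N x
    unfolding S_def by (simp add: sum_nonneg flip: of_real_sum)
  have H: "(\<integral>\<^sup>+x. H x \<partial>M) \<le> ennreal ((suminf b)\<^sup>2)"
  proof -
    have inc: "incseq (\<lambda>N x. ennreal ((cmod (S N x))\<^sup>2))"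
      unfolding cS by (intro incseq_SucI le_funI ennreal_leI power_mono) (auto intro: sum_nonneg)
    have "(\<integral>\<^sup>+x. H x \<partial>M) = (SUP N. \<integral>\<^sup>+x. ennreal ((cmod (S N x))\<^sup>2) \<partial>M)"
      unfolding H_def by (intro nn_integral_monotone_convergence_SUP inc) measurable
    also have "\<dots> \<le> ennreal ((suminf b)\<^sup>2)"
    proof (rule SUP_least)
      fix N
      have "(\<integral>\<^sup>+x. ennreal ((cmod (S N x))\<^sup>2) \<partial>M) = ennreal ((l2_norm M (S N))\<^sup>2)"
        using nn_integral_eq_integral[OF l2_integrable[OF S[of N]]] by (simp add: l2_norm_square)
      also have "\<dots> \<le> ennreal ((suminf b)\<^sup>2)"
        using Sn[of N] by (intro ennreal_leI power_mono) auto
      finally show "(\<integral>\<^sup>+x. ennreal ((cmod (S N x))\<^sup>2) \<partial>M) \<le> ennreal ((suminf b)\<^sup>2)" .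
    qed
    finally show ?thesis .
  qed
  then have "(\<integral>\<^sup>+x. H x \<partial>M) \<noteq> \<infinity>"
    by (auto simp: top_unique)
  then have "AE x in M. H x \<noteq> \<infinity>"
    by (intro nn_integral_PInf_AE) auto
  then have bnd: "AE x in M. \<forall>N. (\<Sum>n<N. cmod (f n x)) \<le> sqrt (enn2real (H x))"
  proof eventually_elim
    case (elim x)
    show ?case
    proof
      fix N
      have "ennreal ((cmod (S N x))\<^sup>2) \<le> H x" unfolding H_def by (rule SUP_upper) simp
      also have "H x = ennreal (enn2real (H x))" using elim by (simp add: less_top)
      finally have "(cmod (S N x))\<^sup>2 \<le> enn2real (H x)" by (simp add: ennreal_le_iff)
      then show "(\<Sum>n<N. cmod (f n x)) \<le> sqrt (enn2real (H x))"
        unfolding cS[symmetric] by (rule real_le_rsqrt)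
    qed
  qed
  then show sm: "AE x in M. summable (\<lambda>n. cmod (f n x))"
    by eventually_elim (auto intro: summableI_nonneg_bounded)
  define F where "F x = (\<Sum>n. f n x)" for x
  have [measurable]: "F \<in> borel_measurable M" unfolding F_def by measurable
  have "AE x in M. ennreal ((cmod (F x))\<^sup>2) \<le> H x"
    using sm bnd
  proof eventually_elim
    case (elim x)
    have "cmod (F x) \<le> (\<Sum>n. cmod (f n x))" unfolding F_def by (rule summable_norm[OF elim(1)])
    also have "\<dots> \<le> sqrt (enn2real (H x))" using elim by (intro suminf_le_const) auto
    finally have "(cmod (F x))\<^sup>2 \<le> (sqrt (enn2real (H x)))\<^sup>2" by (intro power_mono) auto
    then have "ennreal ((cmod (F x))\<^sup>2) \<le> ennreal (enn2real (H x))" by (simp add: ennreal_leI)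
    also have "\<dots> \<le> H x" by (cases "H x") auto
    finally show ?case .
  qed
  then have "(\<integral>\<^sup>+x. ennreal ((cmod (F x))\<^sup>2) \<partial>M) \<le> (\<integral>\<^sup>+x. H x \<partial>M)"
    by (rule nn_integral_mono_AE)
  with H have le: "(\<integral>\<^sup>+x. ennreal ((cmod (F x))\<^sup>2) \<partial>M) \<le> ennreal ((suminf b)\<^sup>2)"
    by (meson order_trans)
  have i: "integrable M (\<lambda>x. (cmod (F x))\<^sup>2)"
    by (rule integrableI_bounded) (use le in \<open>auto intro: le_less_trans\<close>)
  then have "F \<in> l2 M" by (simp add: l2_def)
  then show "(\<lambda>x. \<Sum>n. f n x) \<in> l2 M" unfolding F_def .
  have "(l2_norm M F)\<^sup>2 \<le> (suminf b)\<^sup>2"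
    using le nn_integral_eq_integral[OF i] by (simp add: l2_norm_square ennreal_le_iff)
  then have "l2_norm M F \<le> suminf b"
    by (rule power2_le_imp_le) (use b0 sb in \<open>auto intro: suminf_nonneg\<close>)
  then show "l2_norm M (\<lambda>x. \<Sum>n. f n x) \<le> suminf b" unfolding F_def .
qed

subsection \<open>Bounded operators\<close>

lemma l2_operatorD:
  assumes "l2_operator M A" and f: "f \<in> l2 M"
  shows l2_operator_closed: "A f \<in> l2 M"
    and l2_operator_cong: "\<And>g. g \<in> l2 M \<Longrightarrow> AE x in M. f x = g x \<Longrightarrow> AE x in M. A f x = A g x"
    and l2_operator_add: "\<And>g. g \<in> l2 M \<Longrightarrow> AE x in M. A (\<lambda>y. f y + g y) x = A f x + A g x"
    and l2_operator_scale: "AE x in M. A (\<lambda>y. c * f y) x = c * A f x"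
  using assms unfolding l2_operator_def by blast+

lemma l2_operator_diff:
  assumes A: "l2_operator M A" and f: "f \<in> l2 M" and g: "g \<in> l2 M"
  shows "AE x in M. A (\<lambda>y. f y - g y) x = A f x - A g x"
  using l2_operator_add[OF A f l2_scale[OF g, of "-1"]] l2_operator_scale[OF A g, of "-1"]
  by (auto elim: AE_mp)

lemma l2_operator_sum:
  assumes A: "l2_operator M A" and "finite I" and "\<And>i. i \<in> I \<Longrightarrow> f i \<in> l2 M"
  shows "AE x in M. A (\<lambda>y. \<Sum>i\<in>I. f i y) x = (\<Sum>i\<in>I. A (f i) x)"
  using assms(2,3)
proof (induction I rule: finite_induct)
  case empty
  then show ?case using l2_operator_scale[OF A l2_zero(1), of 0] by simp
next
  case (insert i I)
  then have "AE x in M. A (\<lambda>y. \<Sum>i\<in>I. f i y) x = (\<Sum>i\<in>I. A (f i) x)" by simp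
  moreover have "AE x in M. A (\<lambda>y. f i y + (\<Sum>i\<in>I. f i y)) x = A (f i) x + A (\<lambda>y. \<Sum>i\<in>I. f i y) x"
    using insert by (intro l2_operator_add[OF A] l2_sum) auto
  ultimately show ?case using insert(1,2) by (auto elim: AE_mp)
qed

lemma l2_operator_id: "l2_operator M id"
  by (simp add: l2_operator_def)

lemma l2_operator_comp:
  assumes A: "l2_operator M A" and B: "l2_operator M B"
  shows "l2_operator M (A \<circ> B)"
  unfolding l2_operator_def
proof (intro conjI ballI allI impI)
  fix f assume f: "f \<in> l2 M"
  note Bf = l2_operator_closed[OF B f]
  show "(A \<circ> B) f \<in> l2 M" using l2_operator_closed[OF A Bf] by simp
  fix c
  from l2_operator_cong[OF A l2_operator_closed[OF B l2_scale[OF f]] l2_scale[OF Bf]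
      l2_operator_scale[OF B f], of c] l2_operator_scale[OF A Bf, of c]
  show "AE x in M. (A \<circ> B) (\<lambda>y. c * f y) x = c * (A \<circ> B) f x"
    by (auto elim: AE_mp)
next
  fix f g assume f: "f \<in> l2 M" and g: "g \<in> l2 M"
  note Bf = l2_operator_closed[OF B f] and Bg = l2_operator_closed[OF B g]
  show "AE x in M. (A \<circ> B) f x = (A \<circ> B) g x" if "AE x in M. f x = g x"
    using l2_operator_cong[OF A Bf Bg l2_operator_cong[OF B f g that]] by simp
  from l2_operator_cong[OF A l2_operator_closed[OF B l2_add[OF f g]] l2_add[OF Bf Bg] l2_operator_add[OF B f g]]
    l2_operator_add[OF A Bf Bg]
  show "AE x in M. (A \<circ> B) (\<lambda>y. f y + g y) x = (A \<circ> B) f x + (A \<circ> B) g x"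
    by (auto elim: AE_mp)
qed

text \<open>An explicit bound instead of the norm lets bounds of composites multiply without
  handling suprema. The sign of K is recorded because it does not follow from the estimate if L^2 is
  trivial.\<close>

definition l2_bounded :: "'a measure \<Rightarrow> 'a l2op \<Rightarrow> real \<Rightarrow> bool" where
  "l2_bounded M A K \<longleftrightarrow> l2_operator M A \<and> 0 \<le> K \<and> (\<forall>f\<in>l2 M. l2_norm M (A f) \<le> K * l2_norm M f)"

lemma l2_bounded_operator: "l2_bounded M A K \<Longrightarrow> l2_operator M A"
  and l2_bounded_nonneg: "l2_bounded M A K \<Longrightarrow> 0 \<le> K"
  and l2_boundedD: "l2_bounded M A K \<Longrightarrow> f \<in> l2 M \<Longrightarrow> l2_norm M (A f) \<le> K * l2_norm M f"
  and l2_bounded_closed: "l2_bounded M A K \<Longrightarrow> f \<in> l2 M \<Longrightarrow> A f \<in> l2 M"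
  by (auto simp: l2_bounded_def l2_operator_closed)

lemma l2_bounded_mono:
  assumes "l2_bounded M A K" and le: "K \<le> L"
  shows "l2_bounded M A L"
proof -
  have "l2_norm M (A f) \<le> L * l2_norm M f" if "f \<in> l2 M" for f
  proof -
    have "l2_norm M (A f) \<le> K * l2_norm M f" using assms that by (simp add: l2_bounded_def)
    also have "\<dots> \<le> L * l2_norm M f" using le by (intro mult_right_mono) auto
    finally show ?thesis .
  qed
  then show ?thesis using assms by (simp add: l2_bounded_def)
qed

lemma l2_bounded_id: "l2_bounded M id 1"
  by (simp add: l2_bounded_def l2_operator_id)

lemma l2_bounded_comp:
  assumes A: "l2_bounded M A K" and B: "l2_bounded M B L"
  shows "l2_bounded M (A \<circ> B) (K * L)"
  unfolding l2_bounded_def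
proof (intro conjI ballI)
  show "l2_operator M (A \<circ> B)" using A B by (simp add: l2_bounded_def l2_operator_comp)
  show "0 \<le> K * L" using A B by (simp add: l2_bounded_def)
  fix f assume f: "f \<in> l2 M"
  have "l2_norm M (A (B f)) \<le> K * l2_norm M (B f)"
    using l2_boundedD[OF A l2_bounded_closed[OF B f]] .
  also have "\<dots> \<le> K * (L * l2_norm M f)"
    using l2_boundedD[OF B f] l2_bounded_nonneg[OF A] by (rule mult_left_mono)
  finally show "l2_norm M ((A \<circ> B) f) \<le> K * L * l2_norm M f" by (simp add: mult.assoc)
qed

lemma l2_bounded_pow: "l2_bounded M A K \<Longrightarrow> l2_bounded M (A ^^ n) (K ^ n)"
  by (induction n) (simp_all add: l2_bounded_id[unfolded id_def] id_def l2_bounded_comp)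

lemma bounded_operator_set_iff:
  "bounded_operator_set M \<Psi> \<longleftrightarrow> (\<exists>K. \<forall>A\<in>\<Psi>. l2_bounded M A K)"
proof
  assume "bounded_operator_set M \<Psi>"
  then obtain C where op: "\<forall>A\<in>\<Psi>. l2_operator M A"
    and C: "\<forall>A\<in>\<Psi>. \<forall>f\<in>l2 M. l2_norm M (A f) \<le> C * l2_norm M f"
    unfolding bounded_operator_set_def by blast
  \<comment> \<open>If L^2 is trivial, the given constant may be negative.\<close>
  have "l2_norm M (A f) \<le> \<bar>C\<bar> * l2_norm M f" if "A \<in> \<Psi>" "f \<in> l2 M" for A f
  proof -
    have "l2_norm M (A f) \<le> C * l2_norm M f" using C that by blast
    also have "\<dots> \<le> \<bar>C\<bar> * l2_norm M f" by (intro mult_right_mono) auto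
    finally show ?thesis .
  qed
  with op have "\<forall>A\<in>\<Psi>. l2_bounded M A \<bar>C\<bar>" by (simp add: l2_bounded_def)
  then show "\<exists>K. \<forall>A\<in>\<Psi>. l2_bounded M A K" ..
qed (auto simp: bounded_operator_set_def l2_bounded_def)

lemma op_norm_leI:
  assumes "\<And>f. f \<in> l2 M \<Longrightarrow> l2_norm M f \<le> 1 \<Longrightarrow> l2_norm M (A f) \<le> K"
  shows "op_norm M A \<le> K"
  unfolding op_norm_def
proof (rule cSup_least)
  show "{l2_norm M (A f) |f. f \<in> l2 M \<and> l2_norm M f \<le> 1} \<noteq> {}"
    using l2_zero[of M] by (auto intro!: exI[of _ "\<lambda>x. 0"])
qed (use assms in auto)

lemma op_norm_le:
  assumes "0 \<le> K" and le: "\<And>f. f \<in> l2 M \<Longrightarrow> l2_norm M (A f) \<le> K * l2_norm M f"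
  shows "op_norm M A \<le> K"
proof (rule op_norm_leI)
  fix f assume "f \<in> l2 M" "l2_norm M f \<le> 1"
  then have "l2_norm M (A f) \<le> K * l2_norm M f" "K * l2_norm M f \<le> K * 1"
    using assms by (auto intro: mult_left_mono simp del: mult_1_right)
  then show "l2_norm M (A f) \<le> K" by simp
qed

lemma op_norm_upper:
  assumes A: "l2_bounded M A K" and f: "f \<in> l2 M" "l2_norm M f \<le> 1"
  shows "l2_norm M (A f) \<le> op_norm M A"
  unfolding op_norm_def
proof (rule cSup_upper)
  show "l2_norm M (A f) \<in> {l2_norm M (A f) |f. f \<in> l2 M \<and> l2_norm M f \<le> 1}" using f by blast
  show "bdd_above {l2_norm M (A f) |f. f \<in> l2 M \<and> l2_norm M f \<le> 1}"
  proof (rule bdd_aboveI)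
    fix y assume "y \<in> {l2_norm M (A f) |f. f \<in> l2 M \<and> l2_norm M f \<le> 1}"
    then obtain g where g: "y = l2_norm M (A g)" "g \<in> l2 M" "l2_norm M g \<le> 1" by blast
    then have "y \<le> K * l2_norm M g" "K * l2_norm M g \<le> K * 1"
      using l2_boundedD[OF A, of g] l2_bounded_nonneg[OF A]
      by (auto intro: mult_left_mono simp del: mult_1_right)
    then show "y \<le> K" by simp
  qed
qed

lemma op_norm_nonneg:
  assumes A: "l2_bounded M A K"
  shows "0 \<le> op_norm M A"
  using op_norm_upper[OF A l2_zero(1)] l2_norm_nonneg[of M "A (\<lambda>x. 0)"]
  by (simp del: l2_norm_nonneg)

lemma op_norm_bound:
  assumes A: "l2_bounded M A K" and f: "f \<in> l2 M"
  shows "l2_norm M (A f) \<le> op_norm M A * l2_norm M f"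
proof (cases "l2_norm M f = 0")
  case True
  then show ?thesis using l2_boundedD[OF A f] by simp
next
  case False
  define c where "c = complex_of_real (1 / l2_norm M f)"
  have c: "cmod c = 1 / l2_norm M f" unfolding c_def by (simp del: of_real_divide)
  have cf: "(\<lambda>x. c * f x) \<in> l2 M" by (rule l2_scale[OF f])
  have "cmod c * l2_norm M (A f) = l2_norm M (\<lambda>x. c * A f x)" by (simp add: l2_norm_scale)
  also have "\<dots> = l2_norm M (A (\<lambda>x. c * f x))"
    using l2_operator_scale[OF l2_bounded_operator[OF A] f, of c]
    by (intro l2_norm_cong_AE l2_scale l2_bounded_closed[OF A] f) (auto elim: AE_mp)
  also have "\<dots> \<le> op_norm M A"
    using False by (intro op_norm_upper[OF A cf]) (simp add: l2_norm_scale c)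
  finally have le: "cmod c * l2_norm M (A f) \<le> op_norm M A" .
  have "0 < l2_norm M f" using False l2_norm_nonneg[of M f] by linarith
  then show ?thesis using le by (simp add: c field_simps)
qed

lemma op_norm_l2_bounded:
  assumes "l2_bounded M A K"
  shows "l2_bounded M A (op_norm M A)"
  using assms op_norm_nonneg[OF assms] op_norm_bound[OF assms] by (simp add: l2_bounded_def)

lemma op_norm_le_bound: "l2_bounded M A K \<Longrightarrow> op_norm M A \<le> K"
  by (rule op_norm_le) (auto simp: l2_bounded_def)

subsection \<open>Neumann series\<close>

lemma eq_AE_of_norm_geometric:
  assumes f: "f \<in> l2 M" and q: "\<bar>q\<bar> < 1" and le: "\<And>N. l2_norm M f \<le> c * q ^ N"
  shows "AE x in M. f x = 0"
proof -
  have "(\<lambda>N. c * q ^ N) \<longlonglongrightarrow> c * 0"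
    by (intro tendsto_mult_left LIMSEQ_power_zero) (use q in simp)
  then have "l2_norm M f \<le> 0"
    using le by (intro LIMSEQ_le_const[of _ "0"]) auto
  then show ?thesis using l2_norm_eq_0[OF f] l2_norm_nonneg[of M f] by auto
qed

text \<open>The Neumann series of \<open>A ^^ n\<close> / z^(n+1) is an inverse of z - A. Assuming
  growth of the powers rather than a bound on A itself makes this the easy half of Gelfand's
  formula.\<close>

lemma not_in_spectrum:
  assumes A: "l2_bounded M A K" and C: "0 \<le> C" and s: "0 \<le> s" and z: "s < cmod z"
    and growth: "\<And>n f. f \<in> l2 M \<Longrightarrow> l2_norm M ((A ^^ n) f) \<le> C * s ^ n * l2_norm M f"
  shows "z \<notin> op_spectrum M A"
proof -
  note Aop = l2_bounded_operator[OF A]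
  have An: "l2_operator M (A ^^ n)" for n
    using l2_bounded_pow[OF A] by (rule l2_bounded_operator)
  have z0: "z \<noteq> 0" "cmod z > 0" using s z by auto
  define q where "q = s / cmod z"
  have q: "0 \<le> q" "q < 1" using s z z0 by (auto simp: q_def divide_simps)
  define u where "u f n x = (1 / z ^ Suc n) * (A ^^ n) f x" for f n x
  define R where "R f x = (\<Sum>n. u f n x)" for f x
  define L where "L = C / cmod z * (1 / (1 - q))"
  have L0: "0 \<le> L" unfolding L_def using C q by simp
  have u: "u f n \<in> l2 M" if "f \<in> l2 M" for f n
    unfolding u_def by (intro l2_scale l2_operator_closed[OF An that])
  have un: "l2_norm M (u f n) \<le> C / cmod z * l2_norm M f * q ^ n" if "f \<in> l2 M" for f n
  proof -
    have "l2_norm M (u f n) = l2_norm M ((A ^^ n) f) / cmod z ^ Suc n"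
      unfolding u_def l2_norm_scale by (simp add: norm_divide norm_power norm_mult)
    also have "\<dots> \<le> (C * s ^ n * l2_norm M f) / cmod z ^ Suc n"
      by (intro divide_right_mono growth[OF that]) auto
    finally show ?thesis by (simp add: q_def power_divide field_simps)
  qed
  have sb: "(\<lambda>n. c * q ^ n) sums (c * (1 / (1 - q)))" for c
    using q by (intro sums_mult geometric_sums) auto
  have smU: "AE x in M. summable (\<lambda>n. u f n x)" if "f \<in> l2 M" for f
  proof -
    have "AE x in M. summable (\<lambda>n. cmod (u f n x))"
      by (rule l2_series(1)[OF u[OF that] un[OF that] sums_summable[OF sb]])
    then show ?thesis by eventually_elim (rule summable_norm_cancel)
  qed
  have R: "R f \<in> l2 M" if "f \<in> l2 M" for f
    unfolding R_def by (rule l2_series(2)[OF u[OF that] un[OF that] sums_summable[OF sb]])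
  have Rn: "l2_norm M (R f) \<le> L * l2_norm M f" if "f \<in> l2 M" for f
    using l2_series(3)[OF u[OF that] un[OF that] sums_summable[OF sb], folded R_def]
    unfolding sums_unique[OF sb, symmetric] L_def by (simp add: mult_ac)
  have Rop: "l2_operator M R"
    unfolding l2_operator_def
  proof (intro conjI ballI allI impI)
    fix f assume f: "f \<in> l2 M"
    show "R f \<in> l2 M" by (rule R[OF f])
    fix c
    have "AE x in M. \<forall>n. (A ^^ n) (\<lambda>y. c * f y) x = c * (A ^^ n) f x"
      using l2_operator_scale[OF An f] by (simp add: AE_all_countable)
    then show "AE x in M. R (\<lambda>y. c * f y) x = c * R f x"
      using smU[OF f]
    proof eventually_elim
      case (elim x)
      have "R (\<lambda>y. c * f y) x = (\<Sum>n. c * u f n x)"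
        unfolding R_def u_def using elim(1) by (simp add: mult_ac)
      also have "\<dots> = c * R f x" unfolding R_def by (rule suminf_mult[OF elim(2)])
      finally show ?case .
    qed
  next
    fix f g assume f: "f \<in> l2 M" and g: "g \<in> l2 M"
    show "AE x in M. R f x = R g x" if fg: "AE x in M. f x = g x"
    proof -
      have "AE x in M. \<forall>n. (A ^^ n) f x = (A ^^ n) g x"
        using l2_operator_cong[OF An f g fg] by (simp add: AE_all_countable)
      then show ?thesis by eventually_elim (simp add: R_def u_def)
    qed
    have "AE x in M. \<forall>n. (A ^^ n) (\<lambda>y. f y + g y) x = (A ^^ n) f x + (A ^^ n) g x"
      using l2_operator_add[OF An f g] by (simp add: AE_all_countable)
    then show "AE x in M. R (\<lambda>y. f y + g y) x = R f x + R g x"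
      using smU[OF f] smU[OF g]
    proof eventually_elim
      case (elim x)
      have "R (\<lambda>y. f y + g y) x = (\<Sum>n. u f n x + u g n x)"
        unfolding R_def u_def using elim(1) by (simp add: distrib_left add_divide_distrib)
      also have "\<dots> = R f x + R g x" unfolding R_def by (rule suminf_add[OF elim(2,3), symmetric])
      finally show ?case .
    qed
  qed
  have RB: "bounded_operator_set M {R}"
    using Rop L0 Rn unfolding bounded_operator_set_iff by (auto simp: l2_bounded_def)
  have right: "AE x in M. z * R f x - A (R f) x = f x" if f: "f \<in> l2 M" for f
  proof -
    \<comment> \<open>A cannot be moved inside the pointwise series directly. The series is
      therefore cut at N: the defect h equals (z - A) applied to the tail D, minus the boundary term
      W of the finite sum. Both are O(q^N), so h vanishes.\<close>
    define h where "h x = z * R f x - A (R f) x - f x" for x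
    have h: "h \<in> l2 M" unfolding h_def
      by (intro l2_diff l2_scale R f l2_operator_closed[OF Aop])
    have hN: "l2_norm M h \<le> ((cmod z + K) * (L * l2_norm M f) + C * l2_norm M f) * q ^ N" for N
    proof -
      define T where "T x = (\<Sum>n<N. u f n x)" for x
      have T: "T \<in> l2 M" unfolding T_def by (intro l2_sum u f) auto
      define D where "D x = R f x - T x" for x
      have D: "D \<in> l2 M" unfolding D_def by (intro l2_diff R f T)
      define V where "V x = (\<Sum>n. u f (n + N) x)" for x
      have b: "l2_norm M (u f (n + N)) \<le> (C / cmod z * l2_norm M f * q ^ N) * q ^ n" for n
        using un[OF f, of "n + N"] by (simp add: power_add mult_ac)
      have VL: "V \<in> l2 M" "l2_norm M V \<le> L * l2_norm M f * q ^ N"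
        using l2_series(2,3)[OF u[OF f] b sums_summable[OF sb], folded V_def]
        unfolding sums_unique[OF sb, symmetric] L_def by (simp_all add: mult_ac)
      have "AE x in M. D x = V x"
        using smU[OF f]
        by eventually_elim (simp add: D_def V_def R_def T_def suminf_split_initial_segment[of _ N])
      then have Dn: "l2_norm M D \<le> L * l2_norm M f * q ^ N"
        using l2_norm_cong_AE[OF D VL(1)] VL(2) by simp
      have AD: "A D \<in> l2 M" by (rule l2_operator_closed[OF Aop D])
      define W where "W x = (1 / z ^ N) * (A ^^ N) f x" for x
      have W: "W \<in> l2 M" unfolding W_def by (intro l2_scale l2_operator_closed[OF An f])
      have Wn: "l2_norm M W \<le> C * l2_norm M f * q ^ N"
      proof -
        have "l2_norm M W = l2_norm M ((A ^^ N) f) / cmod z ^ N"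
          unfolding W_def l2_norm_scale by (simp add: norm_divide norm_power norm_mult)
        also have "\<dots> \<le> (C * s ^ N * l2_norm M f) / cmod z ^ N"
          by (intro divide_right_mono growth[OF f]) auto
        finally show ?thesis by (simp add: q_def power_divide field_simps)
      qed
      have AT: "AE x in M. A T x = (\<Sum>n<N. (1 / z ^ Suc n) * (A ^^ Suc n) f x)"
      proof -
        have "AE x in M. A T x = (\<Sum>n<N. A (u f n) x)"
          unfolding T_def by (intro l2_operator_sum[OF Aop] u f) auto
        moreover have "AE x in M. \<forall>n. A (u f n) x = (1 / z ^ Suc n) * (A ^^ Suc n) f x"
          using l2_operator_scale[OF Aop l2_operator_closed[OF An f]]
          unfolding AE_all_countable u_def by (simp only: funpow.simps comp_apply simp_thms)
        ultimately show ?thesis by eventually_elim simp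
      qed
      have tel: "z * T x - (\<Sum>n<N. (1 / z ^ Suc n) * (A ^^ Suc n) f x) = f x - W x" for x
        unfolding T_def u_def W_def using z0 by (induction N) (auto simp: field_simps)
      have "AE x in M. h x = (z * D x - A D x) - W x"
        using AT l2_operator_diff[OF Aop R[OF f] T]
      proof eventually_elim
        case (elim x)
        have "A D x = A (R f) x - A T x" using elim(2) unfolding D_def by simp
        moreover have "W x = f x - (z * T x - A T x)" using elim(1) tel[of x] by simp
        ultimately show ?case unfolding h_def by (simp only: D_def) (simp add: algebra_simps)
      qed
      then have "l2_norm M h = l2_norm M (\<lambda>x. (z * D x - A D x) - W x)"
        by (intro l2_norm_cong_AE h l2_diff l2_scale D AD W) (auto elim: AE_mp)
      also have "\<dots> \<le> l2_norm M (\<lambda>x. z * D x - A D x) + l2_norm M W"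
        by (intro l2_norm_triangle_diff l2_diff l2_scale D AD W)
      also have "\<dots> \<le> (l2_norm M (\<lambda>x. z * D x) + l2_norm M (A D)) + l2_norm M W"
        by (intro add_right_mono l2_norm_triangle_diff l2_scale D AD)
      also have "\<dots> \<le> (cmod z * l2_norm M D + K * l2_norm M D) + l2_norm M W"
        using l2_boundedD[OF A D] by (simp add: l2_norm_scale)
      also have "\<dots> = (cmod z + K) * l2_norm M D + l2_norm M W" by (simp add: distrib_right)
      also have "\<dots> \<le> (cmod z + K) * (L * l2_norm M f * q ^ N) + C * l2_norm M f * q ^ N"
        using l2_bounded_nonneg[OF A] by (intro add_mono mult_left_mono Dn Wn) auto
      finally show ?thesis by (simp add: algebra_simps)
    qed
    have "AE x in M. h x = 0"
      by (rule eq_AE_of_norm_geometric[OF h _ hN]) (use q in auto)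
    then show ?thesis by eventually_elim (simp add: h_def)
  qed
  \<comment> \<open>On this side only the powers of A act on the argument, so the series telescopes
    pointwise and the limit exchange of the previous part is avoided.\<close>
  have left: "AE x in M. R (\<lambda>y. z * f y - A f y) x = f x" if f: "f \<in> l2 M" for f
  proof -
    have zf: "(\<lambda>y. z * f y) \<in> l2 M" and Af: "A f \<in> l2 M"
      by (auto intro: l2_scale f l2_operator_closed[OF Aop])
    have "AE x in M. \<forall>n. (A ^^ n) (\<lambda>y. z * f y - A f y) x = (A ^^ n) (\<lambda>y. z * f y) x - (A ^^ n) (A f) x"
      using l2_operator_diff[OF An zf Af] by (simp add: AE_all_countable)
    moreover have "AE x in M. \<forall>n. (A ^^ n) (\<lambda>y. z * f y) x = z * (A ^^ n) f x"
      using l2_operator_scale[OF An f] by (simp add: AE_all_countable)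
    ultimately show ?thesis
      using smU[OF f]
    proof eventually_elim
      case (elim x)
      have "u (\<lambda>y. z * f y - A f y) n x = z * u f n x - z * u f (Suc n) x" for n
        using elim(1,2) z0 by (simp add: u_def funpow_swap1[symmetric] field_simps)
      moreover have "(\<lambda>n. z * u f n x - z * u f (Suc n) x) sums (z * u f 0 x - 0)"
        using summable_LIMSEQ_zero[OF elim(3)]
        by (intro telescope_sums' tendsto_mult_right_zero)
      ultimately have "R (\<lambda>y. z * f y - A f y) x = z * u f 0 x"
        unfolding R_def by (simp add: sums_iff)
      then show ?case using z0 by (simp add: u_def)
    qed
  qed
  show ?thesis unfolding op_spectrum_def using RB right left by blast
qed

lemma op_spectral_radius_le:
  assumes A: "l2_bounded M A K" and C: "0 \<le> C" and s: "0 \<le> s"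
    and growth: "\<And>n f. f \<in> l2 M \<Longrightarrow> l2_norm M ((A ^^ n) f) \<le> C * s ^ n * l2_norm M f"
  shows "op_spectral_radius M A \<le> s"
  unfolding op_spectral_radius_def
proof (rule cSup_least)
  fix y assume "y \<in> insert 0 (cmod ` op_spectrum M A)"
  then show "y \<le> s"
    using not_in_spectrum[OF A C s _ growth] s by (force simp: not_less[symmetric])
qed simp

lemma spectrum_cmod_le:
  assumes A: "l2_bounded M A K" and z: "z \<in> op_spectrum M A"
  shows "cmod z \<le> K"
  using not_in_spectrum[OF A _ l2_bounded_nonneg[OF A], of 1 z] z
    l2_boundedD[OF l2_bounded_pow[OF A]] by (force simp: not_less[symmetric])

lemma op_spectral_radius_nonneg:
  assumes A: "l2_bounded M A K"
  shows "0 \<le> op_spectral_radius M A"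
  unfolding op_spectral_radius_def
  by (rule cSup_upper) (use spectrum_cmod_le[OF A] l2_bounded_nonneg[OF A] in \<open>auto intro!: bdd_aboveI[of _ K]\<close>)

lemma spectrum_cmod_le_radius:
  assumes A: "l2_bounded M A K" and z: "z \<in> op_spectrum M A"
  shows "cmod z \<le> op_spectral_radius M A"
  unfolding op_spectral_radius_def
  by (rule cSup_upper) (use z spectrum_cmod_le[OF A] l2_bounded_nonneg[OF A] in \<open>auto intro!: bdd_aboveI[of _ K]\<close>)

lemma op_spectral_radius_le_bound:
  assumes A: "l2_bounded M A K"
  shows "op_spectral_radius M A \<le> K"
  by (rule op_spectral_radius_le[OF A, of 1])
    (use l2_bounded_nonneg[OF A] l2_boundedD[OF l2_bounded_pow[OF A]] in auto)

subsection \<open>Powers of an operator and its spectral radius\<close>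

text \<open>\<open>Q w\<close> is the inverse of 1 - w A. The variable w = 1/z moves the point at
  infinity of the resolvent to 0, where the Taylor coefficients are the powers of A.\<close>

locale resolvent_family =
  fixes M :: "'a measure" and A :: "'a l2op" and K :: real and D :: "complex set"
    and Q :: "complex \<Rightarrow> 'a l2op"
  assumes bounded_A: "l2_bounded M A K"
    and D: "open D" "0 \<in> D"
    and bounded_Q: "w \<in> D \<Longrightarrow> l2_bounded M (Q w) (op_norm M (Q w))"
    and Q_right: "w \<in> D \<Longrightarrow> f \<in> l2 M \<Longrightarrow> AE x in M. Q w f x - w * A (Q w f) x = f x"
    and Q_left: "w \<in> D \<Longrightarrow> f \<in> l2 M \<Longrightarrow> AE x in M. Q w (\<lambda>y. f y - w * A f y) x = f x"
begin

abbreviation q :: "complex \<Rightarrow> real" where "q w \<equiv> op_norm M (Q w)"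

lemma A_closed: "f \<in> l2 M \<Longrightarrow> A f \<in> l2 M"
  by (rule l2_bounded_closed[OF bounded_A])

lemma Q_closed: "w \<in> D \<Longrightarrow> f \<in> l2 M \<Longrightarrow> Q w f \<in> l2 M"
  by (rule l2_bounded_closed[OF bounded_Q])

lemma Q_operator: "w \<in> D \<Longrightarrow> l2_operator M (Q w)"
  by (rule l2_bounded_operator[OF bounded_Q])

lemma K_nonneg: "0 \<le> K"
  by (rule l2_bounded_nonneg[OF bounded_A])

lemma q_nonneg: "w \<in> D \<Longrightarrow> 0 \<le> q w"
  by (rule l2_bounded_nonneg[OF bounded_Q])

text \<open>Resolvent identity: with h = \<open>Q v f\<close> one has f = (h - w A h) + (w - v) A h,
  and \<open>Q w\<close> is applied to both sides.\<close>

lemma Q_diff: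
  assumes w: "w \<in> D" and v: "v \<in> D" and f: "f \<in> l2 M"
  shows "AE x in M. Q w f x - Q v f x = (w - v) * Q w (A (Q v f)) x"
proof -
  define h where "h = Q v f"
  have h: "h \<in> l2 M" and Ah: "A h \<in> l2 M" and hA: "(\<lambda>y. h y - w * A h y) \<in> l2 M"
    unfolding h_def by (intro Q_closed A_closed v f l2_diff l2_scale)+
  have sA: "(\<lambda>y. (w - v) * A h y) \<in> l2 M" by (rule l2_scale[OF Ah])
  have "AE x in M. f x = (h x - w * A h x) + (w - v) * A h x"
    using Q_right[OF v f] by eventually_elim (simp add: h_def algebra_simps)
  from l2_operator_cong[OF Q_operator[OF w] f l2_add[OF hA sA] this]
    l2_operator_add[OF Q_operator[OF w] hA sA] Q_left[OF w h]
    l2_operator_scale[OF Q_operator[OF w] Ah, of "w - v"]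
  show ?thesis by eventually_elim (simp add: h_def)
qed

lemma Q_diff_norm:
  assumes w: "w \<in> D" and v: "v \<in> D" and f: "f \<in> l2 M"
  shows "l2_norm M (\<lambda>x. Q w f x - Q v f x) \<le> cmod (w - v) * (q w * K * q v) * l2_norm M f"
proof -
  have "l2_norm M (\<lambda>x. Q w f x - Q v f x) = l2_norm M (\<lambda>x. (w - v) * Q w (A (Q v f)) x)"
    using Q_diff[OF w v f] by (intro l2_norm_cong_AE l2_diff l2_scale Q_closed A_closed w v f) (auto elim: AE_mp)
  also have "\<dots> = cmod (w - v) * l2_norm M (Q w (A (Q v f)))" by (rule l2_norm_scale)
  also have "\<dots> \<le> cmod (w - v) * (q w * (K * q v) * l2_norm M f)"
    using l2_boundedD[OF l2_bounded_comp[OF bounded_Q[OF w] l2_bounded_comp[OF bounded_A bounded_Q[OF v]]] f]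
    by (intro mult_left_mono) auto
  finally show ?thesis by (simp add: mult_ac)
qed

text \<open>The resolvent identity bounds \<open>q w\<close> by \<open>q v\<close> plus at most half
  of \<open>q w\<close>, and the latter is absorbed on the left.\<close>

lemma q_local:
  assumes w: "w \<in> D" and v: "v \<in> D" and small: "cmod (w - v) * (K * q v) \<le> 1 / 2"
  shows "q w \<le> 2 * q v"
proof -
  have "q w \<le> q v + cmod (w - v) * (q w * K * q v)"
  proof (rule op_norm_le)
    show "0 \<le> q v + cmod (w - v) * (q w * K * q v)"
      using q_nonneg[OF w] q_nonneg[OF v] K_nonneg by simp
    fix f assume f: "f \<in> l2 M"
    have "l2_norm M (Q w f) = l2_norm M (\<lambda>x. Q v f x + (Q w f x - Q v f x))" by simp
    also have "\<dots> \<le> l2_norm M (Q v f) + l2_norm M (\<lambda>x. Q w f x - Q v f x)"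
      by (intro l2_norm_triangle l2_diff Q_closed w v f)
    also have "\<dots> \<le> q v * l2_norm M f + cmod (w - v) * (q w * K * q v) * l2_norm M f"
      by (intro add_mono Q_diff_norm l2_boundedD[OF bounded_Q] w v f)
    finally show "l2_norm M (Q w f) \<le> (q v + cmod (w - v) * (q w * K * q v)) * l2_norm M f"
      by (simp add: distrib_right)
  qed
  also have "cmod (w - v) * (q w * K * q v) \<le> q w * (1 / 2)"
    using mult_left_mono[OF small q_nonneg[OF w]] by (simp add: mult_ac)
  finally show ?thesis by simp
qed

lemma q_locally_bounded:
  assumes v: "v \<in> D"
  shows "\<exists>e>0. \<forall>w. cmod (w - v) < e \<longrightarrow> w \<in> D \<and> q w \<le> 2 * q v"
proof -
  obtain e1 where e1: "e1 > 0" "ball v e1 \<subseteq> D"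
    using D v by (meson open_contains_ball)
  have p: "0 < 1 / (2 * (K * q v + 1))"
    using K_nonneg q_nonneg[OF v] by (simp add: add_nonneg_pos)
  \<comment> \<open>Inside this radius |w - v| K \<open>q v\<close> is at most 1/2, as
    \<open>q_local\<close> requires; the summand 1 covers the case K \<open>q v\<close> = 0.\<close>
  define e where "e = min e1 (1 / (2 * (K * q v + 1)))"
  have "w \<in> D \<and> q w \<le> 2 * q v" if "cmod (w - v) < e" for w
  proof
    show w: "w \<in> D" using that e1(2) by (auto simp: e_def dist_norm norm_minus_commute)
    have Kq: "0 \<le> K * q v" using K_nonneg q_nonneg[OF v] by simp
    have "cmod (w - v) * (K * q v) \<le> (1 / (2 * (K * q v + 1))) * (K * q v)"
      using that Kq by (intro mult_right_mono) (auto simp: e_def)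
    also have "\<dots> \<le> 1 / 2" using Kq by (simp add: field_simps)
    finally show "q w \<le> 2 * q v" by (rule q_local[OF w v])
  qed
  moreover have "e > 0" using e1(1) p by (simp add: e_def)
  ultimately show ?thesis by blast
qed

text \<open>A finite subcover by the balls of \<open>q_locally_bounded\<close> suffices; the sum of
  its local bounds serves as the common constant. The result feeds the Cauchy estimates
  below.\<close>

lemma q_bounded_on_compact:
  assumes S: "compact S" "S \<subseteq> D"
  shows "\<exists>B. \<forall>w\<in>S. q w \<le> B"
proof -
  obtain e where e: "\<And>v. v \<in> D \<Longrightarrow> e v > 0"
    "\<And>v w. v \<in> D \<Longrightarrow> cmod (w - v) < e v \<Longrightarrow> w \<in> D \<and> q w \<le> 2 * q v"
    using q_locally_bounded by metis
  have "S \<subseteq> (\<Union>v\<in>S. ball v (e v))"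
    using e(1) S(2) by (meson UN_I centre_in_ball subset_iff)
  from compactE_image[OF S(1) _ this]
  obtain S' where S': "S' \<subseteq> S" "finite S'" "S \<subseteq> (\<Union>v\<in>S'. ball v (e v))" by auto
  have "q w \<le> (\<Sum>v\<in>S'. 2 * q v)" if w: "w \<in> S" for w
  proof -
    obtain v where v: "v \<in> S'" "w \<in> ball v (e v)" using S'(3) w by blast
    then have "q w \<le> 2 * q v"
      using e(2)[of v w] S'(1) S(2) by (auto simp: dist_norm norm_minus_commute)
    also have "\<dots> \<le> (\<Sum>v\<in>S'. 2 * q v)"
      using v S' S(2) q_nonneg by (intro member_le_sum) auto
    finally show ?thesis .
  qed
  then show ?thesis by blast
qed

definition \<phi> :: "('a \<Rightarrow> complex) \<Rightarrow> ('a \<Rightarrow> complex) \<Rightarrow> complex \<Rightarrow> complex" where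
  "\<phi> f g w = l2_inner M (Q w f) g"

text \<open>By the resolvent identity the derivative at v is the coefficient of \<open>Q v h\<close>
  with h = \<open>A (Q v f)\<close>: the difference quotient deviates from it by the coefficient of
  \<open>Q w h\<close> - \<open>Q v h\<close>, which is O(|w - v|).\<close>

lemma \<phi>_holomorphic:
  assumes f: "f \<in> l2 M" and g: "g \<in> l2 M"
  shows "\<phi> f g holomorphic_on D"
proof (rule holomorphic_onI)
  fix v assume v: "v \<in> D"
  define h where "h = A (Q v f)"
  have h: "h \<in> l2 M" unfolding h_def by (intro A_closed Q_closed v f)
  obtain e where e: "e > 0" "\<And>w. cmod (w - v) < e \<Longrightarrow> w \<in> D \<and> q w \<le> 2 * q v"
    using q_locally_bounded[OF v] by blast
  define c where "c = 2 * q v * K * q v * l2_norm M h * l2_norm M g"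
  have est: "cmod ((\<phi> f g w - \<phi> f g v) / (w - v) - l2_inner M (Q v h) g) \<le> c * cmod (w - v)"
    if wv: "w \<noteq> v" "cmod (w - v) < e" for w
  proof -
    have w: "w \<in> D" and qw: "q w \<le> 2 * q v" using e(2) wv by auto
    have "\<phi> f g w - \<phi> f g v = l2_inner M (\<lambda>x. Q w f x - Q v f x) g"
      unfolding \<phi>_def by (rule l2_inner_diff_left[symmetric]; intro Q_closed w v f g)
    also have "\<dots> = l2_inner M (\<lambda>x. (w - v) * Q w h x) g"
      unfolding h_def
      by (intro l2_inner_cong_AE Q_diff l2_diff l2_scale Q_closed A_closed w v f g)
    also have "\<dots> = (w - v) * l2_inner M (Q w h) g" by (rule l2_inner_scale_left)
    finally have "(\<phi> f g w - \<phi> f g v) / (w - v) - l2_inner M (Q v h) g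
        = l2_inner M (Q w h) g - l2_inner M (Q v h) g"
      using wv(1) by simp
    also have "\<dots> = l2_inner M (\<lambda>x. Q w h x - Q v h x) g"
      by (rule l2_inner_diff_left[symmetric]; intro Q_closed w v h g)
    finally have "cmod ((\<phi> f g w - \<phi> f g v) / (w - v) - l2_inner M (Q v h) g)
        \<le> l2_norm M (\<lambda>x. Q w h x - Q v h x) * l2_norm M g"
      using l2_inner_le[OF l2_diff[OF Q_closed[OF w h] Q_closed[OF v h]] g] by simp
    also have "\<dots> \<le> (cmod (w - v) * (q w * K * q v) * l2_norm M h) * l2_norm M g"
      by (intro mult_right_mono Q_diff_norm w v h) auto
    also have "\<dots> \<le> (cmod (w - v) * (2 * q v * K * q v) * l2_norm M h) * l2_norm M g"
      using qw K_nonneg q_nonneg[OF v] by (intro mult_right_mono mult_left_mono) auto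
    finally show ?thesis by (simp add: c_def mult_ac)
  qed
  have "((\<lambda>w. c * cmod (w - v)) \<longlongrightarrow> c * cmod (v - v)) (at v)"
    by (intro tendsto_intros)
  then have "((\<lambda>w. c * cmod (w - v)) \<longlongrightarrow> 0) (at v)" by simp
  moreover have "\<forall>\<^sub>F w in at v. cmod ((\<phi> f g w - \<phi> f g v) / (w - v) - l2_inner M (Q v h) g) \<le> c * cmod (w - v)"
    unfolding eventually_at using e(1) est by (intro exI[of _ e]) (auto simp: dist_norm)
  ultimately have "((\<lambda>w. (\<phi> f g w - \<phi> f g v) / (w - v) - l2_inner M (Q v h) g) \<longlongrightarrow> 0) (at v)"
    by (rule Lim_null_comparison[rotated])
  then have "(\<phi> f g has_field_derivative l2_inner M (Q v h) g) (at v)"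
    unfolding has_field_derivative_iff by (rule LIM_zero_cancel)
  then show "\<phi> f g field_differentiable at v within D"
    by (meson field_differentiable_at_within field_differentiable_def)
qed

lemma \<phi>_0:
  assumes f: "f \<in> l2 M" and g: "g \<in> l2 M"
  shows "\<phi> f g 0 = l2_inner M f g"
  unfolding \<phi>_def
  by (rule l2_inner_cong_AE) (use Q_right[OF D(2) f] Q_closed[OF D(2) f] f g in auto)

text \<open>This is \<open>Q w\<close> = 1 + w \<open>Q w\<close> A, tested against g.\<close>

lemma \<phi>_rec:
  assumes f: "f \<in> l2 M" and g: "g \<in> l2 M" and w: "w \<in> D"
  shows "\<phi> f g w = l2_inner M f g + w * \<phi> (A f) g w"
proof -
  have Af: "A f \<in> l2 M" by (rule A_closed[OF f])
  have "AE x in M. Q w f x = f x + w * Q w (A f) x"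
    using Q_left[OF w f] l2_operator_diff[OF Q_operator[OF w] f l2_scale[OF Af, of w]]
      l2_operator_scale[OF Q_operator[OF w] Af, of w]
    by eventually_elim (simp add: diff_eq_eq)
  then have "\<phi> f g w = l2_inner M (\<lambda>x. f x + w * Q w (A f) x) g"
    unfolding \<phi>_def by (intro l2_inner_cong_AE l2_add l2_scale Q_closed w f g Af)
  also have "\<dots> = l2_inner M f g + l2_inner M (\<lambda>x. w * Q w (A f) x) g"
    by (intro l2_inner_add_left l2_scale Q_closed w f g Af)
  finally show ?thesis by (simp add: \<phi>_def l2_inner_scale_left)
qed

text \<open>Coefficients are compared in \<open>\<phi>_rec\<close>. The induction varies f because
  the recursion passes from f to \<open>A f\<close>.\<close>

lemma fps_nth_\<phi>:
  assumes f: "f \<in> l2 M" and g: "g \<in> l2 M"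
  shows "fps_nth (fps_expansion (\<phi> f g) 0) n = l2_inner M ((A ^^ n) f) g"
  using f
proof (induction n arbitrary: f)
  case 0
  then show ?case by (simp add: fps_expansion_def \<phi>_0 g)
next
  case (Suc n)
  have Af: "A f \<in> l2 M" by (rule A_closed[OF Suc.prems])
  note exp = has_fps_expansion_fps_expansion[OF D \<phi>_holomorphic[OF _ g]]
  have "(\<lambda>w. l2_inner M f g + w * \<phi> (A f) g w) has_fps_expansion
      (fps_const (l2_inner M f g) + fps_X * fps_expansion (\<phi> (A f) g) 0)"
    by (intro fps_expansion_intros exp Af)
  moreover have "\<forall>\<^sub>F w in nhds 0. \<phi> f g w = l2_inner M f g + w * \<phi> (A f) g w"
    using eventually_nhds_in_open[OF D] by eventually_elim (rule \<phi>_rec[OF Suc.prems g])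
  ultimately have "\<phi> f g has_fps_expansion
      (fps_const (l2_inner M f g) + fps_X * fps_expansion (\<phi> (A f) g) 0)"
    by (simp add: has_fps_expansion_cong)
  then have "fps_expansion (\<phi> f g) 0 = fps_const (l2_inner M f g) + fps_X * fps_expansion (\<phi> (A f) g) 0"
    by (rule fps_expansion_eqI)
  then show ?case
    using Suc.IH[OF Af] by (simp add: funpow_swap1)
qed

text \<open>Cauchy's inequality on the circle of radius t bounds the n-th Taylor coefficient, with a
  constant that is uniform in f and g because \<open>q\<close> is bounded on the disc.\<close>

lemma power_bound:
  assumes t: "t > 0" "cball 0 t \<subseteq> D"
  shows "\<exists>B\<ge>0. \<forall>n. \<forall>f\<in>l2 M. l2_norm M ((A ^^ n) f) \<le> B * (1 / t) ^ n * l2_norm M f"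
proof -
  obtain B where B: "\<And>w. w \<in> cball 0 t \<Longrightarrow> q w \<le> B"
    using q_bounded_on_compact[OF compact_cball t(2)] by blast
  have "0 \<le> q 0" by (rule q_nonneg[OF D(2)])
  also have "q 0 \<le> B" using B[of 0] t by simp
  finally have B0: "0 \<le> B" .
  have "l2_norm M ((A ^^ n) f) \<le> B * (1 / t) ^ n * l2_norm M f" if f: "f \<in> l2 M" for n f
  proof (cases "l2_norm M ((A ^^ n) f) = 0")
    case True
    then show ?thesis using B0 t by simp
  next
    case False
    \<comment> \<open>Testing the n-th power against its own value turns the n-th coefficient into
      ||g||^2, and one factor ||g|| cancels against the Cauchy bound.\<close>
    define g where "g = (A ^^ n) f"
    have g: "g \<in> l2 M" unfolding g_def
      by (rule l2_bounded_closed[OF l2_bounded_pow[OF bounded_A] f])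
    have hol: "\<phi> f g holomorphic_on D" by (rule \<phi>_holomorphic[OF f g])
    have "cmod ((deriv ^^ n) (\<phi> f g) 0) \<le> fact n * (B * l2_norm M f * l2_norm M g) / t ^ n"
    proof (rule Cauchy_inequality)
      show "\<phi> f g holomorphic_on ball 0 t"
        using hol t(2) ball_subset_cball by (metis holomorphic_on_subset order_trans)
      show "continuous_on (cball 0 t) (\<phi> f g)"
        using hol t(2) by (meson continuous_on_subset holomorphic_on_imp_continuous_on)
      show "0 < t" by (rule t(1))
      fix w :: complex assume "cmod (0 - w) = t"
      then have w: "w \<in> cball 0 t" "w \<in> D" using t(2) by auto
      have "cmod (\<phi> f g w) \<le> l2_norm M (Q w f) * l2_norm M g"
        unfolding \<phi>_def by (intro l2_inner_le Q_closed w f g)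
      also have "\<dots> \<le> (q w * l2_norm M f) * l2_norm M g"
        by (intro mult_right_mono l2_boundedD[OF bounded_Q] w f) auto
      also have "\<dots> \<le> (B * l2_norm M f) * l2_norm M g"
        by (intro mult_right_mono B w) auto
      finally show "cmod (\<phi> f g w) \<le> B * l2_norm M f * l2_norm M g" .
    qed
    moreover have "(deriv ^^ n) (\<phi> f g) 0 = fact n * complex_of_real ((l2_norm M g)\<^sup>2)"
      using fps_nth_\<phi>[OF f g, of n] by (simp add: fps_expansion_def field_simps l2_inner_self flip: g_def)
    ultimately have "fact n * (l2_norm M g)\<^sup>2 \<le> fact n * (B * l2_norm M f * l2_norm M g) / t ^ n"
      by (simp add: norm_mult norm_power)
    then have "(l2_norm M g)\<^sup>2 \<le> (B * l2_norm M f * l2_norm M g) / t ^ n"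
      by (simp add: mult_le_cancel_left_pos flip: times_divide_eq_right)
    then have "l2_norm M g * l2_norm M g \<le> (B * (1 / t) ^ n * l2_norm M f) * l2_norm M g"
      by (simp add: power2_eq_square power_one_over field_simps)
    moreover have "0 < l2_norm M g" using False l2_norm_nonneg[of M g] by (simp add: g_def del: l2_norm_nonneg)
    ultimately show ?thesis by (simp add: g_def)
  qed
  then show ?thesis using B0 by blast
qed

end

text \<open>
  The nontrivial half of Gelfand's formula: the matrix coefficients of \<open>(1 - w A)\<^sup>-\<^sup>1\<close> are
  holomorphic on the disc of radius \<open>1 / \<rho>(A)\<close>, and their Taylor coefficients are those of the
  powers of \<open>A\<close>.
\<close>

lemma power_bound_of_spectral_radius:
  assumes A: "l2_bounded M A K" and s: "op_spectral_radius M A < s"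
  shows "\<exists>B\<ge>0. \<forall>n. \<forall>f\<in>l2 M. l2_norm M ((A ^^ n) f) \<le> B * s ^ n * l2_norm M f"
proof -
  have \<rho>: "0 \<le> op_spectral_radius M A" by (rule op_spectral_radius_nonneg[OF A])
  \<comment> \<open>A number strictly between the spectral radius and s is needed, so that the
    closed disc of radius 1/s lies in the open disc of radius 1/t on which the inverses
    exist.\<close>
  define t where "t = (op_spectral_radius M A + s) / 2"
  have t: "op_spectral_radius M A < t" "t < s" "0 < t" using s \<rho> by (auto simp: t_def)
  define good where "good w Q \<longleftrightarrow> l2_bounded M Q (op_norm M Q) \<and>
    (\<forall>f\<in>l2 M. (AE x in M. Q f x - w * A (Q f) x = f x) \<and>
      (AE x in M. Q (\<lambda>y. f y - w * A f y) x = f x))" for w Q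
  have "\<exists>Q. good w Q" if w: "w \<in> ball 0 (1 / t)" for w
  proof (cases "w = 0")
    case True
    then show ?thesis
      using op_norm_l2_bounded[OF l2_bounded_id] by (intro exI[of _ id]) (simp add: good_def)
  next
    case False
    have "t < cmod (1 / w)" using w False t by (simp add: norm_divide field_simps)
    then have "1 / w \<notin> op_spectrum M A"
      using spectrum_cmod_le_radius[OF A, of "1 / w"] t by auto
    then obtain R where "bounded_operator_set M {R}"
      and R: "\<And>f. f \<in> l2 M \<Longrightarrow> AE x in M. 1 / w * R f x - A (R f) x = f x"
        "\<And>f. f \<in> l2 M \<Longrightarrow> AE x in M. R (\<lambda>y. 1 / w * f y - A f y) x = f x"
      unfolding op_spectrum_def by blast
    then obtain L where L: "l2_bounded M R L" by (auto simp: bounded_operator_set_iff)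
    note Rop = l2_bounded_operator[OF L] and Aop = l2_bounded_operator[OF A]
    \<comment> \<open>The inverse of 1 - w A is 1/w times the resolvent at 1/w. With the scalar
      placed inside R, both identities for R apply without appeal to its linearity.\<close>
    define Q where "Q f = R (\<lambda>x. (1 / w) * f x)" for f
    have Q: "AE x in M. Q f x = 1 / w * R f x" if "f \<in> l2 M" for f
      unfolding Q_def by (rule l2_operator_scale[OF Rop that])
    have Qcl: "Q f \<in> l2 M" if "f \<in> l2 M" for f
      unfolding Q_def by (intro l2_operator_closed[OF Rop] l2_scale that)
    have "l2_bounded M Q (L * (1 / cmod w))"
    proof -
      have sc: "l2_bounded M (\<lambda>f x. 1 / w * f x) (1 / cmod w)"
        unfolding l2_bounded_def l2_operator_def
        by (auto intro: l2_scale simp: l2_norm_scale norm_divide distrib_left elim: AE_mp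
            simp del: times_divide_eq_left mult_1_left)
      have "Q = R \<circ> (\<lambda>f x. 1 / w * f x)" by (auto simp: Q_def fun_eq_iff)
      then show ?thesis using l2_bounded_comp[OF L sc] by simp
    qed
    then have "l2_bounded M Q (op_norm M Q)" by (rule op_norm_l2_bounded)
    moreover have "AE x in M. Q f x - w * A (Q f) x = f x" if f: "f \<in> l2 M" for f
    proof -
      have sf: "(\<lambda>x. 1 / w * f x) \<in> l2 M" by (rule l2_scale[OF f])
      show ?thesis
        using R(1)[OF sf] unfolding Q_def[symmetric]
        by eventually_elim (use False in \<open>simp add: field_simps\<close>)
    qed
    moreover have "AE x in M. Q (\<lambda>y. f y - w * A f y) x = f x" if f: "f \<in> l2 M" for f
    proof -
      have "(\<lambda>x. 1 / w * (f x - w * A f x)) = (\<lambda>y. 1 / w * f y - A f y)"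
        using False by (simp add: fun_eq_iff field_simps)
      then show ?thesis using R(2)[OF f] by (simp only: Q_def)
    qed
    ultimately show ?thesis unfolding good_def by blast
  qed
  then obtain Q where Q: "\<And>w. w \<in> ball 0 (1 / t) \<Longrightarrow> good w (Q w)" by metis
  interpret resolvent_family M A K "ball 0 (1 / t)" Q
    by unfold_locales (use A Q t in \<open>auto simp: good_def\<close>)
  have "cball 0 (1 / s) \<subseteq> ball (0::complex) (1 / t)"
    using t by (simp add: cball_subset_ball_iff frac_less2)
  from power_bound[OF _ this] t show ?thesis by simp
qed

subsection \<open>Geometric means of functions\<close>

lemma geometric_mean_le_arithmetic_mean:
  fixes u :: "'i \<Rightarrow> real"
  assumes I: "finite I" "I \<noteq> {}" and u: "\<And>i. i \<in> I \<Longrightarrow> 0 \<le> u i"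
  shows "(\<Prod>i\<in>I. u i powr (1 / card I)) \<le> (\<Sum>i\<in>I. u i) / card I"
proof (cases "\<exists>i\<in>I. u i = 0")
  case True
  then have "(\<Prod>i\<in>I. u i powr (1 / card I)) = 0" using I by auto
  also have "0 \<le> (\<Sum>i\<in>I. u i) / card I" using u by (simp add: sum_nonneg)
  finally show ?thesis .
next
  case False
  with u have pos: "0 < u i" if "i \<in> I" for i using that by (metis less_eq_real_def)
  have "(\<Prod>i\<in>I. u i powr (1 / card I)) = exp (\<Sum>i\<in>I. (1 / card I) *\<^sub>R ln (u i))"
    using pos I by (subst exp_sum) (auto simp: powr_def less_imp_neq[symmetric] intro!: prod.cong)
  also have "\<dots> \<le> (\<Sum>i\<in>I. (1 / card I) * exp (ln (u i)))"
    using I by (intro convex_on_sum[OF I exp_convex]) auto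
  also have "\<dots> = (\<Sum>i\<in>I. u i) / card I"
    using pos by (simp add: sum_divide_distrib)
  finally show ?thesis .
qed

text \<open>Hoelder's inequality with card I equal exponents: each u i is divided by its integral
  and the inequality of the means is integrated. If one of the integrals is 0, the product vanishes
  almost everywhere.\<close>

lemma
  fixes u :: "'i \<Rightarrow> 'a \<Rightarrow> real"
  assumes I: "finite I" "I \<noteq> {}" and int: "\<And>i. i \<in> I \<Longrightarrow> integrable M (u i)"
    and u: "\<And>i x. i \<in> I \<Longrightarrow> 0 \<le> u i x"
  shows integrable_geometric_mean: "integrable M (\<lambda>x. \<Prod>i\<in>I. u i x powr (1 / card I))"
    and integral_geometric_mean_le:
      "(\<integral>x. (\<Prod>i\<in>I. u i x powr (1 / card I)) \<partial>M) \<le> (\<Prod>i\<in>I. (\<integral>x. u i x \<partial>M) powr (1 / card I))"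
proof -
  let ?a = "1 / card I"
  note [measurable] = borel_measurable_integrable[OF int]
  have isum: "integrable M (\<lambda>x. (\<Sum>i\<in>I. v i * u i x) / card I)" for v :: "'i \<Rightarrow> real"
    using int by auto
  have amgm: "(\<Prod>i\<in>I. u i x powr ?a) \<le> (\<Sum>i\<in>I. 1 * u i x) / card I" for x
    using geometric_mean_le_arithmetic_mean[OF I, of "\<lambda>i. u i x"] u by simp
  show i: "integrable M (\<lambda>x. \<Prod>i\<in>I. u i x powr ?a)"
  proof (rule Bochner_Integration.integrable_bound[OF isum[of "\<lambda>_. 1"]])
    show "AE x in M. norm (\<Prod>i\<in>I. u i x powr ?a) \<le> norm ((\<Sum>i\<in>I. 1 * u i x) / card I)"
    proof (rule AE_I2)
      fix x
      have "norm (\<Prod>i\<in>I. u i x powr ?a) = (\<Prod>i\<in>I. u i x powr ?a)" by (simp add: prod_nonneg)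
      with amgm[of x] show "norm (\<Prod>i\<in>I. u i x powr ?a) \<le> norm ((\<Sum>i\<in>I. 1 * u i x) / card I)"
        by (metis abs_ge_self order_trans real_norm_def)
    qed
  qed measurable
  define J where "J i = (\<integral>x. u i x \<partial>M)" for i
  have J0: "0 \<le> J i" if "i \<in> I" for i unfolding J_def using u[OF that] by simp
  show "(\<integral>x. (\<Prod>i\<in>I. u i x powr ?a) \<partial>M) \<le> (\<Prod>i\<in>I. (\<integral>x. u i x \<partial>M) powr ?a)"
  proof (cases "\<exists>i\<in>I. J i = 0")
    case True
    then obtain i where iI: "i \<in> I" and Ji: "J i = 0" by blast
    have "AE x in M. u i x = 0"
      using integral_nonneg_eq_0_iff_AE[OF int[OF iI]] u[OF iI] Ji by (auto simp: J_def)
    then have "AE x in M. (\<Prod>i\<in>I. u i x powr ?a) = 0"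
      by eventually_elim (use I iI in auto)
    then have "(\<integral>x. (\<Prod>i\<in>I. u i x powr ?a) \<partial>M) = (\<integral>x. 0 \<partial>M)"
      by (intro integral_cong_AE) auto
    then show ?thesis by (simp add: prod_nonneg)
  next
    case False
    with J0 have pos: "0 < J i" if "i \<in> I" for i using that by (metis less_eq_real_def)
    define P where "P = (\<Prod>i\<in>I. J i powr ?a)"
    have "(\<Prod>i\<in>I. u i x powr ?a) \<le> P * ((\<Sum>i\<in>I. (1 / J i) * u i x) / card I)" for x
    proof -
      have "(\<Prod>i\<in>I. u i x powr ?a) = (\<Prod>i\<in>I. J i powr ?a * ((1 / J i) * u i x) powr ?a)"
        using pos u by (intro prod.cong refl, subst powr_mult[symmetric]) (auto simp: less_imp_le dest: pos)
      also have "\<dots> = P * (\<Prod>i\<in>I. ((1 / J i) * u i x) powr ?a)"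
        by (simp add: P_def prod.distrib)
      also have "\<dots> \<le> P * ((\<Sum>i\<in>I. (1 / J i) * u i x) / card I)"
        unfolding P_def using pos u I
        by (intro mult_left_mono geometric_mean_le_arithmetic_mean prod_nonneg) (auto simp: less_imp_le)
      finally show ?thesis .
    qed
    then have "(\<integral>x. (\<Prod>i\<in>I. u i x powr ?a) \<partial>M) \<le> (\<integral>x. P * ((\<Sum>i\<in>I. (1 / J i) * u i x) / card I) \<partial>M)"
      by (intro integral_mono i integrable_mult_right isum)
    also have "\<dots> = P * ((\<Sum>i\<in>I. (1 / J i) * J i) / card I)"
      using int by (simp add: J_def)
    also have "(\<Sum>i\<in>I. (1 / J i) * J i) = (\<Sum>i\<in>I. 1)"
      using pos by (intro sum.cong) (auto simp: less_imp_neq[symmetric])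
    finally show ?thesis using I by (simp add: P_def J_def)
  qed
qed

lemma l2_norm_geometric_mean_le:
  assumes I: "finite I" "I \<noteq> {}" and f: "\<And>i. i \<in> I \<Longrightarrow> f i \<in> l2 M" and g: "g \<in> l2 M"
    and le: "AE x in M. cmod (g x) \<le> (\<Prod>i\<in>I. cmod (f i x) powr (1 / card I))"
  shows "l2_norm M g \<le> (\<Prod>i\<in>I. l2_norm M (f i) powr (1 / card I))"
proof -
  let ?a = "1 / card I"
  have sq: "(\<Prod>i\<in>I. c i powr ?a)\<^sup>2 = (\<Prod>i\<in>I. (c i)\<^sup>2 powr ?a)" if "\<And>i. 0 \<le> c i" for c :: "_ \<Rightarrow> real"
    using that by (simp add: power2_eq_square powr_mult prod.distrib)
  have "(l2_norm M g)\<^sup>2 \<le> (\<integral>x. (\<Prod>i\<in>I. (cmod (f i x))\<^sup>2 powr ?a) \<partial>M)"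
    unfolding l2_norm_square
  proof (rule integral_mono_AE[OF l2_integrable[OF g]])
    show "integrable M (\<lambda>x. \<Prod>i\<in>I. (cmod (f i x))\<^sup>2 powr ?a)"
      by (rule integrable_geometric_mean[OF I]) (auto intro: l2_integrable f)
    show "AE x in M. (cmod (g x))\<^sup>2 \<le> (\<Prod>i\<in>I. (cmod (f i x))\<^sup>2 powr ?a)"
      using le by eventually_elim (use power_mono[of _ _ 2] in \<open>fastforce simp flip: sq\<close>)
  qed
  also have "\<dots> \<le> (\<Prod>i\<in>I. (\<integral>x. (cmod (f i x))\<^sup>2 \<partial>M) powr ?a)"
    by (rule integral_geometric_mean_le[OF I]) (auto intro: l2_integrable f)
  also have "\<dots> = (\<Prod>i\<in>I. l2_norm M (f i) powr ?a)\<^sup>2"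
    by (simp add: sq flip: l2_norm_square)
  finally show ?thesis by (rule power2_le_imp_le) (simp add: prod_nonneg)
qed

subsection \<open>Operators with nonnegative kernel\<close>

text \<open>Values stay complex, so operators apply directly, while \<open>cmod\<close> of the
  function serves as its real version.\<close>

definition l2_nonneg :: "'a measure \<Rightarrow> ('a \<Rightarrow> complex) \<Rightarrow> bool" where
  "l2_nonneg M f \<longleftrightarrow> f \<in> l2 M \<and> (AE x in M. f x = complex_of_real (cmod (f x)))"

lemma l2_nonneg_l2: "l2_nonneg M f \<Longrightarrow> f \<in> l2 M"
  by (simp add: l2_nonneg_def)

lemma l2_nonneg_cmod: "f \<in> l2 M \<Longrightarrow> l2_nonneg M (\<lambda>x. complex_of_real (cmod (f x)))"
  by (simp add: l2_nonneg_def l2_cmod)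

text \<open>This is the form in which \<open>is_geometric_mean\<close> supplies kernels: real and
  nonnegative everywhere, so that \<open>powr\<close> can be taken pointwise.\<close>

definition nonneg_kernel :: "'a measure \<Rightarrow> 'a l2op \<Rightarrow> ('a \<times> 'a \<Rightarrow> real) \<Rightarrow> bool" where
  "nonneg_kernel M A a \<longleftrightarrow> (\<forall>p. 0 \<le> a p) \<and> has_kernel M A (\<lambda>p. complex_of_real (a p))"

lemma nonneg_kernel_nonneg: "nonneg_kernel M A a \<Longrightarrow> 0 \<le> a p"
  and nonneg_kernel_operator: "nonneg_kernel M A a \<Longrightarrow> l2_operator M A"
  unfolding nonneg_kernel_def has_kernel_def by blast+

lemma nonneg_kernel_measurable:
  assumes "nonneg_kernel M A a"
  shows "a \<in> borel_measurable (M \<Otimes>\<^sub>M M)"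
proof -
  have "(\<lambda>p. complex_of_real (a p)) \<in> borel_measurable (M \<Otimes>\<^sub>M M)"
    using assms by (simp add: nonneg_kernel_def has_kernel_def)
  then have "(\<lambda>p. Re (complex_of_real (a p))) \<in> borel_measurable (M \<Otimes>\<^sub>M M)" by measurable
  then show ?thesis by simp
qed

lemma nonneg_kernel_apply:
  assumes A: "nonneg_kernel M A a" and f: "f \<in> l2 M"
  shows "AE x in M. integrable M (\<lambda>y. complex_of_real (a (x, y)) * f y) \<and>
    integrable M (\<lambda>y. a (x, y) * cmod (f y)) \<and> A f x = (\<integral>y. complex_of_real (a (x, y)) * f y \<partial>M)"
proof -
  have "AE x in M. integrable M (\<lambda>y. complex_of_real (a (x, y)) * f y) \<and>
      A f x = (\<integral>y. complex_of_real (a (x, y)) * f y \<partial>M)"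
    using A f by (simp add: nonneg_kernel_def has_kernel_def)
  then show ?thesis
  proof eventually_elim
    case (elim x)
    then have "integrable M (\<lambda>y. norm (complex_of_real (a (x, y)) * f y))" by (intro integrable_norm) simp
    then show ?case using elim nonneg_kernel_nonneg[OF A] by (simp add: norm_mult)
  qed
qed

lemma nonneg_kernel_cmod_le:
  assumes A: "nonneg_kernel M A a" and f: "f \<in> l2 M"
  shows "AE x in M. cmod (A f x) \<le> (\<integral>y. a (x, y) * cmod (f y) \<partial>M)"
  using nonneg_kernel_apply[OF A f]
proof eventually_elim
  case (elim x)
  then have "cmod (A f x) \<le> (\<integral>y. cmod (complex_of_real (a (x, y)) * f y) \<partial>M)"
    by (simp add: integral_norm_bound)
  then show ?case using nonneg_kernel_nonneg[OF A] by (simp add: norm_mult)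
qed

lemma nonneg_kernel_apply_nonneg:
  assumes A: "nonneg_kernel M A a" and f: "l2_nonneg M f"
  shows "AE x in M. A f x = complex_of_real (\<integral>y. a (x, y) * cmod (f y) \<partial>M)"
  using nonneg_kernel_apply[OF A l2_nonneg_l2[OF f]]
proof eventually_elim
  case (elim x)
  have "(\<integral>y. complex_of_real (a (x, y)) * f y \<partial>M) = (\<integral>y. complex_of_real (a (x, y) * cmod (f y)) \<partial>M)"
  proof (rule integral_cong_AE)
    show "(\<lambda>y. complex_of_real (a (x, y)) * f y) \<in> borel_measurable M"
      "(\<lambda>y. complex_of_real (a (x, y) * cmod (f y))) \<in> borel_measurable M"
      using elim by (auto dest!: borel_measurable_integrable simp del: of_real_mult)
    from f have "AE y in M. f y = complex_of_real (cmod (f y))" by (simp add: l2_nonneg_def)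
    then show "AE y in M. complex_of_real (a (x, y)) * f y = complex_of_real (a (x, y) * cmod (f y))"
      by eventually_elim (metis of_real_mult)
  qed
  then show ?case using elim by (simp del: of_real_mult)
qed

lemma nonneg_kernel_l2_nonneg:
  assumes A: "nonneg_kernel M A a" and f: "l2_nonneg M f"
  shows "l2_nonneg M (A f)"
  using nonneg_kernel_apply_nonneg[OF A f] l2_operator_closed[OF nonneg_kernel_operator[OF A] l2_nonneg_l2[OF f]]
    nonneg_kernel_nonneg[OF A]
  by (auto simp: l2_nonneg_def elim!: AE_mp)

lemma nonneg_kernel_cmod_eq:
  assumes A: "nonneg_kernel M A a" and f: "l2_nonneg M f"
  shows "AE x in M. cmod (A f x) = (\<integral>y. a (x, y) * cmod (f y) \<partial>M)"
  using nonneg_kernel_apply_nonneg[OF A f]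
  by eventually_elim (use nonneg_kernel_nonneg[OF A] in simp)

lemma nonneg_kernel_cmod:
  assumes A: "nonneg_kernel M A a" and f: "f \<in> l2 M"
  shows "AE x in M. cmod (A f x) \<le> cmod (A (\<lambda>x. complex_of_real (cmod (f x))) x)"
  using nonneg_kernel_cmod_le[OF A f] nonneg_kernel_cmod_eq[OF A l2_nonneg_cmod[OF f]]
  by eventually_elim simp

lemma nonneg_kernel_norm_cmod:
  assumes A: "nonneg_kernel M A a" and f: "f \<in> l2 M"
  shows "l2_norm M (A f) \<le> l2_norm M (A (\<lambda>x. complex_of_real (cmod (f x))))"
  using nonneg_kernel_cmod[OF A f] l2_operator_closed[OF nonneg_kernel_operator[OF A]] f l2_cmod(1)[OF f]
  by (intro l2_dominated(2)) (auto intro: l2_measurable)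

text \<open>For fixed x, Hoelder is applied in y to the functions
  \<open>b i (x, y) * cmod (f i y)\<close>. The function g is only assumed to be dominated by the
  mean of the f i, and the conclusion has the same shape, so the step can be iterated.\<close>

lemma nonneg_kernel_geometric_mean:
  assumes I: "finite I" "I \<noteq> {}"
    and B: "\<And>i. i \<in> I \<Longrightarrow> nonneg_kernel M (B i) (b i)"
    and C: "nonneg_kernel M C (\<lambda>p. \<Prod>i\<in>I. b i p powr (1 / card I))"
    and f: "\<And>i. i \<in> I \<Longrightarrow> l2_nonneg M (f i)" and g: "g \<in> l2 M"
    and le: "AE x in M. cmod (g x) \<le> (\<Prod>i\<in>I. cmod (f i x) powr (1 / card I))"
  shows "AE x in M. cmod (C g x) \<le> (\<Prod>i\<in>I. cmod (B i (f i) x) powr (1 / card I))"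
proof -
  let ?a = "1 / card I" and ?c = "\<lambda>p. \<Prod>i\<in>I. b i p powr (1 / card I)"
  have b0: "0 \<le> b i p" if "i \<in> I" for i p using nonneg_kernel_nonneg[OF B[OF that]] .
  have "AE x in M. \<forall>i\<in>I. integrable M (\<lambda>y. b i (x, y) * cmod (f i y))"
    using nonneg_kernel_apply[OF B l2_nonneg_l2[OF f]] I(1)
    by (intro AE_finite_allI) (auto elim: AE_mp)
  moreover have "AE x in M. \<forall>i\<in>I. cmod (B i (f i) x) = (\<integral>y. b i (x, y) * cmod (f i y) \<partial>M)"
    using nonneg_kernel_cmod_eq[OF B f] I(1) by (intro AE_finite_allI) auto
  ultimately show ?thesis
    using nonneg_kernel_cmod_le[OF C g] nonneg_kernel_apply[OF C g]
  proof eventually_elim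
    case (elim x)
    have int: "integrable M (\<lambda>y. b i (x, y) * cmod (f i y))" if "i \<in> I" for i
      using elim(1) that by blast
    have nn: "0 \<le> b i (x, y) * cmod (f i y)" if "i \<in> I" for i y
      using b0[OF that] by simp
    have "cmod (C g x) \<le> (\<integral>y. ?c (x, y) * cmod (g y) \<partial>M)" by (rule elim(3))
    also have "\<dots> \<le> (\<integral>y. (\<Prod>i\<in>I. (b i (x, y) * cmod (f i y)) powr ?a) \<partial>M)"
    proof (rule integral_mono_AE)
      show "integrable M (\<lambda>y. ?c (x, y) * cmod (g y))" using elim(4) by blast
      show "integrable M (\<lambda>y. \<Prod>i\<in>I. (b i (x, y) * cmod (f i y)) powr ?a)"
        by (rule integrable_geometric_mean[OF I int nn])
      show "AE y in M. ?c (x, y) * cmod (g y) \<le> (\<Prod>i\<in>I. (b i (x, y) * cmod (f i y)) powr ?a)"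
        using le
      proof eventually_elim
        case (elim y)
        have "?c (x, y) * cmod (g y) \<le> ?c (x, y) * (\<Prod>i\<in>I. cmod (f i y) powr ?a)"
          by (rule mult_left_mono[OF elim]) (simp add: prod_nonneg)
        also have "\<dots> = (\<Prod>i\<in>I. b i (x, y) powr ?a * cmod (f i y) powr ?a)"
          by (simp add: prod.distrib)
        also have "\<dots> = (\<Prod>i\<in>I. (b i (x, y) * cmod (f i y)) powr ?a)"
          using b0 by (intro prod.cong) (auto simp: powr_mult)
        finally show ?case .
      qed
    qed
    also have "\<dots> \<le> (\<Prod>i\<in>I. (\<integral>y. b i (x, y) * cmod (f i y) \<partial>M) powr ?a)"
      by (rule integral_geometric_mean_le[OF I int nn])
    also have "\<dots> = (\<Prod>i\<in>I. cmod (B i (f i) x) powr ?a)"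
      using elim(2) by (intro prod.cong) auto
    finally show ?case .
  qed
qed

subsection \<open>Adjoints\<close>

text \<open>The inner integral is A applied to |f|, and Cauchy-Schwarz with |g| follows. This is the
  absolute integrability which both exchanges of integrals in \<open>nonneg_kernel_adjoint\<close>
  rest on.\<close>

lemma nonneg_kernel_adjoint_bound:
  assumes sf: "sigma_finite_measure M" and A: "l2_bounded M A K" "nonneg_kernel M A a"
    and f: "f \<in> l2 M" and g: "g \<in> l2 M"
  shows "(\<integral>\<^sup>+x. \<integral>\<^sup>+y. ennreal (a (x, y) * cmod (f y) * cmod (g x)) \<partial>M \<partial>M)
    \<le> ennreal (K * l2_norm M f * l2_norm M g)"
proof -
  interpret sigma_finite_measure M by (rule sf)
  note [measurable] = nonneg_kernel_measurable[OF A(2)] l2_measurable[OF f] l2_measurable[OF g]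
  note a0 = nonneg_kernel_nonneg[OF A(2)]
  define F where "F y = complex_of_real (cmod (f y))" for y
  have F: "l2_nonneg M F" "l2_norm M F = l2_norm M f"
    unfolding F_def using f by (auto intro: l2_nonneg_cmod l2_cmod)
  note AF = l2_bounded_closed[OF A(1) l2_nonneg_l2[OF F(1)]]
  have "AE x in M. (\<integral>\<^sup>+y. ennreal (a (x, y) * cmod (f y) * cmod (g x)) \<partial>M)
      = ennreal (cmod (A F x) * cmod (g x))"
    using nonneg_kernel_apply[OF A(2) f] nonneg_kernel_cmod_eq[OF A(2) F(1)] AE_space
  proof eventually_elim
    case (elim x)
    have [measurable]: "(\<lambda>y. a (x, y)) \<in> borel_measurable M" using elim(3) by measurable
    have "(\<integral>\<^sup>+y. ennreal (a (x, y) * cmod (f y) * cmod (g x)) \<partial>M)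
        = (\<integral>\<^sup>+y. ennreal (a (x, y) * cmod (f y)) * ennreal (cmod (g x)) \<partial>M)"
      using a0 by (simp add: ennreal_mult)
    also have "\<dots> = (\<integral>\<^sup>+y. ennreal (a (x, y) * cmod (f y)) \<partial>M) * ennreal (cmod (g x))"
      by (rule nn_integral_multc) measurable
    also have "(\<integral>\<^sup>+y. ennreal (a (x, y) * cmod (f y)) \<partial>M) = ennreal (\<integral>y. a (x, y) * cmod (f y) \<partial>M)"
      using elim(1) a0 by (intro nn_integral_eq_integral) auto
    also have "(\<integral>y. a (x, y) * cmod (f y) \<partial>M) = cmod (A F x)"
      using elim(2) by (simp add: F_def)
    finally show ?case by (simp add: ennreal_mult)
  qed
  then have "(\<integral>\<^sup>+x. \<integral>\<^sup>+y. ennreal (a (x, y) * cmod (f y) * cmod (g x)) \<partial>M \<partial>M)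
      = (\<integral>\<^sup>+x. ennreal (cmod (A F x) * cmod (g x)) \<partial>M)"
    by (rule nn_integral_cong_AE)
  also have "\<dots> = ennreal (\<integral>x. cmod (A F x) * cmod (g x) \<partial>M)"
    by (intro nn_integral_eq_integral l2_mult_integrable AF g) auto
  also have "\<dots> \<le> ennreal (K * l2_norm M f * l2_norm M g)"
  proof (rule ennreal_leI)
    have "(\<integral>x. cmod (A F x) * cmod (g x) \<partial>M) \<le> l2_norm M (A F) * l2_norm M g"
      by (rule l2_Cauchy_Schwarz[OF AF g])
    also have "\<dots> \<le> (K * l2_norm M f) * l2_norm M g"
      using l2_boundedD[OF A(1) l2_nonneg_l2[OF F(1)]] F(2) by (intro mult_right_mono) auto
    finally show "(\<integral>x. cmod (A F x) * cmod (g x) \<partial>M) \<le> K * l2_norm M f * l2_norm M g" .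
  qed
  finally show ?thesis .
qed

text \<open>
  A nonnegative function which is bounded as a functional on \<open>L\<^sup>2\<close> belongs to \<open>L\<^sup>2\<close>: test it against
  its truncations.
\<close>

lemma l2_by_duality:
  fixes h :: "'a \<Rightarrow> ennreal"
  assumes sf: "sigma_finite_measure M" and h [measurable]: "h \<in> borel_measurable M" and L: "0 \<le> L"
    and dual: "\<And>f. f \<in> l2 M \<Longrightarrow> (\<integral>\<^sup>+y. ennreal (cmod (f y)) * h y \<partial>M) \<le> ennreal (L * l2_norm M f)"
  shows "AE y in M. h y < \<infinity>"
    and "(\<lambda>y. complex_of_real (enn2real (h y))) \<in> l2 M"
    and "l2_norm M (\<lambda>y. complex_of_real (enn2real (h y))) \<le> L"
proof -
  interpret sigma_finite_measure M by (rule sf)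
  obtain E :: "nat \<Rightarrow> 'a set" where E: "range E \<subseteq> sets M" "(\<Union>i. E i) = space M"
      "\<And>i. emeasure M (E i) \<noteq> \<infinity>" "incseq E"
    by (rule sigma_finite_incseq) blast
  have [measurable]: "E n \<in> sets M" for n using E(1) by blast
  \<comment> \<open>h is truncated in height and in support, which puts F n into L^2 before anything
    is known about h.\<close>
  define F where "F n y = complex_of_real (enn2real (min (h y) (ennreal (real n))) * indicator (E n) y)" for n y
  have [measurable]: "F n \<in> borel_measurable M" for n unfolding F_def by measurable
  have fin: "min (h y) (ennreal (real n)) < \<infinity>" for y n by (simp add: min_less_iff_disj)
  have cF: "ennreal (cmod (F n y)) = min (h y) (ennreal (real n)) * indicator (E n) y" for n y
    unfolding F_def using fin[of y n]
    by (auto simp: indicator_def norm_mult split: if_splits)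
  have F: "F n \<in> l2 M" for n
  proof -
    have "integrable M (\<lambda>y. (real n)\<^sup>2 * indicator (E n) y)"
      using E(3)[of n] by (intro integrable_mult_right integrable_real_indicator) (auto simp: less_top)
    then have "integrable M (\<lambda>y. (cmod (F n y))\<^sup>2)"
    proof (rule Bochner_Integration.integrable_bound)
      have "cmod (F n y) \<le> real n * indicator (E n) y" for y
        unfolding F_def using fin[of y n]
        by (auto simp: indicator_def norm_mult intro: enn2real_leI)
      then have le: "(cmod (F n y))\<^sup>2 \<le> (real n * indicator (E n) y)\<^sup>2" for y
        by (intro power_mono) auto
      have "norm ((cmod (F n y))\<^sup>2) \<le> norm ((real n)\<^sup>2 * indicator (E n) y)" for y
        using le[of y] by (cases "y \<in> E n") simp_all
      then show "AE y in M. norm ((cmod (F n y))\<^sup>2) \<le> norm ((real n)\<^sup>2 * indicator (E n) y)"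
        by simp
    qed measurable
    then show ?thesis by (simp add: l2_def)
  qed
  \<comment> \<open>As |F n| <= h, the square of ||F n|| is at most the integral of |F n| h, hence
    at most L ||F n||; one factor cancels.\<close>
  have Fn: "l2_norm M (F n) \<le> L" for n
  proof -
    have "ennreal ((l2_norm M (F n))\<^sup>2) = (\<integral>\<^sup>+y. ennreal ((cmod (F n y))\<^sup>2) \<partial>M)"
      unfolding l2_norm_square by (rule nn_integral_eq_integral[symmetric, OF l2_integrable[OF F]]) auto
    also have "\<dots> \<le> (\<integral>\<^sup>+y. ennreal (cmod (F n y)) * h y \<partial>M)"
    proof (rule nn_integral_mono)
      fix y
      have "ennreal (cmod (F n y)) \<le> h y" unfolding cF by (auto simp: indicator_def)
      then show "ennreal ((cmod (F n y))\<^sup>2) \<le> ennreal (cmod (F n y)) * h y"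
        by (simp add: power2_eq_square ennreal_mult mult_left_mono)
    qed
    also have "\<dots> \<le> ennreal (L * l2_norm M (F n))" by (rule dual[OF F])
    finally have "l2_norm M (F n) * l2_norm M (F n) \<le> L * l2_norm M (F n)"
      using L by (simp add: power2_eq_square ennreal_le_iff)
    then show ?thesis
      using L by (cases "l2_norm M (F n) = 0") (auto simp: mult_le_cancel_right order.strict_iff_order)
  qed
  define H where "H y = (SUP n. ennreal ((cmod (F n y))\<^sup>2))" for y
  have [measurable]: "H \<in> borel_measurable M" unfolding H_def by measurable
  have H: "(\<integral>\<^sup>+y. H y \<partial>M) \<le> ennreal (L\<^sup>2)"
  proof -
    have "incseq (\<lambda>n y. ennreal ((cmod (F n y))\<^sup>2))"
    proof (intro incseq_SucI le_funI)
      fix n y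
      have "indicator (E n) y \<le> (indicator (E (Suc n)) y :: ennreal)"
        using E(4) by (auto simp: indicator_def incseq_Suc_iff)
      then have "ennreal (cmod (F n y)) \<le> ennreal (cmod (F (Suc n) y))"
        unfolding cF by (intro mult_mono min.mono) (auto intro: ennreal_leI)
      then show "ennreal ((cmod (F n y))\<^sup>2) \<le> ennreal ((cmod (F (Suc n) y))\<^sup>2)"
        by (intro ennreal_leI power_mono) (auto simp: ennreal_le_iff)
    qed
    then have "(\<integral>\<^sup>+y. H y \<partial>M) = (SUP n. \<integral>\<^sup>+y. ennreal ((cmod (F n y))\<^sup>2) \<partial>M)"
      unfolding H_def by (intro nn_integral_monotone_convergence_SUP) measurable
    also have "\<dots> \<le> ennreal (L\<^sup>2)"
    proof (rule SUP_least)
      fix n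
      have "(\<integral>\<^sup>+y. ennreal ((cmod (F n y))\<^sup>2) \<partial>M) = ennreal ((l2_norm M (F n))\<^sup>2)"
        unfolding l2_norm_square by (rule nn_integral_eq_integral[OF l2_integrable[OF F]]) auto
      also have "\<dots> \<le> ennreal (L\<^sup>2)" by (intro ennreal_leI power_mono Fn) auto
      finally show "(\<integral>\<^sup>+y. ennreal ((cmod (F n y))\<^sup>2) \<partial>M) \<le> ennreal (L\<^sup>2)" .
    qed
    finally show ?thesis .
  qed
  then have "(\<integral>\<^sup>+y. H y \<partial>M) \<noteq> \<infinity>" by (auto simp: top_unique)
  then have "AE y in M. H y \<noteq> \<infinity>" by (intro nn_integral_PInf_AE) auto
  then have key: "AE y in M. h y < \<infinity> \<and> ennreal ((enn2real (h y))\<^sup>2) \<le> H y"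
    using AE_space
  proof eventually_elim
    case (elim y)
    obtain n0 where n0: "y \<in> E n" if "n \<ge> n0" for n
    proof -
      obtain k where "y \<in> E k" using E(2) elim(2) by blast
      then have "\<And>n. n \<ge> k \<Longrightarrow> y \<in> E n" using E(4) unfolding incseq_def by blast
      then show ?thesis using that by blast
    qed
    have up: "ennreal ((cmod (F n y))\<^sup>2) \<le> H y" for n unfolding H_def by (rule SUP_upper) simp
    have "h y \<noteq> \<infinity>"
    proof
      assume top: "h y = \<infinity>"
      have Hr: "H y = ennreal (enn2real (H y))" using elim(1) by (simp add: less_top)
      obtain k :: nat where k: "enn2real (H y) < real k" using reals_Archimedean2 by blast
      \<comment> \<open>If h y were infinite, F n y = n would give n^2 <= H y, which n > k
        contradicts; \<open>Suc k\<close> ensures n >= 1 and hence n <= n^2.\<close>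
      define n where "n = max (Suc k) n0"
      have "cmod (F n y) = real n" unfolding F_def using top n0[of n] by (simp add: n_def)
      then have "ennreal ((real n)\<^sup>2) \<le> ennreal (enn2real (H y))" using up[of n] Hr by simp
      then have "(real n)\<^sup>2 \<le> enn2real (H y)" by (simp add: ennreal_le_iff)
      moreover have "real n \<le> (real n)\<^sup>2" by (rule self_le_power) (simp_all add: n_def)
      moreover have "real k \<le> real n" by (simp add: n_def)
      ultimately show False using k by linarith
    qed
    then have hr: "h y = ennreal (enn2real (h y))" by (simp add: less_top)
    obtain k :: nat where k: "enn2real (h y) < real k" using reals_Archimedean2 by blast
    define n where "n = max k n0"
    have "enn2real (h y) \<le> real n" using k by (simp add: n_def)
    then have "min (h y) (ennreal (real n)) = h y"
      by (subst hr, subst hr) (simp add: min_def ennreal_leI)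
    then have "cmod (F n y) = enn2real (h y)" unfolding F_def using n0[of n] by (simp add: n_def)
    then show ?case using up[of n] \<open>h y \<noteq> \<infinity>\<close> by (simp add: less_top)
  qed
  then show "AE y in M. h y < \<infinity>" by eventually_elim simp
  let ?g = "\<lambda>y. complex_of_real (enn2real (h y))"
  have "AE y in M. ennreal ((cmod (?g y))\<^sup>2) \<le> H y"
    using key by eventually_elim simp
  then have "(\<integral>\<^sup>+y. ennreal ((cmod (?g y))\<^sup>2) \<partial>M) \<le> (\<integral>\<^sup>+y. H y \<partial>M)"
    by (rule nn_integral_mono_AE)
  then have le: "(\<integral>\<^sup>+y. ennreal ((cmod (?g y))\<^sup>2) \<partial>M) \<le> ennreal (L\<^sup>2)" using H by (rule order_trans)
  have i: "integrable M (\<lambda>y. (cmod (?g y))\<^sup>2)"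
    by (rule integrableI_bounded) (use le in \<open>auto intro: le_less_trans\<close>)
  then show "?g \<in> l2 M" by (simp add: l2_def)
  have "(l2_norm M ?g)\<^sup>2 \<le> L\<^sup>2"
    using le nn_integral_eq_integral[OF i] by (simp add: l2_norm_square ennreal_le_iff)
  then show "l2_norm M ?g \<le> L" by (rule power2_le_imp_le) (rule L)
qed

text \<open>It is not clear beforehand that integrals against the transposed kernel converge.
  Tonelli turns the bound for A into a bounded functional given by the integral h of absolute
  values; duality then places h in L^2, which yields convergence almost everywhere and the bound K
  at once.\<close>

lemma nonneg_kernel_adjoint:
  assumes sf: "sigma_finite_measure M" and A: "l2_bounded M A K" "nonneg_kernel M A a"
  shows "\<exists>B. l2_bounded M B K \<and> nonneg_kernel M B (\<lambda>(x, y). a (y, x)) \<and>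
    (\<forall>f\<in>l2 M. \<forall>g\<in>l2 M. l2_inner M (A f) g = l2_inner M f (B g))"
proof -
  interpret sigma_finite_measure M by (rule sf)
  interpret P: pair_sigma_finite M M ..
  note [measurable] = nonneg_kernel_measurable[OF A(2)]
  note a0 = nonneg_kernel_nonneg[OF A(2)]
  define h where "h g y = (\<integral>\<^sup>+x. ennreal (a (x, y) * cmod (g x)) \<partial>M)" for g :: "'a \<Rightarrow> complex" and y
  define B where "B g y = (\<integral>x. complex_of_real (a (x, y)) * g x \<partial>M)" for g y
  have hm: "h g \<in> borel_measurable M" if "g \<in> l2 M" for g
    using l2_measurable[OF that] unfolding h_def by measurable
  have sect: "(\<lambda>x. complex_of_real (a (x, y)) * g x) \<in> borel_measurable M"
    if "g \<in> l2 M" "y \<in> space M" for g y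
    using l2_measurable[OF that(1)] that(2) by measurable
  have dual: "(\<integral>\<^sup>+y. ennreal (cmod (f y)) * h g y \<partial>M) \<le> ennreal (K * l2_norm M g * l2_norm M f)"
    if f: "f \<in> l2 M" and g: "g \<in> l2 M" for f g
  proof -
    note [measurable] = l2_measurable[OF f] l2_measurable[OF g]
    have "(\<integral>\<^sup>+y. ennreal (cmod (f y)) * h g y \<partial>M)
        = (\<integral>\<^sup>+y. \<integral>\<^sup>+x. ennreal (a (x, y) * cmod (f y) * cmod (g x)) \<partial>M \<partial>M)"
      unfolding h_def
      by (intro nn_integral_cong, subst nn_integral_cmult[symmetric])
        (auto simp: ennreal_mult'[symmetric] a0 mult_ac intro!: nn_integral_cong)
    also have "\<dots> = (\<integral>\<^sup>+x. \<integral>\<^sup>+y. ennreal (a (x, y) * cmod (f y) * cmod (g x)) \<partial>M \<partial>M)"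
      by (rule P.Fubini') measurable
    also have "\<dots> \<le> ennreal (K * l2_norm M f * l2_norm M g)"
      by (rule nonneg_kernel_adjoint_bound[OF sf A f g])
    finally show ?thesis by (simp add: mult_ac)
  qed
  have L: "0 \<le> K * l2_norm M g" for g using l2_bounded_nonneg[OF A(1)] by simp
  have dualD: "AE y in M. h g y < \<infinity>" "(\<lambda>y. complex_of_real (enn2real (h g y))) \<in> l2 M"
    "l2_norm M (\<lambda>y. complex_of_real (enn2real (h g y))) \<le> K * l2_norm M g" if g: "g \<in> l2 M" for g
    using l2_by_duality[OF sf hm[OF g] L[of g]] dual[OF _ g] by blast+
  have int: "AE y in M. integrable M (\<lambda>x. complex_of_real (a (x, y)) * g x) \<and> cmod (B g y) \<le> enn2real (h g y)"
    if g: "g \<in> l2 M" for g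
    using dualD(1)[OF g] AE_space
  proof eventually_elim
    case (elim y)
    have hy: "h g y = (\<integral>\<^sup>+x. ennreal (norm (complex_of_real (a (x, y)) * g x)) \<partial>M)"
      unfolding h_def using a0 by (simp add: norm_mult)
    then have i: "integrable M (\<lambda>x. complex_of_real (a (x, y)) * g x)"
      using elim by (intro integrableI_bounded sect g) auto
    have "cmod (B g y) \<le> (\<integral>x. norm (complex_of_real (a (x, y)) * g x) \<partial>M)"
      unfolding B_def by (rule integral_norm_bound)
    also have "\<dots> = enn2real (h g y)"
      unfolding hy using i by (intro integral_eq_nn_integral) auto
    finally show ?case using i by blast
  qed
  have Bg: "B g \<in> l2 M" "l2_norm M (B g) \<le> K * l2_norm M g" if g: "g \<in> l2 M" for g
  proof -
    note [measurable] = l2_measurable[OF g]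
    have m: "B g \<in> borel_measurable M" unfolding B_def by measurable
    have le: "AE y in M. cmod (B g y) \<le> cmod (complex_of_real (enn2real (h g y)))"
      using int[OF g] by eventually_elim simp
    note d = l2_dominated[OF m dualD(2)[OF g] le]
    show "B g \<in> l2 M" by (rule d(1))
    show "l2_norm M (B g) \<le> K * l2_norm M g" using d(2) dualD(3)[OF g] by linarith
  qed
  have Bop: "l2_operator M B"
    unfolding l2_operator_def
  proof (intro conjI ballI allI impI)
    fix f assume f: "f \<in> l2 M"
    show "B f \<in> l2 M" by (rule Bg(1)[OF f])
    show "AE y in M. B (\<lambda>x. c * f x) y = c * B f y" for c
      using int[OF f]
      by eventually_elim (simp add: B_def mult.left_commute)
  next
    fix f g assume f: "f \<in> l2 M" and g: "g \<in> l2 M"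
    show "AE y in M. B (\<lambda>x. f x + g x) y = B f y + B g y"
      using int[OF f] int[OF g] by eventually_elim (simp add: B_def distrib_left)
    show "AE y in M. B f y = B g y" if "AE x in M. f x = g x"
      using AE_space
    proof eventually_elim
      case (elim y)
      show ?case unfolding B_def
        using that by (intro integral_cong_AE sect f g elim) (auto elim: AE_mp)
    qed
  qed
  have "l2_bounded M B K"
    using Bop Bg(2) l2_bounded_nonneg[OF A(1)] by (simp add: l2_bounded_def)
  moreover have "nonneg_kernel M B (\<lambda>(x, y). a (y, x))"
    unfolding nonneg_kernel_def has_kernel_def
  proof (intro conjI ballI allI)
    show "0 \<le> (case p of (x, y) \<Rightarrow> a (y, x))" for p using a0 by (cases p) simp
    show "l2_operator M B" by (rule Bop)
    show "(\<lambda>p. complex_of_real (case p of (x, y) \<Rightarrow> a (y, x))) \<in> borel_measurable (M \<Otimes>\<^sub>M M)"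
      by measurable
    fix g assume g: "g \<in> l2 M"
    show "AE y in M. integrable M (\<lambda>x. complex_of_real (case (y, x) of (x, y) \<Rightarrow> a (y, x)) * g x) \<and>
        B g y = (\<integral>x. complex_of_real (case (y, x) of (x, y) \<Rightarrow> a (y, x)) * g x \<partial>M)"
      using int[OF g] by eventually_elim (simp add: B_def)
  qed
  moreover have "l2_inner M (A f) g = l2_inner M f (B g)" if f: "f \<in> l2 M" and g: "g \<in> l2 M" for f g
  proof -
    note [measurable] = l2_measurable[OF f] l2_measurable[OF g]
    \<comment> \<open>The adjoint relation is Fubini for this function, whose absolute integrability
      is \<open>nonneg_kernel_adjoint_bound\<close>.\<close>
    define k where "k x y = complex_of_real (a (x, y)) * f y * cnj (g x)" for x y
    have km [measurable]: "case_prod k \<in> borel_measurable (M \<Otimes>\<^sub>M M)"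
      unfolding k_def by measurable
    have k: "integrable (M \<Otimes>\<^sub>M M) (case_prod k)"
    proof (rule integrableI_bounded[OF km])
      have "(\<integral>\<^sup>+p. ennreal (norm (case_prod k p)) \<partial>(M \<Otimes>\<^sub>M M))
          = (\<integral>\<^sup>+x. \<integral>\<^sup>+y. ennreal (norm (k x y)) \<partial>M \<partial>M)"
        by (subst nn_integral_fst[symmetric]) auto
      also have "\<dots> = (\<integral>\<^sup>+x. \<integral>\<^sup>+y. ennreal (a (x, y) * cmod (f y) * cmod (g x)) \<partial>M \<partial>M)"
        using a0 by (simp add: k_def norm_mult)
      also have "\<dots> \<le> ennreal (K * l2_norm M f * l2_norm M g)"
        by (rule nonneg_kernel_adjoint_bound[OF sf A f g])
      finally show "(\<integral>\<^sup>+p. ennreal (norm (case_prod k p)) \<partial>(M \<Otimes>\<^sub>M M)) < \<infinity>"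
        by (auto intro: le_less_trans)
    qed
    have "l2_inner M (A f) g = (\<integral>x. (\<integral>y. k x y \<partial>M) \<partial>M)"
      unfolding l2_inner_def
    proof (rule integral_cong_AE)
      show "(\<lambda>x. A f x * cnj (g x)) \<in> borel_measurable M"
        using l2_measurable[OF l2_bounded_closed[OF A(1) f]] by measurable
      show "(\<lambda>x. \<integral>y. k x y \<partial>M) \<in> borel_measurable M" by measurable
      show "AE x in M. A f x * cnj (g x) = (\<integral>y. k x y \<partial>M)"
        using nonneg_kernel_apply[OF A(2) f] by eventually_elim (simp add: k_def)
    qed
    also have "\<dots> = (\<integral>y. (\<integral>x. k x y \<partial>M) \<partial>M)"
      by (rule P.Fubini_integral[OF k, symmetric])
    also have "\<dots> = l2_inner M f (B g)"
      unfolding l2_inner_def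
    proof (rule Bochner_Integration.integral_cong[OF refl])
      fix y
      have "(\<integral>x. k x y \<partial>M) = (\<integral>x. f y * cnj (complex_of_real (a (x, y)) * g x) \<partial>M)"
        by (simp add: k_def mult_ac)
      also have "\<dots> = f y * (\<integral>x. cnj (complex_of_real (a (x, y)) * g x) \<partial>M)"
        by (rule integral_mult_right_zero)
      also have "(\<integral>x. cnj (complex_of_real (a (x, y)) * g x) \<partial>M) = cnj (B g y)"
        unfolding B_def by (rule Bochner_Integration.integral_cnj)
      finally show "(\<integral>x. k x y \<partial>M) = f y * cnj (B g y)" .
    qed
    finally show ?thesis .
  qed
  ultimately show ?thesis by blast
qed

subsection \<open>Products and powers of sets of operators\<close>

lemma listset_iff: "As \<in> listset Ss \<longleftrightarrow> list_all2 (\<in>) As Ss"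
  by (induction Ss arbitrary: As) (auto simp: set_Cons_def list_all2_Cons2)

lemma in_set_prod_iff: "T \<in> set_prod Ss \<longleftrightarrow> (\<exists>As. list_all2 (\<in>) As Ss \<and> T = foldr (\<circ>) As id)"
  by (auto simp: set_prod_def listset_iff)

lemma foldr_comp_append: "foldr (\<circ>) (As @ Bs) id = foldr (\<circ>) As id \<circ> foldr (\<circ>) Bs id"
  by (induction As) (auto simp: comp_assoc)

lemma l2_bounded_foldr:
  "(\<And>A. A \<in> set As \<Longrightarrow> l2_bounded M A K) \<Longrightarrow> l2_bounded M (foldr (\<circ>) As id) (K ^ length As)"
  by (induction As) (auto simp: l2_bounded_id l2_bounded_comp)

lemma in_set_power_iff:
  "T \<in> set_power \<Sigma> k \<longleftrightarrow> (\<exists>As. length As = k \<and> set As \<subseteq> \<Sigma> \<and> T = foldr (\<circ>) As id)"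
proof -
  have "list_all2 (\<in>) As (replicate k \<Sigma>) \<longleftrightarrow> length As = k \<and> set As \<subseteq> \<Sigma>" for As
    by (auto simp: list_all2_conv_all_nth in_set_conv_nth subset_iff)
  then show ?thesis by (simp add: set_power_def in_set_prod_iff conj_assoc)
qed

lemma set_power_l2_bounded:
  assumes "\<forall>A\<in>\<Sigma>. l2_bounded M A K"
  shows "\<forall>T\<in>set_power \<Sigma> k. l2_bounded M T (K ^ k)"
  using assms by (auto simp: in_set_power_iff subset_iff intro!: l2_bounded_foldr)

lemma funpow_in_set_power: "B \<in> \<Sigma> \<Longrightarrow> B ^^ k \<in> set_power \<Sigma> k"
  unfolding in_set_power_iff by (rule exI[of _ "replicate k B"]) (induction k; auto)

lemma set_power_add:
  assumes "T \<in> set_power \<Sigma> (m + n)"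
  shows "\<exists>U\<in>set_power \<Sigma> m. \<exists>V\<in>set_power \<Sigma> n. T = U \<circ> V"
proof -
  obtain As where As: "length As = m + n" "set As \<subseteq> \<Sigma>" "T = foldr (\<circ>) As id"
    using assms by (auto simp: in_set_power_iff)
  have "T = foldr (\<circ>) (take m As) id \<circ> foldr (\<circ>) (drop m As) id"
    using As(3) by (metis append_take_drop_id foldr_comp_append)
  moreover have "foldr (\<circ>) (take m As) id \<in> set_power \<Sigma> m"
    using As(1,2) set_take_subset[of m As] unfolding in_set_power_iff
    by (intro exI[of _ "take m As"]) auto
  moreover have "foldr (\<circ>) (drop m As) id \<in> set_power \<Sigma> n"
    using As(1,2) set_drop_subset[of m As] unfolding in_set_power_iff
    by (intro exI[of _ "drop m As"]) auto
  ultimately show ?thesis by blast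
qed

lemma set_norm_le:
  assumes "0 \<le> K" "\<And>A. A \<in> \<Sigma> \<Longrightarrow> op_norm M A \<le> K"
  shows "set_norm M \<Sigma> \<le> K"
  unfolding set_norm_def by (rule cSup_least) (use assms in auto)

lemma op_norm_le_set_norm:
  assumes "\<forall>A\<in>\<Sigma>. l2_bounded M A K" and A: "A \<in> \<Sigma>"
  shows "op_norm M A \<le> set_norm M \<Sigma>"
  unfolding set_norm_def
proof (rule cSup_upper)
  show "bdd_above (insert 0 (op_norm M ` \<Sigma>))"
    using assms(1) op_norm_le_bound l2_bounded_nonneg[OF bspec[OF assms(1) A]]
    by (intro bdd_aboveI[of _ K]) auto
qed (use A in auto)

lemma set_norm_nonneg:
  assumes "\<forall>A\<in>\<Sigma>. l2_bounded M A K"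
  shows "0 \<le> set_norm M \<Sigma>"
proof (cases "\<Sigma> = {}")
  case False
  then obtain A where A: "A \<in> \<Sigma>" by blast
  have "0 \<le> op_norm M A" by (rule op_norm_nonneg[OF bspec[OF assms A]])
  also have "\<dots> \<le> set_norm M \<Sigma>" by (rule op_norm_le_set_norm[OF assms A])
  finally show ?thesis .
qed (simp add: set_norm_def)

subsection \<open>Joint and generalized spectral radius\<close>

lemma convergent_root_submultiplicative:
  fixes a :: "nat \<Rightarrow> real"
  assumes a0: "\<And>n. 0 \<le> a n" and sub: "\<And>m n. a (m + n) \<le> a m * a n"
  shows "convergent (\<lambda>n. root n (a n))"
proof -
  \<comment> \<open>Index 0 is left out, because \<open>root 0\<close> is constantly 0.\<close>
  define L where "L = (INF n\<in>{1..}. root n (a n))"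
  have bdd: "bdd_below ((\<lambda>n. root n (a n)) ` {1..})"
    using a0 by (intro bdd_belowI[of _ 0]) auto
  have L: "L \<le> root n (a n)" if "n \<ge> 1" for n
    unfolding L_def using bdd that by (intro cINF_lower) auto
  have "0 \<le> L" unfolding L_def using a0 by (intro cINF_greatest) auto
  have "(\<lambda>n. root n (a n)) \<longlonglongrightarrow> L"
  proof (rule order_tendstoI)
    fix y assume "y < L"
    show "\<forall>\<^sub>F n in sequentially. y < root n (a n)"
      using eventually_ge_at_top[of 1] by eventually_elim (use L \<open>y < L\<close> in \<open>auto intro: less_le_trans\<close>)
  next
    fix y assume y: "L < y"
    then obtain c where c: "L < c" "c < y" using dense by blast
    then have c0: "0 < c" using \<open>0 \<le> L\<close> by linarith
    obtain p where p: "p \<ge> 1" "root p (a p) < c"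
      using c(1) bdd unfolding L_def by (subst (asm) cINF_less_iff) auto
    have ap: "a p \<le> c ^ p"
      using p a0[of p] real_root_pow_pos2[of p "a p"] power_mono[of "root p (a p)" c p] by auto
    \<comment> \<open>The sum covers all remainders of n modulo p; the summand 1 makes C positive,
      so that its n-th roots tend to 1.\<close>
    define C where "C = (\<Sum>r<p. a r / c ^ r) + 1"
    have C: "0 < C" unfolding C_def using a0 c0 by (intro add_nonneg_pos sum_nonneg) auto
    have apq: "a (q * p + r) \<le> (c ^ p) ^ q * a r" for q r
    proof (induction q)
      case (Suc q)
      have "a (Suc q * p + r) = a (p + (q * p + r))" by (simp add: add.assoc)
      also have "\<dots> \<le> a p * a (q * p + r)" by (rule sub)
      also have "\<dots> \<le> c ^ p * ((c ^ p) ^ q * a r)"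
        using ap Suc a0 c0 by (intro mult_mono) auto
      finally show ?case by (simp add: mult.assoc)
    qed simp
    have an: "a n \<le> c ^ n * C" for n
    proof -
      have r: "n mod p < p" using p by simp
      have "a n = a (n div p * p + n mod p)" by simp
      also have "\<dots> \<le> (c ^ p) ^ (n div p) * a (n mod p)" by (rule apq)
      also have "\<dots> = c ^ (n div p * p + n mod p) * (a (n mod p) / c ^ (n mod p))"
        using c0 by (simp only: power_add power_mult[symmetric] mult.commute) simp
      also have "\<dots> = c ^ n * (a (n mod p) / c ^ (n mod p))" by simp
      also have "a (n mod p) / c ^ (n mod p) \<le> (\<Sum>r<p. a r / c ^ r)"
        using r a0 c0 by (intro member_le_sum) auto
      finally show ?thesis
        using c0 by (simp add: C_def mult_left_mono distrib_left add_increasing2)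
    qed
    have "(\<lambda>n. c * root n C) \<longlonglongrightarrow> c * 1"
      by (intro tendsto_mult_left LIMSEQ_root_const C)
    then have "\<forall>\<^sub>F n in sequentially. c * root n C < y"
      using c(2) by (auto dest: order_tendstoD(2))
    then show "\<forall>\<^sub>F n in sequentially. root n (a n) < y"
      using eventually_ge_at_top[of 1]
    proof eventually_elim
      case (elim n)
      have "root n (a n) \<le> root n (c ^ n * C)" using an elim(2) by simp
      also have "\<dots> = c * root n C" using elim(2) c0 by (simp add: real_root_mult real_root_power_cancel)
      finally show ?case using elim(1) by linarith
    qed
  qed
  then show ?thesis by (auto simp: convergent_def)
qed

text \<open>The \<open>lim\<close> in the definition is meaningful only once convergence is known;
  it follows from submultiplicativity of the norms of the powers.\<close>

lemma joint_spectral_radius_tendsto: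
  assumes \<Sigma>: "\<forall>A\<in>\<Sigma>. l2_bounded M A K"
  shows "(\<lambda>k. root k (set_norm M (set_power \<Sigma> k))) \<longlonglongrightarrow> joint_spectral_radius M \<Sigma>"
proof -
  note bd = set_power_l2_bounded[OF \<Sigma>]
  note nn = set_norm_nonneg[OF bd]
  have "set_norm M (set_power \<Sigma> (m + n)) \<le> set_norm M (set_power \<Sigma> m) * set_norm M (set_power \<Sigma> n)" for m n
  proof (rule set_norm_le)
    show "0 \<le> set_norm M (set_power \<Sigma> m) * set_norm M (set_power \<Sigma> n)" using nn by simp
    fix T assume "T \<in> set_power \<Sigma> (m + n)"
    then obtain U V where U: "U \<in> set_power \<Sigma> m" and V: "V \<in> set_power \<Sigma> n" and T: "T = U \<circ> V"
      using set_power_add by blast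
    have "op_norm M T \<le> op_norm M U * op_norm M V"
      unfolding T by (intro op_norm_le_bound l2_bounded_comp op_norm_l2_bounded[OF bspec[OF bd U]] op_norm_l2_bounded[OF bspec[OF bd V]])
    also have "\<dots> \<le> set_norm M (set_power \<Sigma> m) * set_norm M (set_power \<Sigma> n)"
      using U V by (intro mult_mono op_norm_le_set_norm[OF bd] nn op_norm_nonneg[OF bspec[OF bd]])
    finally show "op_norm M T \<le> set_norm M (set_power \<Sigma> m) * set_norm M (set_power \<Sigma> n)" .
  qed
  then have "convergent (\<lambda>k. root k (set_norm M (set_power \<Sigma> k)))"
    using nn by (intro convergent_root_submultiplicative)
  then show ?thesis by (simp add: joint_spectral_radius_def convergent_LIMSEQ_iff)
qed

text \<open>Write n = r + p q with r < p: the q blocks are controlled by the hypothesis, and E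
  bounds the cost of the remaining r factors.\<close>

lemma power_bound_of_some_power:
  assumes B: "l2_bounded M B K" and p: "p \<ge> 1" and s: "0 < s" and C: "0 \<le> C"
    and le: "\<And>n f. f \<in> l2 M \<Longrightarrow> l2_norm M (((B ^^ p) ^^ n) f) \<le> C * (s ^ p) ^ n * l2_norm M f"
  shows "\<exists>D\<ge>0. \<forall>n. \<forall>f\<in>l2 M. l2_norm M ((B ^^ n) f) \<le> D * s ^ n * l2_norm M f"
proof -
  have K: "0 \<le> K" by (rule l2_bounded_nonneg[OF B])
  define E where "E = (\<Sum>r<p. K ^ r / s ^ r)"
  have E: "0 \<le> E" unfolding E_def using K s by (intro sum_nonneg) auto
  have "l2_norm M ((B ^^ n) f) \<le> (E * C) * s ^ n * l2_norm M f" if f: "f \<in> l2 M" for n f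
  proof -
    define r q where "r = n mod p" and "q = n div p"
    have n: "n = r + p * q" by (simp add: r_def q_def)
    have r: "r < p" using p by (simp add: r_def)
    have B2: "(B ^^ p) ^^ q = B ^^ (p * q)" by (simp add: funpow_mult mult.commute)
    have g: "(B ^^ (p * q)) f \<in> l2 M" by (rule l2_bounded_closed[OF l2_bounded_pow[OF B] f])
    have "l2_norm M ((B ^^ n) f) = l2_norm M ((B ^^ r) ((B ^^ (p * q)) f))"
      unfolding n funpow_add by simp
    also have "\<dots> \<le> K ^ r * l2_norm M ((B ^^ (p * q)) f)"
      by (rule l2_boundedD[OF l2_bounded_pow[OF B] g])
    also have "\<dots> \<le> K ^ r * (C * (s ^ p) ^ q * l2_norm M f)"
      using le[OF f, of q] K unfolding B2 by (intro mult_left_mono) auto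
    also have "\<dots> = (K ^ r / s ^ r) * (C * s ^ n * l2_norm M f)"
      using s by (simp add: n power_add power_mult)
    also have "\<dots> \<le> E * (C * s ^ n * l2_norm M f)"
      unfolding E_def using r K s C by (intro mult_right_mono member_le_sum) auto
    finally show ?thesis by (simp add: mult.assoc)
  qed
  then show ?thesis using E C by (intro exI[of _ "E * C"]) auto
qed

lemma root_less_imp_less_power:
  assumes "1 \<le> k" "0 \<le> x" "root k x < s"
  shows "x < s ^ k"
proof -
  have "x = root k x ^ k" using assms by (simp add: real_root_pow_pos2)
  also have "\<dots> < s ^ k" using assms by (intro power_strict_mono) auto
  finally show ?thesis .
qed

lemma power_bound_joint:
  assumes \<Sigma>: "\<forall>A\<in>\<Sigma>. l2_bounded M A K" and B: "B \<in> \<Sigma>"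
    and s: "joint_spectral_radius M \<Sigma> < s" "0 < s"
  shows "\<exists>D\<ge>0. \<forall>n. \<forall>f\<in>l2 M. l2_norm M ((B ^^ n) f) \<le> D * s ^ n * l2_norm M f"
proof -
  note bd = set_power_l2_bounded[OF \<Sigma>]
  have "\<forall>\<^sub>F k in sequentially. root k (set_norm M (set_power \<Sigma> k)) < s"
    by (rule order_tendstoD(2)[OF joint_spectral_radius_tendsto[OF \<Sigma>] s(1)])
  then obtain p where p: "p \<ge> 1" "root p (set_norm M (set_power \<Sigma> p)) < s"
    using eventually_happens[OF eventually_conj[OF _ eventually_ge_at_top[of 1]]] by force
  have "op_norm M (B ^^ p) \<le> set_norm M (set_power \<Sigma> p)"
    by (rule op_norm_le_set_norm[OF bd funpow_in_set_power[OF B]])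
  also have "\<dots> \<le> s ^ p"
    using root_less_imp_less_power[OF p(1) set_norm_nonneg[OF bd] p(2)] by simp
  finally have "op_norm M (B ^^ p) \<le> s ^ p" .
  then have bp: "l2_bounded M (B ^^ p) (s ^ p)"
    by (rule l2_bounded_mono[OF op_norm_l2_bounded[OF bspec[OF bd funpow_in_set_power[OF B]]]])
  have "l2_norm M (((B ^^ p) ^^ n) f) \<le> 1 * (s ^ p) ^ n * l2_norm M f" if "f \<in> l2 M" for n f
    using l2_boundedD[OF l2_bounded_pow[OF bp] that] by simp
  then show ?thesis
    by (intro power_bound_of_some_power[OF bspec[OF \<Sigma> B] p(1) s(2), of 1]) auto
qed

abbreviation sup_spectral_radius :: "'a measure \<Rightarrow> 'a l2op set \<Rightarrow> real" where
  "sup_spectral_radius M \<Sigma> \<equiv> Sup (insert 0 (op_spectral_radius M ` \<Sigma>))"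

lemma sup_spectral_radius_bdd:
  assumes "\<forall>A\<in>\<Sigma>. l2_bounded M A K"
  shows "bdd_above (insert 0 (op_spectral_radius M ` \<Sigma>))"
  by (rule bdd_aboveI[of _ "max 0 K"])
    (use op_spectral_radius_le_bound[OF bspec[OF assms]] in \<open>auto simp: le_max_iff_disj\<close>)

lemma sup_spectral_radius_nonneg:
  assumes "\<forall>A\<in>\<Sigma>. l2_bounded M A K"
  shows "0 \<le> sup_spectral_radius M \<Sigma>"
  by (rule cSup_upper) (use sup_spectral_radius_bdd[OF assms] in auto)

text \<open>\<open>real_of_ereal\<close> sends infinite values to 0, so the definition is faithful
  only because the limsup lies between 0 and a finite bound.\<close>

lemma generalized_spectral_radius_limsup:
  assumes \<Sigma>: "\<forall>A\<in>\<Sigma>. l2_bounded M A K"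
  shows "limsup (\<lambda>k. ereal (root k (sup_spectral_radius M (set_power \<Sigma> k))))
      = ereal (generalized_spectral_radius M \<Sigma>)" (is "limsup ?u = _")
    and "0 \<le> generalized_spectral_radius M \<Sigma>"
proof -
  note bd = set_power_l2_bounded[OF \<Sigma>]
  \<comment> \<open>K may be negative if \<open>\<Sigma>\<close> is empty.\<close>
  define L where "L = max 0 K"
  have "root k (sup_spectral_radius M (set_power \<Sigma> k)) \<le> L" for k
  proof (cases "k = 0")
    case False
    have "sup_spectral_radius M (set_power \<Sigma> k) \<le> L ^ k"
    proof (rule cSup_least)
      fix y assume "y \<in> insert 0 (op_spectral_radius M ` set_power \<Sigma> k)"
      moreover have "op_spectral_radius M T \<le> L ^ k" if "T \<in> set_power \<Sigma> k" for T
      proof (rule op_spectral_radius_le_bound)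
        have "\<forall>A\<in>\<Sigma>. l2_bounded M A L" using \<Sigma> by (auto simp: L_def intro: l2_bounded_mono)
        then show "l2_bounded M T (L ^ k)" using set_power_l2_bounded that by blast
      qed
      ultimately show "y \<le> L ^ k" by (auto simp: L_def)
    qed simp
    then have "root k (sup_spectral_radius M (set_power \<Sigma> k)) \<le> root k (L ^ k)"
      using False by simp
    also have "\<dots> = L" using False by (simp add: real_root_power_cancel L_def)
    finally show ?thesis .
  qed (simp add: L_def)
  then have up: "limsup ?u \<le> ereal L" by (intro Limsup_bounded) auto
  have "0 \<le> root k (sup_spectral_radius M (set_power \<Sigma> k))" for k
    using sup_spectral_radius_nonneg[OF bd] by (cases "k = 0") auto
  then have "limsup (\<lambda>_. 0) \<le> limsup ?u" by (intro Limsup_mono) auto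
  then have low: "0 \<le> limsup ?u" by (simp add: Limsup_const)
  from up low show "limsup ?u = ereal (generalized_spectral_radius M \<Sigma>)"
    unfolding generalized_spectral_radius_def by (cases "limsup ?u") auto
  with low show "0 \<le> generalized_spectral_radius M \<Sigma>" by simp
qed

text \<open>A limsup below s provides some p >= 1 for which B^p, a member of
  \<open>set_power \<Sigma> p\<close>, has spectral radius below s^p. Gelfand's formula for B^p
  converts this into growth of norms.\<close>

lemma power_bound_generalized:
  assumes \<Sigma>: "\<forall>A\<in>\<Sigma>. l2_bounded M A K" and B: "B \<in> \<Sigma>"
    and s: "generalized_spectral_radius M \<Sigma> < s" "0 < s"
  shows "\<exists>D\<ge>0. \<forall>n. \<forall>f\<in>l2 M. l2_norm M ((B ^^ n) f) \<le> D * s ^ n * l2_norm M f"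
proof -
  note bd = set_power_l2_bounded[OF \<Sigma>]
  have "\<forall>\<^sub>F k in sequentially. ereal (root k (sup_spectral_radius M (set_power \<Sigma> k))) < ereal s"
    by (rule Limsup_lessD) (use s(1) generalized_spectral_radius_limsup(1)[OF \<Sigma>] in simp)
  then have "\<forall>\<^sub>F k in sequentially. root k (sup_spectral_radius M (set_power \<Sigma> k)) < s" by simp
  then obtain p where p: "p \<ge> 1" "root p (sup_spectral_radius M (set_power \<Sigma> p)) < s"
    using eventually_happens[OF eventually_conj[OF _ eventually_ge_at_top[of 1]]] by force
  have "op_spectral_radius M (B ^^ p) \<le> sup_spectral_radius M (set_power \<Sigma> p)"
    by (rule cSup_upper) (use funpow_in_set_power[OF B] sup_spectral_radius_bdd[OF bd] in auto)
  also have "\<dots> < s ^ p"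
    by (rule root_less_imp_less_power[OF p(1) sup_spectral_radius_nonneg[OF bd] p(2)])
  finally have "op_spectral_radius M (B ^^ p) < s ^ p" .
  from power_bound_of_spectral_radius[OF bspec[OF bd funpow_in_set_power[OF B]] this]
  show ?thesis using power_bound_of_some_power[OF bspec[OF \<Sigma> B] p(1) s(2)] by meson
qed

lemma joint_spectral_radius_nonneg:
  assumes \<Sigma>: "\<forall>A\<in>\<Sigma>. l2_bounded M A K"
  shows "0 \<le> joint_spectral_radius M \<Sigma>"
proof (rule LIMSEQ_le_const[OF joint_spectral_radius_tendsto[OF \<Sigma>]])
  show "\<exists>N. \<forall>n\<ge>N. 0 \<le> root n (set_norm M (set_power \<Sigma> n))"
    using set_norm_nonneg[OF set_power_l2_bounded[OF \<Sigma>]] by (intro exI[of _ 1]) auto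
qed

lemma radius_nonneg:
  assumes "r \<in> {generalized_spectral_radius M, joint_spectral_radius M}"
    and "\<forall>A\<in>\<Sigma>. l2_bounded M A K"
  shows "0 \<le> r \<Sigma>"
  using assms(1) generalized_spectral_radius_limsup(2)[OF assms(2)] joint_spectral_radius_nonneg[OF assms(2)]
  by auto

text \<open>Together with nonnegativity, this is all that the norm inequality uses about r, so both
  radii are treated at once from here on.\<close>

lemma radius_power_bound:
  assumes "r \<in> {generalized_spectral_radius M, joint_spectral_radius M}"
    and \<Sigma>: "\<forall>A\<in>\<Sigma>. l2_bounded M A K" and B: "B \<in> \<Sigma>" and s: "r \<Sigma> < s"
  shows "\<exists>D\<ge>0. \<forall>n. \<forall>f\<in>l2 M. l2_norm M ((B ^^ n) f) \<le> D * s ^ n * l2_norm M f"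
proof -
  have "0 < s" using radius_nonneg[OF assms(1) \<Sigma>] s by linarith
  then show ?thesis
    using assms(1) s power_bound_generalized[OF \<Sigma> B] power_bound_joint[OF \<Sigma> B] by auto
qed

subsection \<open>The radii of a set of adjoints\<close>

text \<open>A relation rather than an operation, since an adjoint is determined only up to equality
  almost everywhere.\<close>

definition l2_adjoint :: "'a measure \<Rightarrow> 'a l2op \<Rightarrow> 'a l2op \<Rightarrow> bool" where
  "l2_adjoint M A B \<longleftrightarrow> (\<forall>f\<in>l2 M. \<forall>g\<in>l2 M. l2_inner M (A f) g = l2_inner M f (B g))"

lemma l2_adjointD: "l2_adjoint M A B \<Longrightarrow> f \<in> l2 M \<Longrightarrow> g \<in> l2 M \<Longrightarrow> l2_inner M (A f) g = l2_inner M f (B g)"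
  by (simp add: l2_adjoint_def)

lemma l2_adjoint_sym: "l2_adjoint M A B \<Longrightarrow> l2_adjoint M B A"
  unfolding l2_adjoint_def by (metis l2_inner_cnj)

lemma l2_adjoint_bounded:
  assumes A: "l2_bounded M A K" and B: "l2_operator M B" and adj: "l2_adjoint M A B"
  shows "l2_bounded M B K"
  unfolding l2_bounded_def
proof (intro conjI ballI B l2_bounded_nonneg[OF A])
  fix g assume g: "g \<in> l2 M"
  have Bg: "B g \<in> l2 M" by (rule l2_operator_closed[OF B g])
  have "complex_of_real ((l2_norm M (B g))\<^sup>2) = l2_inner M (A (B g)) g"
    using l2_adjointD[OF adj Bg g] by (simp add: l2_inner_self)
  then have "(l2_norm M (B g))\<^sup>2 = cmod (l2_inner M (A (B g)) g)"
    by (metis abs_of_nonneg norm_of_real zero_le_power2)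
  also have "\<dots> \<le> l2_norm M (A (B g)) * l2_norm M g"
    by (rule l2_inner_le[OF l2_bounded_closed[OF A Bg] g])
  also have "\<dots> \<le> (K * l2_norm M (B g)) * l2_norm M g"
    by (rule mult_right_mono[OF l2_boundedD[OF A Bg]]) simp
  finally have "l2_norm M (B g) * l2_norm M (B g) \<le> (K * l2_norm M g) * l2_norm M (B g)"
    by (simp add: power2_eq_square mult_ac)
  then show "l2_norm M (B g) \<le> K * l2_norm M g"
    using l2_bounded_nonneg[OF A]
    by (cases "l2_norm M (B g) = 0") (auto simp: mult_le_cancel_right order.strict_iff_order)
qed

lemma l2_adjoint_comp:
  assumes "l2_operator M B" "l2_operator M A'" "l2_adjoint M A A'" "l2_adjoint M B B'"
  shows "l2_adjoint M (A \<circ> B) (B' \<circ> A')"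
  using assms by (simp add: l2_adjoint_def l2_operator_closed)

lemma l2_adjoint_foldr_rev:
  assumes "list_all2 (\<lambda>A B. l2_bounded M A K \<and> l2_bounded M B K \<and> l2_adjoint M A B) As Bs"
  shows "l2_adjoint M (foldr (\<circ>) As id) (foldr (\<circ>) (rev Bs) id)"
  using assms
proof (induction rule: list_all2_induct)
  case Nil
  show ?case by (simp add: l2_adjoint_def)
next
  case (Cons A As B Bs)
  have bd: "\<And>A. A \<in> set As \<Longrightarrow> l2_bounded M A K"
    using Cons.hyps(2) by (auto simp: list_all2_conv_all_nth in_set_conv_nth)
  have op: "l2_operator M (foldr (\<circ>) As id)" "l2_operator M B"
    using l2_bounded_operator[OF l2_bounded_foldr[OF bd]] Cons.hyps(1) by (auto intro: l2_bounded_operator)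
  have "l2_adjoint M (A \<circ> foldr (\<circ>) As id) (foldr (\<circ>) (rev Bs) id \<circ> B)"
    by (rule l2_adjoint_comp[OF op _ Cons.IH]) (use Cons.hyps(1) in blast)
  moreover have "foldr (\<circ>) (A # As) id = A \<circ> foldr (\<circ>) As id"
    "foldr (\<circ>) (rev (B # Bs)) id = foldr (\<circ>) (rev Bs) id \<circ> B"
    using foldr_comp_append[of "rev Bs" "[B]"] by simp_all
  ultimately show ?case by (simp only:)
qed

lemma op_norm_adjoint_le:
  assumes A: "l2_bounded M A K" and B: "l2_bounded M B L" and adj: "l2_adjoint M A B"
  shows "op_norm M B \<le> op_norm M A"
  by (rule op_norm_le_bound[OF l2_adjoint_bounded[OF op_norm_l2_bounded[OF A] l2_bounded_operator[OF B] adj]])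

lemma l2_adjoint_funpow:
  assumes A: "l2_bounded M A K" and B: "l2_bounded M B L" and adj: "l2_adjoint M A B"
  shows "l2_adjoint M (A ^^ n) (B ^^ n)"
proof (induction n)
  case 0
  show ?case by (simp add: l2_adjoint_def)
next
  case (Suc n)
  have "l2_adjoint M (A \<circ> A ^^ n) (B ^^ n \<circ> B)"
    by (intro l2_adjoint_comp Suc adj l2_bounded_operator[OF l2_bounded_pow[OF A]] l2_bounded_operator[OF B])
  then show ?case by (metis funpow.simps(2) funpow_Suc_right)
qed

text \<open>The spectra are compared through growth: a bound for the powers of A is also one for the
  powers of its adjoint, and the Neumann series turns it back into a bound for the spectrum.\<close>

lemma op_spectral_radius_adjoint_le:
  assumes A: "l2_bounded M A K" and B: "l2_bounded M B L" and adj: "l2_adjoint M A B"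
  shows "op_spectral_radius M B \<le> op_spectral_radius M A"
proof (rule dense_ge)
  fix s assume s: "op_spectral_radius M A < s"
  then have s0: "0 < s" using op_spectral_radius_nonneg[OF A] by linarith
  obtain C where C: "0 \<le> C" "\<And>n f. f \<in> l2 M \<Longrightarrow> l2_norm M ((A ^^ n) f) \<le> C * s ^ n * l2_norm M f"
    using power_bound_of_spectral_radius[OF A s] by blast
  have "l2_bounded M (B ^^ n) (C * s ^ n)" for n
  proof (rule l2_adjoint_bounded)
    show "l2_bounded M (A ^^ n) (C * s ^ n)"
      using l2_bounded_operator[OF l2_bounded_pow[OF A]] C s0 by (simp add: l2_bounded_def)
    show "l2_operator M (B ^^ n)" by (rule l2_bounded_operator[OF l2_bounded_pow[OF B]])
    show "l2_adjoint M (A ^^ n) (B ^^ n)" by (rule l2_adjoint_funpow[OF A B adj])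
  qed
  then show "op_spectral_radius M B \<le> s"
    by (intro op_spectral_radius_le[OF B C(1)] l2_boundedD) (use s0 in auto)
qed

text \<open>Taking adjoints reverses words, but a power of a single set is closed under reversal of
  words; so corresponding powers of the two sets consist of mutually adjoint operators.\<close>

lemma radius_adjoint:
  assumes r: "r \<in> {generalized_spectral_radius M, joint_spectral_radius M}"
    and \<Sigma>: "\<forall>A\<in>\<Sigma>. l2_bounded M A K" and \<Sigma>': "\<forall>A\<in>\<Sigma>'. l2_bounded M A K"
    and ex: "\<And>A. A \<in> \<Sigma> \<Longrightarrow> \<exists>B\<in>\<Sigma>'. l2_adjoint M A B" and ex': "\<And>B. B \<in> \<Sigma>' \<Longrightarrow> \<exists>A\<in>\<Sigma>. l2_adjoint M B A"
  shows "r \<Sigma> = r \<Sigma>'"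
proof -
  have pw: "\<exists>T'\<in>set_power \<Sigma>2 k. l2_adjoint M T T'"
    if bd: "\<forall>A\<in>\<Sigma>1. l2_bounded M A K" "\<forall>A\<in>\<Sigma>2. l2_bounded M A K"
      and ex: "\<And>A. A \<in> \<Sigma>1 \<Longrightarrow> \<exists>B\<in>\<Sigma>2. l2_adjoint M A B" and T: "T \<in> set_power \<Sigma>1 k"
    for \<Sigma>1 \<Sigma>2 T k
  proof -
    obtain As where As: "length As = k" "set As \<subseteq> \<Sigma>1" "T = foldr (\<circ>) As id"
      using T by (auto simp: in_set_power_iff)
    obtain \<beta> where \<beta>: "\<And>A. A \<in> \<Sigma>1 \<Longrightarrow> \<beta> A \<in> \<Sigma>2 \<and> l2_adjoint M A (\<beta> A)" using ex by metis
    have "list_all2 (\<lambda>A B. l2_bounded M A K \<and> l2_bounded M B K \<and> l2_adjoint M A B) As (map \<beta> As)"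
      using As(2) \<beta> bd by (auto simp: list_all2_map2 list_all2_same)
    then have "l2_adjoint M T (foldr (\<circ>) (rev (map \<beta> As)) id)"
      unfolding As(3) by (rule l2_adjoint_foldr_rev)
    moreover have "foldr (\<circ>) (rev (map \<beta> As)) id \<in> set_power \<Sigma>2 k"
      unfolding in_set_power_iff using As \<beta> by (intro exI[of _ "rev (map \<beta> As)"]) auto
    ultimately show ?thesis by blast
  qed
  note bd = set_power_l2_bounded[OF \<Sigma>] and bd' = set_power_l2_bounded[OF \<Sigma>']
  \<comment> \<open>Both radii depend only on the values of a quantity \<open>\<gamma>\<close> on
    the powers. A one-sided inequality for it suffices, adjointness being symmetric.\<close>
  have img: "\<gamma> ` set_power \<Sigma> k = \<gamma> ` set_power \<Sigma>' k"
    if \<gamma>: "\<And>A B. l2_bounded M A (K ^ k) \<Longrightarrow> l2_bounded M B (K ^ k) \<Longrightarrow> l2_adjoint M A B \<Longrightarrow> (\<gamma> B :: real) \<le> \<gamma> A"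
    for \<gamma> k
  proof -
    have eq: "\<gamma> A = \<gamma> B"
      if "l2_bounded M A (K ^ k)" "l2_bounded M B (K ^ k)" "l2_adjoint M A B" for A B
      using \<gamma>[OF that] \<gamma>[OF that(2,1) l2_adjoint_sym[OF that(3)]] by simp
    show ?thesis
    proof (intro equalityI subsetI)
      fix y assume "y \<in> \<gamma> ` set_power \<Sigma> k"
      then obtain T where T: "T \<in> set_power \<Sigma> k" "y = \<gamma> T" by blast
      then obtain T' where "T' \<in> set_power \<Sigma>' k" "l2_adjoint M T T'" using pw[OF \<Sigma> \<Sigma>' ex] by blast
      then show "y \<in> \<gamma> ` set_power \<Sigma>' k" using eq[OF bspec[OF bd T(1)] bspec[OF bd']] T(2) by blast
    next
      fix y assume "y \<in> \<gamma> ` set_power \<Sigma>' k"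
      then obtain T where T: "T \<in> set_power \<Sigma>' k" "y = \<gamma> T" by blast
      then obtain T' where "T' \<in> set_power \<Sigma> k" "l2_adjoint M T T'" using pw[OF \<Sigma>' \<Sigma> ex'] by blast
      then show "y \<in> \<gamma> ` set_power \<Sigma> k" using eq[OF bspec[OF bd' T(1)] bspec[OF bd]] T(2) by blast
    qed
  qed
  have "set_norm M (set_power \<Sigma> k) = set_norm M (set_power \<Sigma>' k)"
    "sup_spectral_radius M (set_power \<Sigma> k) = sup_spectral_radius M (set_power \<Sigma>' k)" for k
    unfolding set_norm_def
    using img[of k "op_norm M", OF op_norm_adjoint_le]
      img[of k "op_spectral_radius M", OF op_spectral_radius_adjoint_le] by simp_all
  then show ?thesis
    using r by (auto simp: generalized_spectral_radius_def joint_spectral_radius_def)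
qed

subsection \<open>Iterating a sequence of operators\<close>

primrec op_iterate :: "(nat \<Rightarrow> 'a l2op) \<Rightarrow> nat \<Rightarrow> 'a l2op" where
  "op_iterate W 0 = id"
| "op_iterate W (Suc n) = W n \<circ> op_iterate W n"

lemma op_iterate_add: "op_iterate W (p + q) = op_iterate (\<lambda>n. W (p + n)) q \<circ> op_iterate W p"
  by (induction q) (auto simp: comp_assoc)

lemma op_iterate_foldr: "op_iterate W n = foldr (\<circ>) (map W (rev [0..<n])) id"
  by (induction n) auto

lemma op_iterate_periodic:
  assumes "\<And>n. W (n + L) = W n"
  shows "op_iterate W (k * L) = op_iterate W L ^^ k"
proof (induction k)
  case (Suc k)
  have "W (k * L + n) = W n" for n
  proof (induction k)
    case (Suc k)
    have "W (Suc k * L + n) = W (k * L + n + L)" by (simp add: ac_simps)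
    then show ?case using assms Suc by simp
  qed simp
  then have "op_iterate W (k * L + L) = op_iterate W L \<circ> op_iterate W (k * L)"
    by (simp add: op_iterate_add)
  then show ?case using Suc by (simp add: add.commute)
qed simp

lemma op_iterate_bounded:
  "(\<And>n. l2_bounded M (W n) K) \<Longrightarrow> l2_bounded M (op_iterate W n) (K ^ n)"
  by (induction n) (auto simp: l2_bounded_id l2_bounded_comp)

text \<open>\<open>Suc k * L\<close> steps split into p initial ones, k full periods of the shifted
  sequence, and L - p final ones. The two ends together cost K^L, independently of k.\<close>

lemma op_iterate_periodic_bound:
  assumes W: "\<And>n. l2_bounded M (W n) K" and per: "\<And>n. W (n + L) = W n" and p: "p \<le> L"
    and D: "\<And>n f. f \<in> l2 M \<Longrightarrow>
      l2_norm M ((op_iterate (\<lambda>n. W (p + n)) L ^^ n) f) \<le> D * s ^ n * l2_norm M f"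
    and nn: "0 \<le> D" "0 \<le> s" and f: "f \<in> l2 M"
  shows "l2_norm M (op_iterate W (Suc k * L) f) \<le> (K ^ L * D * l2_norm M f) * s ^ k"
proof -
  have K: "0 \<le> K" by (rule l2_bounded_nonneg[OF W])
  define B where "B = op_iterate (\<lambda>n. W (p + n)) L"
  define U where "U = op_iterate (\<lambda>n. W (p + (k * L + n))) (L - p)"
  have B: "l2_bounded M B (K ^ L)" unfolding B_def by (rule op_iterate_bounded[OF W])
  have U: "l2_bounded M U (K ^ (L - p))" unfolding U_def by (rule op_iterate_bounded[OF W])
  define g where "g = op_iterate W p f"
  have g: "g \<in> l2 M" "l2_norm M g \<le> K ^ p * l2_norm M f"
    unfolding g_def using op_iterate_bounded[of M W K p, OF W] f
    by (auto intro: l2_bounded_closed l2_boundedD)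
  have "Suc k * L = p + (k * L + (L - p))" using p by simp
  moreover have "op_iterate (\<lambda>n. W (p + n)) (k * L) = B ^^ k"
    unfolding B_def by (rule op_iterate_periodic) (use per in \<open>simp flip: add.assoc\<close>)
  ultimately have "op_iterate W (Suc k * L) f = U ((B ^^ k) g)"
    by (simp only: op_iterate_add[of W p] op_iterate_add[of _ "k * L"] U_def g_def comp_apply)
  then have "l2_norm M (op_iterate W (Suc k * L) f) \<le> K ^ (L - p) * l2_norm M ((B ^^ k) g)"
    using l2_boundedD[OF U l2_bounded_closed[OF l2_bounded_pow[OF B] g(1)]] by simp
  also have "\<dots> \<le> K ^ (L - p) * (D * s ^ k * (K ^ p * l2_norm M f))"
  proof (rule mult_left_mono)
    have "l2_norm M ((B ^^ k) g) \<le> D * s ^ k * l2_norm M g"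
      unfolding B_def by (rule D[OF g(1)])
    also have "\<dots> \<le> D * s ^ k * (K ^ p * l2_norm M f)"
      using g(2) nn by (intro mult_left_mono) auto
    finally show "l2_norm M ((B ^^ k) g) \<le> D * s ^ k * (K ^ p * l2_norm M f)" .
  qed (use K in simp)
  also have "\<dots> = (K ^ (L - p) * K ^ p) * D * l2_norm M f * s ^ k" by (simp add: mult_ac)
  also have "K ^ (L - p) * K ^ p = K ^ L" using p by (simp flip: power_add)
  finally show ?thesis .
qed

section \<open>Log-convexity of the norms of alternating iterates\<close>

lemma log_convex_power_le:
  fixes b :: "nat \<Rightarrow> real"
  assumes nn: "\<And>n. 0 \<le> b n" and b0: "b 0 \<le> 1" and lc: "\<And>n. (b (Suc n))\<^sup>2 \<le> b n * b (Suc (Suc n))"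
  shows "b 1 ^ n \<le> b n \<or> n = 0"
proof -
  \<comment> \<open>Log-convexity says that the ratios b (n+1) / b n increase, and the first one is
    at least b 1 because b 0 <= 1. Products are used since terms may vanish; n = 0 is excluded from
    the conclusion because b 0 may be below 1.\<close>
  have step: "b 1 * b n \<le> b (Suc n)" for n
  proof (induction n)
    case 0
    show ?case using b0 nn[of 1] by (simp add: mult_left_le)
  next
    case (Suc n)
    show ?case
    proof (cases "b (Suc n) = 0")
      case False
      have "b (Suc n) * (b 1 * b (Suc n)) \<le> b 1 * (b n * b (Suc (Suc n)))"
        using mult_left_mono[OF lc[of n] nn[of 1]] by (simp add: power2_eq_square mult_ac)
      also have "\<dots> = (b 1 * b n) * b (Suc (Suc n))" by simp
      also have "\<dots> \<le> b (Suc n) * b (Suc (Suc n))" by (rule mult_right_mono[OF Suc nn])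
      finally show ?thesis using False nn[of "Suc n"] by (simp add: mult_le_cancel_left)
    qed (simp add: nn)
  qed
  have "b 1 ^ Suc n \<le> b (Suc n)" for n
  proof (induction n)
    case (Suc n)
    have "b 1 ^ Suc (Suc n) \<le> b 1 * b (Suc n)" using mult_left_mono[OF Suc nn[of 1]] by simp
    also have "\<dots> \<le> b (Suc (Suc n))" by (rule step)
    finally show ?case .
  qed simp
  then show ?thesis by (cases n) auto
qed

text \<open>Moving the operator of step n to the other side of the inner product turns it into that
  of step n + 1. Hence ||x (n+1)||^2 = <x n, x (n+2)>, and Cauchy-Schwarz gives
  log-convexity.\<close>

lemma alternating_norm_power_le:
  assumes C: "l2_bounded M C K" and C': "l2_bounded M C' K" and adj: "l2_adjoint M C C'"
    and f: "f \<in> l2 M" "l2_norm M f \<le> 1" and n: "n \<ge> 1"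
  shows "l2_norm M (C f) ^ n \<le> l2_norm M (op_iterate (\<lambda>n. if odd n then C' else C) n f)"
proof -
  let ?W = "\<lambda>n. if odd n then C' else C"
  have W: "l2_bounded M (?W n) K" for n using C C' by simp
  define x where "x n = op_iterate ?W n f" for n
  have x: "x n \<in> l2 M" for n
    unfolding x_def by (rule l2_bounded_closed[OF op_iterate_bounded[OF W] f(1)])
  have xS: "x (Suc n) = ?W n (x n)" for n by (simp add: x_def)
  have adjW: "l2_adjoint M (?W n) (?W (Suc n))" for n
    using adj l2_adjoint_sym[OF adj] by simp
  have "(l2_norm M (x (Suc n)))\<^sup>2 \<le> l2_norm M (x n) * l2_norm M (x (Suc (Suc n)))" for n
  proof -
    have "complex_of_real ((l2_norm M (x (Suc n)))\<^sup>2) = l2_inner M (x n) (x (Suc (Suc n)))"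
      using l2_adjointD[OF adjW x x, of n n "Suc n"] by (simp only: xS[symmetric] l2_inner_self)
    then have "(l2_norm M (x (Suc n)))\<^sup>2 = cmod (l2_inner M (x n) (x (Suc (Suc n))))"
      by (metis abs_of_nonneg norm_of_real zero_le_power2)
    then show ?thesis using l2_inner_le[OF x x] by simp
  qed
  from log_convex_power_le[of "\<lambda>n. l2_norm M (x n)" n, OF _ _ this] f(2) n
  show ?thesis by (simp add: x_def)
qed

lemma le_of_power_growth:
  fixes x S D :: real
  assumes "0 \<le> x" "0 < S" and le: "\<And>k. x ^ Suc k \<le> D * S ^ k"
  shows "x \<le> S"
proof (rule ccontr)
  assume "\<not> x \<le> S"
  then have x: "S < x" "0 < x" using assms by auto
  then have "1 < x / S" using assms by simp
  then obtain k where k: "D / x < (x / S) ^ k" using real_arch_pow by blast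
  have "x * (x / S) ^ k \<le> D" using le[of k] assms by (simp add: power_divide field_simps)
  then show False using k x by (simp add: field_simps)
qed

section \<open>Domination of alternating iterates by the mean of the columns\<close>

lemma geometric_mean_const:
  assumes "finite I" "I \<noteq> {}" "0 \<le> c"
  shows "(\<Prod>i\<in>I. c powr (1 / card I)) = (c :: real)"
proof -
  have "card I \<noteq> 0" using assms by simp
  then show ?thesis using assms(3) by (cases "c = 0") (simp_all add: powr_power)
qed

text \<open>
  Applying \<open>C\<close> and \<open>C'\<close> alternately, the \<open>n\<close>-th factor is at each step the geometric mean of the same
  operators in a permuted order.  Hence the result is dominated by the geometric mean of the columns,
  and each column runs periodically through the word of its \<open>\<Sigma> j\<close>.
\<close>

lemma alternating_geometric_mean:
  assumes I: "finite I" "I \<noteq> {}"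
    and V: "\<And>i b. i \<in> I \<Longrightarrow> nonneg_kernel M (V i b) (v i b)"
    and C: "\<And>b. nonneg_kernel M (C b) (\<lambda>x. \<Prod>i\<in>I. v i b x powr (1 / card I))"
    and \<sigma>: "\<And>p. bij_betw (\<lambda>j. \<sigma> j p) I I" and f: "l2_nonneg M f"
  shows "l2_nonneg M (op_iterate (\<lambda>p. C (odd p)) p f)"
    and "\<And>j. j \<in> I \<Longrightarrow> l2_nonneg M (op_iterate (\<lambda>p. V (\<sigma> j p) (odd p)) p f)"
    and "AE x in M. cmod (op_iterate (\<lambda>p. C (odd p)) p f x)
      \<le> (\<Prod>j\<in>I. cmod (op_iterate (\<lambda>p. V (\<sigma> j p) (odd p)) p f x) powr (1 / card I))"
proof -
  have \<sigma>I: "\<sigma> j p \<in> I" if "j \<in> I" for j p using \<sigma>[of p] that by (auto simp: bij_betw_def)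
  show F: "l2_nonneg M (op_iterate (\<lambda>p. C (odd p)) p f)" for p
    by (induction p) (auto simp: f nonneg_kernel_l2_nonneg[OF C])
  show G: "l2_nonneg M (op_iterate (\<lambda>p. V (\<sigma> j p) (odd p)) p f)" if "j \<in> I" for j p
    by (induction p) (auto simp: f nonneg_kernel_l2_nonneg[OF V[OF \<sigma>I[OF that]]])
  show "AE x in M. cmod (op_iterate (\<lambda>p. C (odd p)) p f x)
      \<le> (\<Prod>j\<in>I. cmod (op_iterate (\<lambda>p. V (\<sigma> j p) (odd p)) p f x) powr (1 / card I))"
  proof (induction p)
    case 0
    have "cmod (f x) = (\<Prod>j\<in>I. cmod (f x) powr (1 / card I))" for x
      using geometric_mean_const[OF I, of "cmod (f x)"] by simp
    then show ?case by simp
  next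
    case (Suc p)
    \<comment> \<open>The kernel of C is a product over all of I, hence invariant under permuting
      the factors. After the permutation, Hoelder pairs the operator with index
      \<open>\<sigma> j p\<close> with column j.\<close>
    have "(\<Prod>i\<in>I. v i b x powr (1 / card I)) = (\<Prod>j\<in>I. v (\<sigma> j p) b x powr (1 / card I))" for b x
      by (rule prod.reindex_bij_betw[OF \<sigma>, symmetric])
    then have C': "nonneg_kernel M (C (odd p)) (\<lambda>x. \<Prod>j\<in>I. v (\<sigma> j p) (odd p) x powr (1 / card I))"
      using C[of "odd p"] by simp
    show ?case
      using nonneg_kernel_geometric_mean[OF I V[OF \<sigma>I] C' G l2_nonneg_l2[OF F] Suc] by simp
  qed
qed

text \<open>One Hoelder step in which every input function is |f|; the mean of equal quantities is
  that quantity.\<close>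

lemma geometric_mean_bounded:
  assumes I: "finite I" "I \<noteq> {}"
    and A: "\<And>i. i \<in> I \<Longrightarrow> nonneg_kernel M (A i) (a i)" and K: "\<And>i. i \<in> I \<Longrightarrow> l2_bounded M (A i) K"
    and C: "nonneg_kernel M C (\<lambda>p. \<Prod>i\<in>I. a i p powr (1 / card I))"
  shows "l2_bounded M C K"
  unfolding l2_bounded_def
proof (intro conjI ballI)
  show "l2_operator M C" by (rule nonneg_kernel_operator[OF C])
  obtain i where "i \<in> I" using I by blast
  then show K0: "0 \<le> K" using K l2_bounded_nonneg by blast
  fix f assume f: "f \<in> l2 M"
  note mean = geometric_mean_const[OF I]
  define g where "g = (\<lambda>x. complex_of_real (cmod (f x)))"
  have g: "l2_nonneg M g" "l2_norm M g = l2_norm M f"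
    unfolding g_def using l2_nonneg_cmod[OF f] l2_cmod(2)[OF f] by simp_all
  have "AE x in M. cmod (C f x) \<le> (\<Prod>i\<in>I. cmod (A i g x) powr (1 / card I))"
    by (rule nonneg_kernel_geometric_mean[OF I A C g(1) f]) (simp_all only: mean norm_ge_zero, simp add: g_def)
  then have "l2_norm M (C f) \<le> (\<Prod>i\<in>I. l2_norm M (A i g) powr (1 / card I))"
    by (intro l2_norm_geometric_mean_le[OF I] l2_operator_closed[OF nonneg_kernel_operator[OF A]]
        l2_operator_closed[OF nonneg_kernel_operator[OF C]] f l2_nonneg_l2[OF g(1)])
  also have "\<dots> \<le> (\<Prod>i\<in>I. (K * l2_norm M f) powr (1 / card I))"
    using l2_boundedD[OF K l2_nonneg_l2[OF g(1)]] g(2) by (intro prod_mono) (auto intro: powr_mono2)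
  also have "\<dots> = K * l2_norm M f" using K0 by (intro mean) simp
  finally show "l2_norm M (C f) \<le> K * l2_norm M f" .
qed

text \<open>\<open>p0 j\<close> is the step at which column j begins a new copy of its word. After
  \<open>Suc k * L\<close> steps the lower bound from log-convexity has exponent
  \<open>Suc k * L\<close>, while column j has grown by s_j^k up to a constant; comparing growth as
  k tends to infinity leaves the L-th power of one norm.\<close>

lemma geometric_mean_norm_power_le:
  assumes I: "finite I" "I \<noteq> {}"
    and V: "\<And>i b. i \<in> I \<Longrightarrow> nonneg_kernel M (V i b) (v i b)"
    and VK: "\<And>i b. i \<in> I \<Longrightarrow> l2_bounded M (V i b) K"
    and C: "\<And>b. nonneg_kernel M (C b) (\<lambda>x. \<Prod>i\<in>I. v i b x powr (1 / card I))"
    and CK: "\<And>b. l2_bounded M (C b) K" and adj: "l2_adjoint M (C False) (C True)"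
    and \<sigma>: "\<And>p. bij_betw (\<lambda>j. \<sigma> j p) I I"
    and L: "even L" "L > 0" and \<sigma>L: "\<And>j p. \<sigma> j (p + L) = \<sigma> j p"
    and p0: "\<And>j. j \<in> I \<Longrightarrow> p0 j \<le> L"
    and r: "r \<in> {generalized_spectral_radius M, joint_spectral_radius M}"
    and \<Sigma>: "\<And>j. j \<in> I \<Longrightarrow> \<forall>A\<in>\<Sigma> j. l2_bounded M A K'"
    and B: "\<And>j. j \<in> I \<Longrightarrow> op_iterate (\<lambda>n. V (\<sigma> j (p0 j + n)) (odd (p0 j + n))) L \<in> \<Sigma> j"
    and f: "l2_nonneg M f" "l2_norm M f \<le> 1"
  shows "l2_norm M (C False f) ^ L \<le> (\<Prod>j\<in>I. r (\<Sigma> j) powr (1 / card I))"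
proof -
  define G where "G j = op_iterate (\<lambda>p. V (\<sigma> j p) (odd p))" for j
  note f2 = l2_nonneg_l2[OF f(1)]
  have r0: "0 \<le> r (\<Sigma> j)" if "j \<in> I" for j by (rule radius_nonneg[OF r \<Sigma>[OF that]])
  have \<sigma>I: "\<sigma> j p \<in> I" if "j \<in> I" for j p using \<sigma>[of p] that by (auto simp: bij_betw_def)
  \<comment> \<open>The growth of powers is controlled only above the radius, and the radius may be
    0; hence the margin e, which also makes the bases positive.\<close>
  have bound: "l2_norm M (C False f) ^ L \<le> (\<Prod>j\<in>I. (r (\<Sigma> j) + e) powr (1 / card I))" if e: "e > 0" for e
  proof -
    define s where "s j = r (\<Sigma> j) + e" for j
    have s: "0 < s j" if "j \<in> I" for j using r0[OF that] e by (simp add: s_def)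
    define T where "T j = op_iterate (\<lambda>n. V (\<sigma> j (p0 j + n)) (odd (p0 j + n))) L" for j
    have "\<forall>j\<in>I. \<exists>D. 0 \<le> D \<and> (\<forall>n. \<forall>f\<in>l2 M. l2_norm M ((T j ^^ n) f) \<le> D * s j ^ n * l2_norm M f)"
    proof
      fix j assume j: "j \<in> I"
      show "\<exists>D. 0 \<le> D \<and> (\<forall>n. \<forall>f\<in>l2 M. l2_norm M ((T j ^^ n) f) \<le> D * s j ^ n * l2_norm M f)"
        using e B[OF j] unfolding T_def by (intro radius_power_bound[OF r \<Sigma>[OF j]]) (simp_all add: s_def)
    qed
    from bchoice[OF this] obtain D where D: "\<And>j. j \<in> I \<Longrightarrow> 0 \<le> D j"
      "\<And>j n f. j \<in> I \<Longrightarrow> f \<in> l2 M \<Longrightarrow> l2_norm M ((T j ^^ n) f) \<le> D j * s j ^ n * l2_norm M f"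
      by blast
    define E where "E j = K ^ L * D j * l2_norm M f" for j
    have Gk: "l2_norm M (G j (Suc k * L) f) \<le> E j * s j ^ k" if j: "j \<in> I" for j k
      unfolding G_def E_def
      by (rule op_iterate_periodic_bound[of M _ K L "p0 j"])
        (use VK[OF \<sigma>I[OF j]] L(1) p0[OF j] D[OF j, unfolded T_def] \<sigma>L s[OF j] f2 in \<open>auto simp: less_imp_le\<close>)
    show ?thesis
    proof (rule le_of_power_growth)
    fix k
    let ?n = "Suc k * L"
    have "(l2_norm M (C False f) ^ L) ^ Suc k = l2_norm M (C False f) ^ ?n"
      by (simp only: power_mult[symmetric] mult.commute)
    also have "\<dots> \<le> l2_norm M (op_iterate (\<lambda>n. if odd n then C True else C False) ?n f)"
      using L(2) by (intro alternating_norm_power_le[OF CK CK adj f2 f(2)]) simp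
    also have "(\<lambda>n. if odd n then C True else C False) = (\<lambda>n. C (odd n))" by auto
    also have "l2_norm M (op_iterate (\<lambda>n. C (odd n)) ?n f) \<le> (\<Prod>j\<in>I. l2_norm M (G j ?n f) powr (1 / card I))"
      unfolding G_def
      by (intro l2_norm_geometric_mean_le[OF I] l2_nonneg_l2 alternating_geometric_mean[OF I V C \<sigma> f(1)])
    also have "\<dots> \<le> (\<Prod>j\<in>I. (E j * s j ^ k) powr (1 / card I))"
      using Gk by (intro prod_mono) (auto intro: powr_mono2)
    also have "\<dots> = (\<Prod>j\<in>I. E j powr (1 / card I) * (s j powr (1 / card I)) ^ k)"
    proof (rule prod.cong[OF refl])
      fix j assume j: "j \<in> I"
      have "(s j ^ k) powr (1 / card I) = (s j powr (1 / card I)) ^ k"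
        using s[OF j] by (simp add: powr_power powr_powr mult.commute flip: powr_realpow)
      moreover have "0 \<le> E j" using D(1)[OF j] l2_bounded_nonneg[OF CK] by (simp add: E_def)
      ultimately show "(E j * s j ^ k) powr (1 / card I) = E j powr (1 / card I) * (s j powr (1 / card I)) ^ k"
        using s[OF j] by (simp add: powr_mult)
    qed
    also have "\<dots> = (\<Prod>j\<in>I. E j powr (1 / card I)) * (\<Prod>j\<in>I. s j powr (1 / card I)) ^ k"
      by (simp add: prod.distrib prod_power_distrib)
    finally show "(l2_norm M (C False f) ^ L) ^ Suc k
        \<le> (\<Prod>j\<in>I. E j powr (1 / card I)) * (\<Prod>j\<in>I. (r (\<Sigma> j) + e) powr (1 / card I)) ^ k"
      by (simp add: s_def)
    next
    show "0 < (\<Prod>j\<in>I. (r (\<Sigma> j) + e) powr (1 / card I))"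
      using r0 e by (intro prod_pos) (auto simp: add_nonneg_pos less_imp_neq[symmetric])
    qed simp
  qed
  \<comment> \<open>As the radii may vanish, continuity of \<open>powr\<close> at base 0 is needed;
    it holds along nonnegative bases since the exponent is positive.\<close>
  have "((\<lambda>e. \<Prod>j\<in>I. (r (\<Sigma> j) + e) powr (1 / card I)) \<longlongrightarrow> (\<Prod>j\<in>I. (r (\<Sigma> j) + 0) powr (1 / card I))) (at_right 0)"
  proof (intro tendsto_prod tendsto_powr2 tendsto_intros)
    show "\<forall>\<^sub>F e in at_right 0. 0 \<le> r (\<Sigma> j) + e" if "j \<in> I" for j
      using eventually_at_right_less[of 0] by eventually_elim (use r0[OF that] in auto)
    show "0 < 1 / real (card I)" using I by (simp add: card_gt_0_iff)
  qed
  then show ?thesis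
    using eventually_at_right_less[of "0::real"]
    by (intro tendsto_lowerbound[of _ _ "at_right 0"]) (auto elim!: eventually_mono bound)
qed

subsection \<open>Riesz representation and adjoints\<close>

lemma l2_norm_add_square:
  assumes f: "f \<in> l2 M" and g: "g \<in> l2 M"
  shows "(l2_norm M (\<lambda>x. f x + g x))\<^sup>2 = (l2_norm M f)\<^sup>2 + (l2_norm M g)\<^sup>2 + 2 * Re (l2_inner M g f)"
proof -
  note fg = l2_add[OF f g]
  have "l2_inner M (\<lambda>x. f x + g x) h = l2_inner M f h + l2_inner M g h" if "h \<in> l2 M" for h
    by (rule l2_inner_add_left[OF f g that])
  note add = this[OF fg] this[OF f] this[OF g]
  have "complex_of_real ((l2_norm M (\<lambda>x. f x + g x))\<^sup>2)
      = cnj (l2_inner M (\<lambda>x. f x + g x) f) + cnj (l2_inner M (\<lambda>x. f x + g x) g)"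
    unfolding l2_inner_cnj by (simp only: add(1) flip: l2_inner_self)
  also have "\<dots> = complex_of_real ((l2_norm M f)\<^sup>2) + cnj (l2_inner M g f) + l2_inner M g f
      + complex_of_real ((l2_norm M g)\<^sup>2)"
    unfolding add(2,3) by (simp only: complex_cnj_add complex_cnj_complex_of_real l2_inner_cnj l2_inner_self add.assoc)
  finally have "Re (complex_of_real ((l2_norm M (\<lambda>x. f x + g x))\<^sup>2)) = Re (complex_of_real ((l2_norm M f)\<^sup>2)
      + cnj (l2_inner M g f) + l2_inner M g f + complex_of_real ((l2_norm M g)\<^sup>2))" by (rule arg_cong)
  then show ?thesis by (simp del: of_real_power)
qed

lemma l2_parallelogram:
  assumes f: "f \<in> l2 M" and g: "g \<in> l2 M"
  shows "(l2_norm M (\<lambda>x. f x - g x))\<^sup>2 = 2 * (l2_norm M f)\<^sup>2 + 2 * (l2_norm M g)\<^sup>2 - (l2_norm M (\<lambda>x. f x + g x))\<^sup>2"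
  using l2_norm_add_square[OF f g] l2_norm_add_square[OF f l2_scale[OF g, of "-1"]]
    l2_inner_scale_left[of M "-1" g f] l2_norm_scale[of M "-1" g] by simp

text \<open>The representing function minimizes \<open>\<parallel>f\<parallel>\<^sup>2 - 2 Re (\<phi> f)\<close>.\<close>

lemma l2_Riesz:
  assumes add: "\<And>f g. f \<in> l2 M \<Longrightarrow> g \<in> l2 M \<Longrightarrow> \<phi> (\<lambda>x. f x + g x) = \<phi> f + \<phi> g"
    and scale: "\<And>c f. f \<in> l2 M \<Longrightarrow> \<phi> (\<lambda>x. c * f x) = c * \<phi> f"
    and bound: "\<And>f. f \<in> l2 M \<Longrightarrow> cmod (\<phi> f) \<le> L * l2_norm M f" and L: "0 \<le> L"
  shows "\<exists>h\<in>l2 M. \<forall>f\<in>l2 M. \<phi> f = l2_inner M f h"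
proof -
  define J where "J f = (l2_norm M f)\<^sup>2 - 2 * Re (\<phi> f)" for f
  define j where "j = (INF f\<in>l2 M. J f)"
  have J_low: "- (L\<^sup>2) \<le> J f" if f: "f \<in> l2 M" for f
  proof -
    have "Re (\<phi> f) \<le> L * l2_norm M f" using complex_Re_le_cmod[of "\<phi> f"] bound[OF f] by linarith
    moreover have "0 \<le> (l2_norm M f - L)\<^sup>2" by simp
    ultimately show ?thesis by (simp add: J_def power2_diff mult_ac)
  qed
  then have bdd: "bdd_below (J ` l2 M)" by (rule bdd_belowI2)
  have j: "j \<le> J f" if "f \<in> l2 M" for f
    unfolding j_def using bdd that by (rule cINF_lower)
  have near: "\<exists>f. f \<in> l2 M \<and> J f < j + e" if "e > 0" for e
  proof -
    have "(INF f\<in>l2 M. J f) < j + e" using that by (simp add: j_def)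
    moreover have "l2 M \<noteq> {}" using l2_zero(1) by blast
    ultimately show ?thesis using bdd by (subst (asm) cINF_less_iff) auto
  qed
  \<comment> \<open>Parallelogram law together with j <= J at the midpoint of f and g:
    near-minimizers lie close to each other.\<close>
  have close: "(l2_norm M (\<lambda>x. f x - g x))\<^sup>2 \<le> 2 * (J f - j) + 2 * (J g - j)"
    if f: "f \<in> l2 M" and g: "g \<in> l2 M" for f g
  proof -
    have "j \<le> J (\<lambda>x. 1 / 2 * (f x + g x))" by (intro j l2_scale l2_add f g)
    also have "\<dots> = (l2_norm M (\<lambda>x. f x + g x))\<^sup>2 / 4 - Re (\<phi> f) - Re (\<phi> g)"
      unfolding J_def l2_norm_scale scale[OF l2_add[OF f g]] add[OF f g]
      by (simp add: power_divide field_simps)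
    finally show ?thesis using l2_parallelogram[OF f g] by (simp add: J_def)
  qed
  \<comment> \<open>Errors (1/4)^n for J become distances of order (1/2)^n, which are summable as
    \<open>l2_series\<close> requires.\<close>
  have "\<forall>n. \<exists>f. f \<in> l2 M \<and> J f < j + (1 / 4) ^ n" using near by simp
  then obtain F where F: "\<And>n. F n \<in> l2 M" "\<And>n. J (F n) < j + (1 / 4) ^ n" by metis
  define d where "d n x = F (Suc n) x - F n x" for n x
  have d: "d n \<in> l2 M" for n unfolding d_def by (intro l2_diff F)
  have dn: "l2_norm M (d n) \<le> 2 * (1 / 2) ^ n" for n
  proof (rule power2_le_imp_le)
    have "(l2_norm M (d n))\<^sup>2 \<le> 2 * (J (F (Suc n)) - j) + 2 * (J (F n) - j)"
      unfolding d_def by (rule close[OF F(1) F(1)])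
    also have "\<dots> \<le> 2 * (1 / 4) ^ Suc n + 2 * (1 / 4) ^ n"
      using F(2)[of n] F(2)[of "Suc n"] by simp
    also have "\<dots> \<le> 4 * (1 / 4) ^ n" by simp
    also have "\<dots> = (2 * (1 / 2) ^ n)\<^sup>2"
      by (simp add: power_mult_distrib power2_eq_square flip: power_mult_distrib)
    finally show "(l2_norm M (d n))\<^sup>2 \<le> (2 * (1 / 2) ^ n)\<^sup>2" .
  qed simp
  have geo: "(\<lambda>n. (c * (1 / 2) ^ n) :: real) sums (c * 2)" for c
    using sums_mult[OF geometric_sums[of "1 / 2 :: real"], of c] by simp
  define h where "h x = F 0 x + (\<Sum>n. d n x)" for x
  have h: "h \<in> l2 M" unfolding h_def
    by (intro l2_add F l2_series(2)[OF d dn sums_summable[OF geo]])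
  define e where "e N x = h x - F N x" for N x
  have e: "e N \<in> l2 M" for N unfolding e_def by (intro l2_diff h F)
  have eN: "l2_norm M (e N) \<le> 4 * (1 / 2) ^ N" for N
  proof -
    have b: "l2_norm M (d (n + N)) \<le> (2 * (1 / 2) ^ N) * (1 / 2) ^ n" for n
      using dn[of "n + N"] by (simp add: power_add mult_ac)
    note tail = l2_series(2,3)[OF d b sums_summable[OF geo], unfolded sums_unique[OF geo, symmetric]]
    have "AE x in M. e N x = (\<Sum>n. d (n + N) x)"
      using l2_series(1)[OF d dn sums_summable[OF geo]]
    proof eventually_elim
      case (elim x)
      have "(\<Sum>n<N. d n x) = F N x - F 0 x" unfolding d_def by (rule sum_lessThan_telescope)
      then show ?case
        using suminf_split_initial_segment[OF summable_norm_cancel[OF elim], of N] by (simp add: e_def h_def)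
    qed
    then have "l2_norm M (e N) = l2_norm M (\<lambda>x. \<Sum>n. d (n + N) x)"
      by (rule l2_norm_cong_AE[OF e tail(1)])
    then show ?thesis using tail(2) by (simp add: mult_ac)
  qed
  have J_add: "J (\<lambda>x. f x + g x) = J f + (l2_norm M g)\<^sup>2 + 2 * Re (l2_inner M g f - \<phi> g)"
    if "f \<in> l2 M" "g \<in> l2 M" for f g
    unfolding J_def l2_norm_add_square[OF that] add[OF that] by simp
  \<comment> \<open>With q = (1/2)^N <= 1 the terms are q^2 from the near-minimality of F N, (4q)^2
    from ||e N||^2, and 2 (4q (||h|| + 4q) + 4 L q) from the mixed terms; 49 = 1 + 16 + 32.\<close>
  define C where "C = 49 + 8 * l2_norm M h + 8 * L"
  have Jh_le: "J h - j \<le> C * (1 / 2) ^ N" for N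
  proof -
    define q :: real where "q = (1 / 2) ^ N"
    have q: "0 \<le> q" "q \<le> 1" "(1 / 4) ^ N = q\<^sup>2"
      by (simp_all add: q_def power_le_one power2_eq_square flip: power_mult_distrib)
    have q2: "q\<^sup>2 \<le> q" using q by (simp add: power2_eq_square mult_left_le)
    have eq: "l2_norm M (e N) \<le> 4 * q" using eN[of N] by (simp add: q_def)
    have FN: "l2_norm M (F N) \<le> l2_norm M h + 4 * q"
    proof -
      have "F N = (\<lambda>x. h x - e N x)" by (simp add: e_def)
      then show ?thesis using l2_norm_triangle_diff[OF h e[of N]] eq by simp
    qed
    have "h = (\<lambda>x. F N x + e N x)" by (simp add: e_def)
    then have "J h = J (F N) + (l2_norm M (e N))\<^sup>2 + 2 * Re (l2_inner M (e N) (F N) - \<phi> (e N))"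
      using J_add[OF F(1) e] by metis
    also have "Re (l2_inner M (e N) (F N) - \<phi> (e N)) \<le> 4 * q * (l2_norm M h + 4 * q) + L * (4 * q)"
    proof -
      have "Re (l2_inner M (e N) (F N) - \<phi> (e N)) \<le> cmod (l2_inner M (e N) (F N) - \<phi> (e N))"
        by (rule complex_Re_le_cmod)
      also have "\<dots> \<le> cmod (l2_inner M (e N) (F N)) + cmod (\<phi> (e N))" by (rule norm_triangle_ineq4)
      also have "\<dots> \<le> l2_norm M (e N) * l2_norm M (F N) + L * l2_norm M (e N)"
        by (intro add_mono l2_inner_le bound e F)
      also have "\<dots> \<le> (4 * q) * (l2_norm M h + 4 * q) + L * (4 * q)"
        using eq FN q L by (intro add_mono mult_mono) auto
      finally show ?thesis .
    qed
    also have "(l2_norm M (e N))\<^sup>2 \<le> (4 * q)\<^sup>2" using eq by (rule power_mono) simp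
    also have "J (F N) \<le> j + q\<^sup>2" using F(2)[of N] q(3) by simp
    finally have "J h - j \<le> 49 * q\<^sup>2 + 8 * q * l2_norm M h + 8 * L * q"
      by (simp add: algebra_simps power2_eq_square)
    also have "\<dots> \<le> 49 * q + 8 * q * l2_norm M h + 8 * L * q" using q2 by simp
    finally show ?thesis by (simp add: C_def q_def algebra_simps)
  qed
  have "(\<lambda>N. C * (1 / 2) ^ N) \<longlonglongrightarrow> C * 0"
    by (intro tendsto_mult_left LIMSEQ_power_zero) simp
  then have "J h - j \<le> C * 0" by (rule LIMSEQ_le_const) (use Jh_le in auto)
  then have Jh: "J h \<le> j" by simp
  have "\<phi> u = l2_inner M u h" if u: "u \<in> l2 M" for u
  proof (rule ccontr)
    define z where "z = \<phi> u - l2_inner M u h"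
    define n where "n = (l2_norm M u)\<^sup>2"
    assume "\<phi> u \<noteq> l2_inner M u h"
    then have z: "0 < (cmod z)\<^sup>2" by (simp add: z_def)
    have n: "0 \<le> n" by (simp add: n_def)
    \<comment> \<open>Replacing h by h + c u changes J by t |z|^2 (t n - 2), which is negative
      because t n < 1 and so contradicts minimality. The summand 1 covers n = 0.\<close>
    define t where "t = 1 / (n + 1)"
    define c where "c = complex_of_real t * cnj z"
    have t: "0 < t" "t * n < 1" using n by (simp_all add: t_def field_simps)
    have cz: "Re (c * z) = t * (cmod z)\<^sup>2"
      unfolding c_def by (simp add: cmod_power2) (simp add: algebra_simps power2_eq_square)
    have "j \<le> J (\<lambda>x. h x + c * u x)" by (intro j l2_add l2_scale h u)
    also have "\<dots> = J h + (cmod c)\<^sup>2 * n - 2 * Re (c * z)"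
      using J_add[OF h l2_scale[OF u, of c]] unfolding scale[OF u] l2_inner_scale_left l2_norm_scale
      by (simp add: z_def n_def power_mult_distrib algebra_simps)
    finally have "2 * (t * (cmod z)\<^sup>2) \<le> (cmod c)\<^sup>2 * n" using Jh cz by linarith
    also have "(cmod c)\<^sup>2 * n = t * (cmod z)\<^sup>2 * (t * n)"
      by (simp add: c_def norm_mult power2_eq_square)
    also have "\<dots> \<le> t * (cmod z)\<^sup>2 * 1" using t z by (intro mult_left_mono) auto
    finally show False using t z by simp
  qed
  then show ?thesis using h by blast
qed

lemma l2_eq_AE_of_inner:
  assumes f: "f \<in> l2 M" and g: "g \<in> l2 M" and eq: "\<And>u. u \<in> l2 M \<Longrightarrow> l2_inner M u f = l2_inner M u g"
  shows "AE x in M. f x = g x"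
proof -
  have d: "(\<lambda>x. f x - g x) \<in> l2 M" by (rule l2_diff[OF f g])
  have "l2_inner M (\<lambda>x. f x - g x) u = 0" if "u \<in> l2 M" for u
    using l2_inner_diff_left[OF f g that] eq[OF that] l2_inner_cnj by (metis diff_self)
  then have "l2_norm M (\<lambda>x. f x - g x) = 0"
    using d l2_inner_self[of M "\<lambda>x. f x - g x"] by simp
  then show ?thesis using l2_norm_eq_0[OF d] by simp
qed

text \<open>
  For operators with nonnegative kernel the adjoint is an integral operator, but a positive kernel
  operator is only known to have some complex kernel.
\<close>

lemma l2_adjoint_exists:
  assumes A: "l2_bounded M A K"
  shows "\<exists>B. l2_bounded M B K \<and> l2_adjoint M A B"
proof -
  note Aop = l2_bounded_operator[OF A] and Acl = l2_bounded_closed[OF A]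
  have "\<exists>h\<in>l2 M. \<forall>f\<in>l2 M. l2_inner M (A f) g = l2_inner M f h" if g: "g \<in> l2 M" for g
  proof (rule l2_Riesz[where L = "K * l2_norm M g"])
    show "0 \<le> K * l2_norm M g" using l2_bounded_nonneg[OF A] by simp
    fix f assume f: "f \<in> l2 M"
    have "cmod (l2_inner M (A f) g) \<le> l2_norm M (A f) * l2_norm M g" by (rule l2_inner_le[OF Acl[OF f] g])
    also have "\<dots> \<le> (K * l2_norm M f) * l2_norm M g"
      by (rule mult_right_mono[OF l2_boundedD[OF A f]]) simp
    finally show "cmod (l2_inner M (A f) g) \<le> K * l2_norm M g * l2_norm M f" by (simp add: mult_ac)
    show "l2_inner M (A (\<lambda>x. c * f x)) g = c * l2_inner M (A f) g" for c
      using l2_inner_cong_AE[OF Acl[OF l2_scale[OF f]] l2_scale[OF Acl[OF f]] g l2_operator_scale[OF Aop f]]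
      by (simp only: l2_inner_scale_left)
  next
    fix f f' assume f: "f \<in> l2 M" and f': "f' \<in> l2 M"
    show "l2_inner M (A (\<lambda>x. f x + f' x)) g = l2_inner M (A f) g + l2_inner M (A f') g"
      using l2_inner_cong_AE[OF Acl[OF l2_add[OF f f']] l2_add[OF Acl[OF f] Acl[OF f']] g l2_operator_add[OF Aop f f']]
      by (simp only: l2_inner_add_left[OF Acl[OF f] Acl[OF f'] g])
  qed
  then have "\<forall>g\<in>l2 M. \<exists>h. h \<in> l2 M \<and> (\<forall>f\<in>l2 M. l2_inner M (A f) g = l2_inner M f h)" by blast
  from bchoice[OF this] obtain B where
    B: "\<And>g. g \<in> l2 M \<Longrightarrow> B g \<in> l2 M" "\<And>f g. g \<in> l2 M \<Longrightarrow> f \<in> l2 M \<Longrightarrow> l2_inner M (A f) g = l2_inner M f (B g)"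
    by blast
  have adj: "l2_adjoint M A B" using B(2) by (simp add: l2_adjoint_def)
  have Bl: "l2_inner M (B g) f = l2_inner M g (A f)" if "f \<in> l2 M" "g \<in> l2 M" for f g
    using B(2)[OF that(2,1)] by (metis l2_inner_cnj)
  have "l2_operator M B"
    unfolding l2_operator_def
  proof (intro conjI ballI allI impI)
    fix f assume f: "f \<in> l2 M"
    show "B f \<in> l2 M" by (rule B(1)[OF f])
    fix c
    show "AE x in M. B (\<lambda>y. c * f y) x = c * B f x"
    proof (rule l2_eq_AE_of_inner)
      fix u assume u: "u \<in> l2 M"
      have "l2_inner M (B (\<lambda>y. c * f y)) u = l2_inner M (\<lambda>x. c * B f x) u"
        by (simp only: Bl[OF u l2_scale[OF f]] l2_inner_scale_left Bl[OF u f])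
      then show "l2_inner M u (B (\<lambda>y. c * f y)) = l2_inner M u (\<lambda>x. c * B f x)"
        by (metis l2_inner_cnj)
    qed (intro B l2_scale f)+
  next
    fix f g assume f: "f \<in> l2 M" and g: "g \<in> l2 M"
    show "AE x in M. B (\<lambda>y. f y + g y) x = B f x + B g x"
    proof (rule l2_eq_AE_of_inner)
      fix u assume u: "u \<in> l2 M"
      have "l2_inner M (B (\<lambda>y. f y + g y)) u = l2_inner M (\<lambda>x. B f x + B g x) u"
        by (simp only: Bl[OF u l2_add[OF f g]] l2_inner_add_left[OF f g Acl[OF u]]
            l2_inner_add_left[OF B(1)[OF f] B(1)[OF g] u] Bl[OF u f] Bl[OF u g])
      then show "l2_inner M u (B (\<lambda>y. f y + g y)) = l2_inner M u (\<lambda>x. B f x + B g x)"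
        by (metis l2_inner_cnj)
    qed (intro B l2_add f g)+
    show "AE x in M. B f x = B g x" if fg: "AE x in M. f x = g x"
    proof (rule l2_eq_AE_of_inner)
      fix u assume u: "u \<in> l2 M"
      have "l2_inner M (B f) u = l2_inner M (B g) u"
        using l2_inner_cong_AE[OF f g Acl[OF u] fg] by (simp only: Bl[OF u f] Bl[OF u g])
      then show "l2_inner M u (B f) = l2_inner M u (B g)" by (metis l2_inner_cnj)
    qed (intro B f g)+
  qed
  from l2_adjoint_bounded[OF A this adj] adj show ?thesis by blast
qed

subsection \<open>Words of starred operators\<close>

lemma l2_adjoint_factor:
  assumes pos: "\<forall>A\<in>\<Psi>. l2_bounded M A K"
    and A: "A \<in> (if b then set_adjoint M \<Psi> else \<Psi>)"
  shows "l2_bounded M A K" "\<exists>B\<in>(if b then \<Psi> else set_adjoint M \<Psi>). l2_adjoint M A B"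
proof -
  have "l2_bounded M A K \<and> (\<exists>B\<in>(if b then \<Psi> else set_adjoint M \<Psi>). l2_adjoint M A B)"
  proof (cases b)
    case True
    then obtain B where B: "B \<in> \<Psi>" "l2_operator M A" "l2_adjoint M B A"
      using A unfolding set_adjoint_def l2_adjoint_def by auto
    moreover have "l2_bounded M A K"
      using pos B(1) by (intro l2_adjoint_bounded[OF _ B(2,3)]) blast
    ultimately show ?thesis using True l2_adjoint_sym[OF B(3)] by auto
  next
    case False
    then have AP: "A \<in> \<Psi>" using A by simp
    then have a: "l2_bounded M A K" using pos by blast
    obtain B where B: "l2_bounded M B K" "l2_adjoint M A B"
      using l2_adjoint_exists[OF a] by blast
    then have "B \<in> set_adjoint M \<Psi>"
      using AP l2_bounded_operator[OF B(1)] unfolding set_adjoint_def l2_adjoint_def by blast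
    then show ?thesis using False a B(2) by auto
  qed
  then show "l2_bounded M A K" "\<exists>B\<in>(if b then \<Psi> else set_adjoint M \<Psi>). l2_adjoint M A B"
    by blast+
qed

text \<open>Adjoints reverse the word and toggle every star. A starred factor leads back to a member
  of \<open>\<Psi> i\<close> itself, since adjointness is symmetric, so no adjoint of
  \<open>set_adjoint\<close> has to be formed.\<close>

lemma starred_factors_adjoint:
  assumes pos: "\<forall>i\<in>set is. \<forall>A\<in>\<Psi> i. l2_bounded M A K"
    and T: "T \<in> set_prod (starred_factors M S \<Psi> is)"
  shows "\<exists>T'\<in>set_prod (starred_factors M (\<lambda>i. \<not> S i) \<Psi> (rev is)). l2_adjoint M T T'"
    and "l2_bounded M T (K ^ length is)"
proof -
  obtain As where As: "list_all2 (\<in>) As (starred_factors M S \<Psi> is)" "T = foldr (\<circ>) As id"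
    using T by (auto simp: in_set_prod_iff)
  have len: "length As = length is"
    using As(1) by (simp add: list_all2_lengthD starred_factors_def)
  have mem: "As ! t \<in> (if S (is ! t) then set_adjoint M (\<Psi> (is ! t)) else \<Psi> (is ! t))" if "t < length is" for t
    using As(1) that by (auto simp: list_all2_conv_all_nth starred_factors_def)
  have bd: "l2_bounded M (As ! t) K" if "t < length is" for t
    by (rule l2_adjoint_factor(1)[OF bspec[OF pos nth_mem[OF that]] mem[OF that]])
  then show "l2_bounded M T (K ^ length is)"
    unfolding As(2) len[symmetric] by (intro l2_bounded_foldr) (auto simp: in_set_conv_nth len)
  have "\<forall>t\<in>{..<length is}. \<exists>B. B \<in> (if S (is ! t) then \<Psi> (is ! t) else set_adjoint M (\<Psi> (is ! t))) \<and>
      l2_adjoint M (As ! t) B"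
  proof
    fix t assume "t \<in> {..<length is}"
    then have t: "t < length is" by simp
    then show "\<exists>B. B \<in> (if S (is ! t) then \<Psi> (is ! t) else set_adjoint M (\<Psi> (is ! t))) \<and>
      l2_adjoint M (As ! t) B"
      using l2_adjoint_factor(2)[OF bspec[OF pos nth_mem[OF t]] mem[OF t]]
      by (simp only: Bex_def)
  qed
  from bchoice[OF this] obtain \<beta> where
    \<beta>: "\<forall>t\<in>{..<length is}. \<beta> t \<in> (if S (is ! t) then \<Psi> (is ! t) else set_adjoint M (\<Psi> (is ! t))) \<and>
      l2_adjoint M (As ! t) (\<beta> t)" ..
  have \<beta>': "\<beta> t \<in> (if \<not> S (is ! t) then set_adjoint M (\<Psi> (is ! t)) else \<Psi> (is ! t))"
    if "t < length is" for t
    using bspec[OF \<beta>, of t] that by (simp split: if_splits)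
  define Bs where "Bs = map \<beta> [0..<length is]"
  have "list_all2 (\<lambda>A B. l2_bounded M A K \<and> l2_bounded M B K \<and> l2_adjoint M A B) As Bs"
    unfolding list_all2_conv_all_nth
  proof (intro conjI allI impI)
    show "length As = length Bs" by (simp add: Bs_def len)
    fix t assume "t < length As"
    then have t: "t < length is" by (simp add: len)
    show "l2_bounded M (As ! t) K" by (rule bd[OF t])
    show "l2_bounded M (Bs ! t) K" unfolding Bs_def using t
      by (simp add: l2_adjoint_factor(1)[OF bspec[OF pos nth_mem[OF t]] \<beta>'[OF t]])
    show "l2_adjoint M (As ! t) (Bs ! t)" using \<beta> t by (simp add: Bs_def)
  qed
  then have "l2_adjoint M T (foldr (\<circ>) (rev Bs) id)"
    unfolding As(2) by (rule l2_adjoint_foldr_rev)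
  moreover have "list_all2 (\<in>) Bs (starred_factors M (\<lambda>i. \<not> S i) \<Psi> is)"
    using \<beta>' by (simp add: list_all2_conv_all_nth starred_factors_def Bs_def)
  then have "list_all2 (\<in>) (rev Bs) (starred_factors M (\<lambda>i. \<not> S i) \<Psi> (rev is))"
    unfolding starred_factors_def rev_map[symmetric] by (simp add: list_all2_rev)
  then have "foldr (\<circ>) (rev Bs) id \<in> set_prod (starred_factors M (\<lambda>i. \<not> S i) \<Psi> (rev is))"
    unfolding in_set_prod_iff by blast
  ultimately show "\<exists>T'\<in>set_prod (starred_factors M (\<lambda>i. \<not> S i) \<Psi> (rev is)). l2_adjoint M T T'"
    by blast
qed

lemma radius_starred_factors_rev:
  assumes r: "r \<in> {generalized_spectral_radius M, joint_spectral_radius M}"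
    and pos: "\<forall>i\<in>set is. \<forall>A\<in>\<Psi> i. l2_bounded M A K"
  shows "r (set_prod (starred_factors M S \<Psi> is)) = r (set_prod (starred_factors M (\<lambda>i. \<not> S i) \<Psi> (rev is)))"
proof (rule radius_adjoint[OF r])
  have pos': "\<forall>i\<in>set (rev is). \<forall>A\<in>\<Psi> i. l2_bounded M A K"
    using pos by simp
  show "\<forall>A\<in>set_prod (starred_factors M S \<Psi> is). l2_bounded M A (K ^ length is)"
    by (intro ballI starred_factors_adjoint(2)[OF pos])
  show "\<forall>A\<in>set_prod (starred_factors M (\<lambda>i. \<not> S i) \<Psi> (rev is)). l2_bounded M A (K ^ length is)"
    using starred_factors_adjoint(2)[OF pos'] by simp
  show "\<exists>B\<in>set_prod (starred_factors M (\<lambda>i. \<not> S i) \<Psi> (rev is)). l2_adjoint M A B"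
    if "A \<in> set_prod (starred_factors M S \<Psi> is)" for A
    by (rule starred_factors_adjoint(1)[OF pos that])
  show "\<exists>A\<in>set_prod (starred_factors M S \<Psi> is). l2_adjoint M B A"
    if "B \<in> set_prod (starred_factors M (\<lambda>i. \<not> S i) \<Psi> (rev is))" for B
    using starred_factors_adjoint(1)[OF pos' that] by simp
qed

section \<open>Column indices and the words of the columns\<close>

text \<open>
  The index \<open>j - p\<close> modulo \<open>m\<close>, represented in \<open>{1..m}\<close>: the operator which column \<open>j\<close> applies at step \<open>p\<close>.
\<close>

definition column_index :: "nat \<Rightarrow> nat \<Rightarrow> nat \<Rightarrow> nat" where
  "column_index m j p = nat ((int j - 1 - int p) mod int m) + 1"

lemma column_index_bij:
  assumes m: "m \<ge> 1"
  shows "bij_betw (\<lambda>j. column_index m j p) {1..m} {1..m}"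
proof -
  have "inj_on (\<lambda>j. column_index m j p) {1..m}"
  proof (rule inj_onI)
    fix j k assume j: "j \<in> {1..m}" and k: "k \<in> {1..m}" and eq: "column_index m j p = column_index m k p"
    have "(int j - 1 - int p) mod int m = (int k - 1 - int p) mod int m"
      using eq m unfolding column_index_def by (simp add: nat_eq_iff)
    then have "int m dvd int j - int k" by (simp add: mod_eq_dvd_iff)
    moreover have "\<bar>int j - int k\<bar> < int m" using j k by auto
    ultimately have "int j - int k = 0" by (metis dvd_imp_le_int linorder_not_less abs_of_nat)
    then show "j = k" by simp
  qed
  moreover have "column_index m j p \<in> {1..m}" for j
  proof -
    have "nat ((int j - 1 - int p) mod int m) < m"
      using m pos_mod_bound[of "int m" "int j - 1 - int p"] by (simp add: nat_less_iff)
    then show ?thesis by (simp add: column_index_def)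
  qed
  then have "(\<lambda>j. column_index m j p) ` {1..m} \<subseteq> {1..m}" by (rule image_subsetI)
  ultimately show ?thesis by (simp add: bij_betw_def endo_inj_surj)
qed

lemma column_index_eq:
  assumes "int j - 1 - int p = int t - int (k * m)" "t < m"
  shows "column_index m j p = t + 1"
proof -
  have "(int t - int (k * m)) mod int m = int t mod int m"
    using mod_mult_self1[of "int t" "- int k" "int m"] by simp
  then show ?thesis using assms by (simp add: column_index_def)
qed

lemma column_index_periodic:
  "column_index m j (p + k * m) = column_index m j p"
proof -
  have "(int j - 1 - int (p + k * m)) mod int m = ((int j - 1 - int p) - int k * int m) mod int m"
    by (simp add: algebra_simps)
  also have "\<dots> = (int j - 1 - int p) mod int m"
    using mod_mult_self1[of "int j - 1 - int p" "- int k" "int m"] by simp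
  finally show ?thesis by (simp add: column_index_def)
qed

text \<open>The operator applied last is the leftmost factor, whence the index L - 1 - t.\<close>

lemma op_iterate_in_set_prod:
  assumes "length Ss = L" and "\<And>t. t < L \<Longrightarrow> W (L - 1 - t) \<in> Ss ! t"
  shows "op_iterate W L \<in> set_prod Ss"
  unfolding in_set_prod_iff op_iterate_foldr
  by (rule exI[of _ "map W (rev [0..<L])"]) (use assms in \<open>auto simp: list_all2_conv_all_nth rev_nth\<close>)

text \<open>Starting at step j, column j applies the indices m, m - 1, ..., 1, index i occurring at
  step j + m - i. As m is even, this step is odd exactly if i + j is odd, so the parity of j decides
  which indices carry the star.\<close>

lemma even_column_word:
  assumes V: "\<And>i b. i \<in> {1..m} \<Longrightarrow> V i b \<in> (if b then set_adjoint M (\<Psi> i) else \<Psi> i)"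
    and m: "even m" and j: "j \<in> {1..m}"
  shows "op_iterate (\<lambda>n. V (column_index m j (j + n)) (odd (j + n))) m
    \<in> set_prod (starred_factors M (if even j then odd else even) \<Psi> [1..<m+1])"
proof (rule op_iterate_in_set_prod)
  fix t assume t: "t < m"
  have "column_index m j (j + (m - 1 - t)) = t + 1"
    by (rule column_index_eq[of _ _ _ 1]) (use t in auto)
  moreover have "odd (j + (m - 1 - t)) \<longleftrightarrow> (if even j then odd else even) (t + 1)"
    using m t by (auto simp: even_diff_nat)
  ultimately show "V (column_index m j (j + (m - 1 - t))) (odd (j + (m - 1 - t)))
      \<in> starred_factors M (if even j then odd else even) \<Psi> [1..<m+1] ! t"
    using V[of "t + 1" True] V[of "t + 1" False] t by (simp add: starred_factors_def del: upt_Suc)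
qed (simp add: starred_factors_def)

text \<open>The starting step must be congruent to j modulo m, so that index m comes first, and odd,
  so that this rightmost factor carries the star. For even j, adding the odd number m achieves both,
  and all columns then have the same word.\<close>

lemma odd_column_word:
  assumes V: "\<And>i b. i \<in> {1..m} \<Longrightarrow> V i b \<in> (if b then set_adjoint M (\<Psi> i) else \<Psi> i)"
    and m: "odd m" and j: "j \<in> {1..m}" and p: "p = (if even j then j + m else j)"
  shows "op_iterate (\<lambda>n. V (column_index m j (p + n)) (odd (p + n))) (2 * m)
    \<in> set_prod (starred_factors M even \<Psi> [1..<m+1] @ starred_factors M odd \<Psi> [1..<m+1])"
proof (rule op_iterate_in_set_prod)
  have op: "odd p" using m p by auto
  define k :: nat where "k = (if even j then 1 else 0)"
  have pk: "p = j + k * m" using p by (simp add: k_def)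
  fix t assume t: "t < 2 * m"
  show "V (column_index m j (p + (2 * m - 1 - t))) (odd (p + (2 * m - 1 - t)))
      \<in> (starred_factors M even \<Psi> [1..<m+1] @ starred_factors M odd \<Psi> [1..<m+1]) ! t"
  proof (cases "t < m")
    case True
    have "column_index m j (p + (2 * m - 1 - t)) = t + 1"
      by (rule column_index_eq[of _ _ _ "k + 2"]) (use t True pk in \<open>auto simp: algebra_simps\<close>)
    moreover have "odd (p + (2 * m - 1 - t)) \<longleftrightarrow> even (t + 1)"
      using op t by (auto simp: even_diff_nat)
    ultimately show ?thesis
      using V[of "t + 1" True] V[of "t + 1" False] True by (simp add: starred_factors_def nth_append del: upt_Suc)
  next
    case False
    define u where "u = t - m"
    have u: "t = m + u" "u < m" using False t by (auto simp: u_def)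
    have "column_index m j (p + (2 * m - 1 - t)) = u + 1"
      by (rule column_index_eq[of _ _ _ "k + 1"]) (use u pk in \<open>auto simp: algebra_simps\<close>)
    moreover have "odd (p + (2 * m - 1 - t)) \<longleftrightarrow> odd (u + 1)"
      using op u m by (auto simp: even_diff_nat)
    ultimately show ?thesis
      using V[of "u + 1" True] V[of "u + 1" False] u by (simp add: starred_factors_def nth_append del: upt_Suc)
  qed
qed (simp add: starred_factors_def)

section \<open>Assembly of the estimate for both parities of m\<close>

lemma prod_alternating:
  fixes u v :: "'b :: comm_monoid_mult"
  shows "(\<Prod>j=1..2 * n. if even j then u else v) = (u * v) ^ n"
proof (induction n)
  case (Suc n)
  have "{1..2 * Suc n} = insert (2 * n + 2) (insert (2 * n + 1) {1..2 * n})" by auto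
  then show ?case using Suc by (simp add: mult_ac)
qed simp

text \<open>The common core of both parities, which differ only in the period L, the starting steps
  \<open>p0\<close> and the sets \<open>\<Sigma> j\<close>. The assumption \<open>word\<close>
  ranges over all choices V of factors, because the A_j and their adjoints are only obtained inside
  the proof.\<close>

lemma set_geometric_mean_norm_power_le:
  assumes sf: "sigma_finite_measure M" and m: "m \<ge> 1"
    and K: "\<forall>j\<in>{1..m}. \<forall>A\<in>\<Psi> j. l2_bounded M A K"
    and r: "r \<in> {generalized_spectral_radius M, joint_spectral_radius M}"
    and L: "even L" "L > 0" "L = k * m"
    and p0: "\<And>j. j \<in> {1..m} \<Longrightarrow> p0 j \<le> L"
    and \<Sigma>: "\<And>j. j \<in> {1..m} \<Longrightarrow> \<forall>A\<in>\<Sigma> j. l2_bounded M A K'"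
    and word: "\<And>V j. (\<And>i b. i \<in> {1..m} \<Longrightarrow> V i b \<in> (if b then set_adjoint M (\<Psi> i) else \<Psi> i)) \<Longrightarrow>
      j \<in> {1..m} \<Longrightarrow> op_iterate (\<lambda>n. V (column_index m j (p0 j + n)) (odd (p0 j + n))) L \<in> \<Sigma> j"
    and C: "C \<in> set_geometric_mean M m (\<lambda>_. 1 / real m) \<Psi>"
    and f: "f \<in> l2 M" "l2_norm M f \<le> 1"
  shows "l2_norm M (C f) ^ L \<le> (\<Prod>j=1..m. r (\<Sigma> j) powr (1 / real m))"
proof -
  let ?I = "{1..m}"
  have I: "finite ?I" "?I \<noteq> {}" "card ?I = m" using m by auto
  obtain A a where A: "\<And>j. j \<in> ?I \<Longrightarrow> A j \<in> \<Psi> j" and a: "\<And>j. j \<in> ?I \<Longrightarrow> nonneg_kernel M (A j) (a j)"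
    and hC: "has_kernel M C (\<lambda>p. complex_of_real (\<Prod>j=1..m. a j p powr (1 / real m)))"
    using C unfolding set_geometric_mean_def is_geometric_mean_def nonneg_kernel_def by blast
  have kC: "nonneg_kernel M C (\<lambda>p. \<Prod>j\<in>?I. a j p powr (1 / card ?I))"
    using hC by (simp add: nonneg_kernel_def prod_nonneg)
  have AK: "l2_bounded M (A j) K" if "j \<in> ?I" for j using K A that by blast
  have CK: "l2_bounded M C K" by (rule geometric_mean_bounded[OF I(1,2) a AK kC])
  have "\<exists>B. l2_bounded M B K \<and> nonneg_kernel M B (\<lambda>(x, y). a j (y, x)) \<and> l2_adjoint M (A j) B"
    if "j \<in> ?I" for j
    using nonneg_kernel_adjoint[OF sf AK[OF that] a[OF that]] by (simp add: l2_adjoint_def)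
  then obtain A' where A': "\<And>j. j \<in> ?I \<Longrightarrow> l2_bounded M (A' j) K"
    "\<And>j. j \<in> ?I \<Longrightarrow> nonneg_kernel M (A' j) (\<lambda>(x, y). a j (y, x))"
    "\<And>j. j \<in> ?I \<Longrightarrow> l2_adjoint M (A j) (A' j)"
    by metis
  \<comment> \<open>Transposition commutes with the pointwise mean, so the adjoint of C is the
    geometric mean of the adjoints \<open>A' j\<close>.\<close>
  obtain C' where C': "l2_bounded M C' K"
    "nonneg_kernel M C' (\<lambda>(x, y). \<Prod>j\<in>?I. a j (y, x) powr (1 / card ?I))" "l2_adjoint M C C'"
    using nonneg_kernel_adjoint[OF sf CK kC] by (auto simp: l2_adjoint_def)
  define V where "V i b = (if b then A' i else A i)" for i b
  define v where "v i b = (if b then (\<lambda>(x, y). a i (y, x)) else a i)" for i b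
  define CC where "CC b = (if b then C' else C)" for b
  have V: "nonneg_kernel M (V i b) (v i b)" "l2_bounded M (V i b) K"
    "V i b \<in> (if b then set_adjoint M (\<Psi> i) else \<Psi> i)" if i: "i \<in> ?I" for i b
  proof -
    show "nonneg_kernel M (V i b) (v i b)" "l2_bounded M (V i b) K"
      using a[OF i] A'[OF i] AK[OF i] by (simp_all add: V_def v_def)
    have "A' i \<in> set_adjoint M (\<Psi> i)"
      using A[OF i] A'(3)[OF i] l2_bounded_operator[OF A'(1)[OF i]]
      unfolding set_adjoint_def l2_adjoint_def by blast
    then show "V i b \<in> (if b then set_adjoint M (\<Psi> i) else \<Psi> i)"
      using A[OF i] by (simp add: V_def)
  qed
  have CC: "nonneg_kernel M (CC b) (\<lambda>x. \<Prod>i\<in>?I. v i b x powr (1 / card ?I))" "l2_bounded M (CC b) K" for b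
    using kC CK C'(1,2) by (simp_all add: CC_def v_def case_prod_unfold)
  have adj: "l2_adjoint M (CC False) (CC True)" using C'(3) by (simp add: CC_def)
  \<comment> \<open>The column estimate is for nonnegative functions; passing to |f| keeps the norm
    of f and can only increase that of \<open>C f\<close>.\<close>
  define g where "g = (\<lambda>x. complex_of_real (cmod (f x)))"
  have g: "l2_nonneg M g" "l2_norm M g \<le> 1"
    unfolding g_def using l2_nonneg_cmod[OF f(1)] l2_cmod(2)[OF f(1)] f(2) by simp_all
  have "l2_norm M (CC False g) ^ L \<le> (\<Prod>j\<in>?I. r (\<Sigma> j) powr (1 / card ?I))"
  proof (rule geometric_mean_norm_power_le[where V = V and v = v and C = CC and \<sigma> = "column_index m"
        and ?p0.0 = p0 and K = K and K' = K', OF I(1,2) V(1,2) CC adj column_index_bij[OF m] L(1,2) _ p0 r \<Sigma> word[OF V(3)] g])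
    show "column_index m j (p + L) = column_index m j p" for j p
      unfolding L(3) by (rule column_index_periodic)
  qed
  moreover have "l2_norm M (C f) ^ L \<le> l2_norm M (CC False g) ^ L"
    using nonneg_kernel_norm_cmod[OF kC f(1)] by (intro power_mono) (simp_all add: CC_def g_def)
  ultimately show ?thesis using I(3) by simp
qed

theorem theorem3p2:
  fixes M :: "'a measure"
    and m :: nat
    and \<Psi> :: "nat \<Rightarrow> 'a l2op set"
    and r :: "'a l2op set \<Rightarrow> real"
  assumes "sigma_finite_measure M"
    and "space M \<noteq> {}"
    and "m \<ge> 1"
    and "\<And>j A. j \<in> {1..m} \<Longrightarrow> A \<in> \<Psi> j \<Longrightarrow> positive_kernel_operator M A"
    and "\<And>j. j \<in> {1..m} \<Longrightarrow> bounded_operator_set M (\<Psi> j)"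
    and "r \<in> {generalized_spectral_radius M, joint_spectral_radius M}"
  shows
    "(even m \<longrightarrow>
        set_norm M (set_geometric_mean M m (\<lambda>_. 1 / real m) \<Psi>)
          \<le> (r (set_prod (starred_factors M odd \<Psi> [1..<m+1]))
              * r (set_prod (starred_factors M even \<Psi> [1..<m+1]))) powr (1 / (2 * real m))
        \<and> (r (set_prod (starred_factors M odd \<Psi> [1..<m+1]))
              * r (set_prod (starred_factors M even \<Psi> [1..<m+1]))) powr (1 / (2 * real m))
          = (r (set_prod (starred_factors M odd \<Psi> [1..<m+1]))
              * r (set_prod (starred_factors M odd \<Psi> (rev [1..<m+1])))) powr (1 / (2 * real m)))
     \<and> (odd m \<longrightarrow>
        set_norm M (set_geometric_mean M m (\<lambda>_. 1 / real m) \<Psi>)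
          \<le> r (set_prod (starred_factors M even \<Psi> [1..<m+1] @ starred_factors M odd \<Psi> [1..<m+1]))
              powr (1 / (2 * real m)))"
proof -
  note sf = assms(1) and m = assms(3) and r = assms(6)
  have "\<forall>j\<in>{1..m}. \<exists>K. \<forall>A\<in>\<Psi> j. l2_bounded M A K"
    using assms(5) unfolding bounded_operator_set_iff by blast
  from bchoice[OF this] obtain \<kappa> where \<kappa>: "\<forall>j\<in>{1..m}. \<forall>A\<in>\<Psi> j. l2_bounded M A (\<kappa> j)" ..
  \<comment> \<open>One bound for all the sets; absolute values are taken because the chosen
    constant of an empty set may be negative.\<close>
  define K where "K = (\<Sum>j=1..m. \<bar>\<kappa> j\<bar>)"
  have K: "\<forall>j\<in>{1..m}. \<forall>A\<in>\<Psi> j. l2_bounded M A K"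
  proof (intro ballI)
    fix j A assume j: "j \<in> {1..m}" and A: "A \<in> \<Psi> j"
    have "\<kappa> j \<le> \<bar>\<kappa> j\<bar>" by simp
    also have "\<bar>\<kappa> j\<bar> \<le> K" unfolding K_def using j by (intro member_le_sum) auto
    finally show "l2_bounded M A K" using \<kappa> j A l2_bounded_mono by blast
  qed
  moreover have "set [1..<m+1] = {1..m}" by auto
  ultimately have K': "\<forall>i\<in>set [1..<m+1]. \<forall>A\<in>\<Psi> i. l2_bounded M A K" by (simp only:)
  have bd: "l2_bounded M T (K ^ m)" if "T \<in> set_prod (starred_factors M S \<Psi> [1..<m+1])" for S T
    using starred_factors_adjoint(2)[OF K' that] by (simp del: upt_Suc)
  have m0: "0 < real m" "0 < m" using m by simp_all
  show ?thesis
  proof (intro conjI impI)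
    assume even: "even m"
    let ?\<Sigma> = "\<lambda>j. set_prod (starred_factors M (if even j then odd else even) \<Psi> [1..<m+1])"
    let ?O = "r (set_prod (starred_factors M odd \<Psi> [1..<m+1]))"
    let ?E = "r (set_prod (starred_factors M even \<Psi> [1..<m+1]))"
    have OE: "0 \<le> ?O" "0 \<le> ?E" by (rule radius_nonneg[OF r]; use bd in blast)+
    obtain n where n: "m = 2 * n" using even by blast
    \<comment> \<open>The m/2 columns with even j run through the first word and the other m/2
      through the second, each with exponent 1/m.\<close>
    have rhs: "(\<Prod>j=1..m. r (?\<Sigma> j) powr (1 / real m)) = ((?O * ?E) powr (1 / (2 * real m))) ^ m"
    proof -
      have "(\<Prod>j=1..m. r (?\<Sigma> j) powr (1 / real m))
          = (\<Prod>j=1..2 * n. if even j then ?O powr (1 / real m) else ?E powr (1 / real m))"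
        unfolding n by (intro prod.cong) auto
      also have "\<dots> = ((?O * ?E) powr (1 / real m)) ^ n"
        unfolding prod_alternating by (simp only: powr_mult OE)
      also have "(?O * ?E) powr (1 / real m) = ((?O * ?E) powr (1 / (2 * real m))) ^ 2"
        using OE by (simp add: power2_eq_square flip: powr_add)
      finally show ?thesis by (simp add: n flip: power_mult)
    qed
    show "set_norm M (set_geometric_mean M m (\<lambda>_. 1 / real m) \<Psi>) \<le> (?O * ?E) powr (1 / (2 * real m))"
    proof (intro set_norm_le op_norm_leI)
      fix C f assume C: "C \<in> set_geometric_mean M m (\<lambda>_. 1 / real m) \<Psi>"
        and f: "f \<in> l2 M" "l2_norm M f \<le> 1"
      have "l2_norm M (C f) ^ m \<le> (\<Prod>j=1..m. r (?\<Sigma> j) powr (1 / real m))"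
      proof (rule set_geometric_mean_norm_power_le[OF sf m K r even m0(2) _ _ _ _ C f])
        show "m = 1 * m" by simp
        show "j \<le> m" if "j \<in> {1..m}" for j using that by simp
        show "\<forall>A\<in>?\<Sigma> j. l2_bounded M A (K ^ m)" for j using bd by blast
        show "op_iterate (\<lambda>n. V (column_index m j (j + n)) (odd (j + n))) m \<in> ?\<Sigma> j"
          if "\<And>i b. i \<in> {1..m} \<Longrightarrow> V i b \<in> (if b then set_adjoint M (\<Psi> i) else \<Psi> i)" "j \<in> {1..m}" for V j
          by (rule even_column_word[OF that(1) even that(2)])
      qed
      then have "l2_norm M (C f) ^ m \<le> ((?O * ?E) powr (1 / (2 * real m))) ^ m" unfolding rhs .
      then show "l2_norm M (C f) \<le> (?O * ?E) powr (1 / (2 * real m))"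
        using m0(2) by (simp add: power_mono_iff)
    qed simp
    have "?E = r (set_prod (starred_factors M odd \<Psi> (rev [1..<m+1])))"
      by (rule radius_starred_factors_rev[OF r K'])
    then show "(?O * ?E) powr (1 / (2 * real m))
        = (?O * r (set_prod (starred_factors M odd \<Psi> (rev [1..<m+1])))) powr (1 / (2 * real m))"
      by (simp only:)
  next
    assume odd: "odd m"
    let ?\<Sigma> = "set_prod (starred_factors M even \<Psi> [1..<m+1] @ starred_factors M odd \<Psi> [1..<m+1])"
    define p0 where "p0 j = (if even j then j + m else j)" for j
    have bd2: "\<forall>T\<in>?\<Sigma>. l2_bounded M T (K ^ m * K ^ m)"
    proof
      fix T assume "T \<in> ?\<Sigma>"
      then obtain As Bs where "list_all2 (\<in>) As (starred_factors M even \<Psi> [1..<m+1])"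
        "list_all2 (\<in>) Bs (starred_factors M odd \<Psi> [1..<m+1])" and T: "T = foldr (\<circ>) (As @ Bs) id"
        unfolding in_set_prod_iff list_all2_append2 by blast
      then have "foldr (\<circ>) As id \<in> set_prod (starred_factors M even \<Psi> [1..<m+1])"
        "foldr (\<circ>) Bs id \<in> set_prod (starred_factors M odd \<Psi> [1..<m+1])"
        unfolding in_set_prod_iff by blast+
      then show "l2_bounded M T (K ^ m * K ^ m)"
        unfolding T foldr_comp_append by (intro l2_bounded_comp bd)
    qed
    have R0: "0 \<le> r ?\<Sigma>" by (rule radius_nonneg[OF r bd2])
    \<comment> \<open>All m columns have the same word of length 2m, so the exponent 1/m adds up to
      1, to be compared with a norm to the power 2m.\<close>
    have rhs: "(\<Prod>j=1..m. r ?\<Sigma> powr (1 / real m)) = (r ?\<Sigma> powr (1 / (2 * real m))) ^ (2 * m)"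
    proof -
      have "r ?\<Sigma> powr (1 / real m) = (r ?\<Sigma> powr (1 / (2 * real m))) ^ 2"
        by (simp add: power2_eq_square flip: powr_add)
      then show ?thesis by (simp only: prod_constant card_atLeastAtMost diff_Suc_1 power_mult)
    qed
    show "set_norm M (set_geometric_mean M m (\<lambda>_. 1 / real m) \<Psi>) \<le> r ?\<Sigma> powr (1 / (2 * real m))"
    proof (intro set_norm_le op_norm_leI)
      fix C f assume C: "C \<in> set_geometric_mean M m (\<lambda>_. 1 / real m) \<Psi>"
        and f: "f \<in> l2 M" "l2_norm M f \<le> 1"
      have "l2_norm M (C f) ^ (2 * m) \<le> (\<Prod>j=1..m. r ?\<Sigma> powr (1 / real m))"
      proof (rule set_geometric_mean_norm_power_le[OF sf m K r _ _ refl _ bd2 _ C f])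
        show "even (2 * m)" "0 < 2 * m" using m0 by simp_all
        show "p0 j \<le> 2 * m" if "j \<in> {1..m}" for j using that by (simp add: p0_def)
        show "op_iterate (\<lambda>n. V (column_index m j (p0 j + n)) (odd (p0 j + n))) (2 * m) \<in> ?\<Sigma>"
          if "\<And>i b. i \<in> {1..m} \<Longrightarrow> V i b \<in> (if b then set_adjoint M (\<Psi> i) else \<Psi> i)" "j \<in> {1..m}" for V j
          by (rule odd_column_word[OF that(1) odd that(2) p0_def])
      qed
      then have "l2_norm M (C f) ^ (2 * m) \<le> (r ?\<Sigma> powr (1 / (2 * real m))) ^ (2 * m)" unfolding rhs .
      then show "l2_norm M (C f) \<le> r ?\<Sigma> powr (1 / (2 * real m))"
        using m0(2) by (simp add: power_mono_iff)
    qed simp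
  qed
qed

end
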